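(* Let $n,r,d\in\mathbb{Z}_{\geq 1}$, let $\mathbb{K}$ be an algebraically closed field of characteristic $p\geq 0$ such that $p$ does not divide $r$, and let $v_1,\ldots,v_d\in\mathbb{K}$. Let $\hat{\rho}: Y_{r,n}^{d}\to\mathbb{K}$ be the linear map sending the basis element $t_{1}^{s_1}\cdots t_{n}^{s_{n}}x_{1}^{r_1}\cdots x_{n}^{r_{n}}f_{w}$ ($0\leq s_i\leq r-1$, $0\leq r_i\leq d-1$, $w\in\mathfrak{S}_n$) to $1$ if $r_1=\cdots=r_n=d-1$, $s_1\equiv\cdots\equiv s_n\equiv 0\pmod r$ and $w=1$, and to $0$ otherwise. Then $\hat{\rho}$ is a symmetrizing form on $Y_{r,n}^{d}$; hence $Y_{r,n}^{d}$ is a symmetric algebra.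
   Context: **Degenerate cyclotomic Yokonuma-Hecke algebra.** $\widehat{Y}_{r,n}$ is the associative unital $\mathbb{K}$-algebra generated by $t_1,\ldots,t_n,f_1,\ldots,f_{n-1},x_1,\ldots,x_n$ with relations: $f_if_j=f_jf_i$ if $|i-j|\geq 2$; $f_if_{i+1}f_i=f_{i+1}f_if_{i+1}$; $t_it_j=t_jt_i$; $f_it_j=t_{s_i(j)}f_i$; $t_i^r=1$; $f_i^2=1$; $x_ix_j=x_jx_i$; $f_ix_{i+1}=x_if_i+e_i$; $f_ix_j=x_jf_i$ for $j\neq i,i+1$; $t_jx_i=x_it_j$ for all $i,j$; where $s_i=(i,i+1)$ and $e_i=\frac1r\sum_{s=0}^{r-1}t_i^st_{i+1}^{-s}$. For $w=s_{i_1}\cdots s_{i_k}\in\mathfrak{S}_n$ put $f_w=f_{i_1}\cdots f_{i_k}$. Put $Y_{r,n}^d=\widehat{Y}_{r,n}/\langle(x_1-v_1)\cdots(x_1-v_d)\rangle$ (quotient by the two-sided ideal). It is known that $Y_{r,n}^d$ has $\mathbb{K}$-basis $\{t_1^{s_1}\cdots t_n^{s_n}x_1^{r_1}\cdots x_n^{r_n}f_w : 0\leq r_i\leq d-1,\ 0\leq s_i\leq r-1,\ w\in\mathfrak{S}_n\}$. **Symmetric algebras.** A finite dimensional $\mathbb{K}$-algebra $A$ is symmetric if it possesses a symmetrizing form, i.e. a linear form $\tau:A\to\mathbb{K}$ such that $\tau(ab)=\tau(ba)$ for all $a,b\in A$ and whose kernel contains no non-zero left or right ideal of $A$. *)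

theory Defs
  imports
    "HOL-Algebra.Algebra"
    "HOL-Algebra.Algebraic_Closure_Type"
    "HOL-Library.Poly_Mapping"
    "HOL-Combinatorics.Permutations"
begin

section \<open>Associative algebras and symmetric algebras\<close>

text \<open>The locale \<^locale>\<open>algebra\<close> of HOL-Algebra is restricted to commutative algebras. Here the
  base field is a type, turned into a ring record by \<^const>\<open>ring_of_type_algebra\<close>.\<close>

locale assoc_algebra =
  module "ring_of_type_algebra :: 'k ring" A + ring A
  for A :: "('k :: field, 'a) module" (structure) +
  assumes smult_mult_left:
      "x \<in> carrier A \<Longrightarrow> y \<in> carrier A \<Longrightarrow> (c \<odot> x) \<otimes> y = c \<odot> (x \<otimes> y)"
    and smult_mult_right:
      "x \<in> carrier A \<Longrightarrow> y \<in> carrier A \<Longrightarrow> x \<otimes> (c \<odot> y) = c \<odot> (x \<otimes> y)"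

definition finite_dimensional :: "('k :: field, 'a) module \<Rightarrow> bool" where
  "finite_dimensional A \<longleftrightarrow>
     (\<exists>B. finite B \<and> B \<subseteq> carrier A \<and>
       (\<forall>a \<in> carrier A. \<exists>c :: 'a \<Rightarrow> 'k. a = (\<Oplus>\<^bsub>A\<^esub>b \<in> B. c b \<odot>\<^bsub>A\<^esub> b)))"

definition linear_form :: "('k :: field, 'a) module \<Rightarrow> ('a \<Rightarrow> 'k) \<Rightarrow> bool" where
  "linear_form A \<tau> \<longleftrightarrow>
     (\<forall>a \<in> carrier A. \<forall>b \<in> carrier A. \<tau> (a \<oplus>\<^bsub>A\<^esub> b) = \<tau> a + \<tau> b) \<and>
     (\<forall>c. \<forall>a \<in> carrier A. \<tau> (c \<odot>\<^bsub>A\<^esub> a) = c * \<tau> a)"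

definition left_ideal :: "'a set \<Rightarrow> ('a, 'm) ring_scheme \<Rightarrow> bool" where
  "left_ideal J A \<longleftrightarrow>
     additive_subgroup J A \<and> (\<forall>a \<in> carrier A. \<forall>x \<in> J. a \<otimes>\<^bsub>A\<^esub> x \<in> J)"

definition right_ideal :: "'a set \<Rightarrow> ('a, 'm) ring_scheme \<Rightarrow> bool" where
  "right_ideal J A \<longleftrightarrow>
     additive_subgroup J A \<and> (\<forall>a \<in> carrier A. \<forall>x \<in> J. x \<otimes>\<^bsub>A\<^esub> a \<in> J)"

definition symmetrizing_form :: "('k :: field, 'a) module \<Rightarrow> ('a \<Rightarrow> 'k) \<Rightarrow> bool" where
  "symmetrizing_form A \<tau> \<longleftrightarrow>
     linear_form A \<tau> \<and>
     (\<forall>a \<in> carrier A. \<forall>b \<in> carrier A. \<tau> (a \<otimes>\<^bsub>A\<^esub> b) = \<tau> (b \<otimes>\<^bsub>A\<^esub> a)) \<and>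
     (\<forall>J. (left_ideal J A \<or> right_ideal J A) \<and> (\<forall>x \<in> J. \<tau> x = 0) \<longrightarrow> J = {\<zero>\<^bsub>A\<^esub>})"

definition symmetric_algebra :: "('k :: field, 'a) module \<Rightarrow> bool" where
  "symmetric_algebra A \<longleftrightarrow>
     assoc_algebra A \<and> finite_dimensional A \<and> (\<exists>\<tau>. symmetrizing_form A \<tau>)"


section \<open>Algebras given by generators and relations\<close>

text \<open>Words under concatenation, written additively so that \<^type>\<open>poly_mapping\<close> from
  words to \<open>'k\<close> becomes the monoid algebra of the free monoid, i.e. the free algebra on \<open>'g\<close>.\<close>

datatype 'g free_monoid = Word (letters: "'g list")

instantiation free_monoid :: (type) monoid_add
begin

definition "0 = Word []"
definition "u + w = Word (letters u @ letters w)"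

instance
  by standard (simp_all add: zero_free_monoid_def plus_free_monoid_def)

end

definition const :: "'k :: field \<Rightarrow> 'g free_monoid \<Rightarrow>\<^sub>0 'k" where
  "const c = Poly_Mapping.single 0 c"

definition gen :: "'g \<Rightarrow> 'g free_monoid \<Rightarrow>\<^sub>0 'k :: field" where
  "gen g = Poly_Mapping.single (Word [g]) 1"

definition free_algebra :: "'g set \<Rightarrow> ('k :: field, 'g free_monoid \<Rightarrow>\<^sub>0 'k) module" where
  "free_algebra G =
     \<lparr>carrier = {p. \<forall>w \<in> Poly_Mapping.keys p. set (letters w) \<subseteq> G},
      monoid.mult = (*), one = 1, ring.zero = 0, add = (+), module.smult = (\<lambda>c p. const c * p)\<rparr>"

text \<open>The quotient of an algebra by the two-sided ideal generated by \<open>S\<close>; as for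
  \<^const>\<open>rcoset_mult\<close>, scalar multiplication of cosets is defined without choosing
  representatives.\<close>

definition quot_algebra :: "('k :: field, 'a) module \<Rightarrow> 'a set \<Rightarrow> ('k, 'a set) module" where
  "quot_algebra A S = (let Q = A Quot (Idl\<^bsub>A\<^esub> S) in
     \<lparr>carrier = carrier Q, monoid.mult = monoid.mult Q, one = \<one>\<^bsub>Q\<^esub>, ring.zero = \<zero>\<^bsub>Q\<^esub>, add = add Q,
      module.smult = (\<lambda>c C. \<Union>a \<in> C. (Idl\<^bsub>A\<^esub> S) +>\<^bsub>A\<^esub> (c \<odot>\<^bsub>A\<^esub> a))\<rparr>)"

definition quot_proj :: "('k :: field, 'a) module \<Rightarrow> 'a set \<Rightarrow> 'a \<Rightarrow> 'a set" where
  "quot_proj A S a = (Idl\<^bsub>A\<^esub> S) +>\<^bsub>A\<^esub> a"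


section \<open>Degenerate cyclotomic Yokonuma-Hecke algebras\<close>

datatype yh_gen = T_gen nat | F_gen nat | X_gen nat

type_synonym 'k yh_free = "yh_gen free_monoid \<Rightarrow>\<^sub>0 'k"

definition yh_gens :: "nat \<Rightarrow> yh_gen set" where
  "yh_gens n = T_gen ` {1..n} \<union> F_gen ` {1..<n} \<union> X_gen ` {1..n}"

abbreviation yt :: "nat \<Rightarrow> 'k :: field yh_free" where "yt i \<equiv> gen (T_gen i)"
abbreviation yf :: "nat \<Rightarrow> 'k :: field yh_free" where "yf i \<equiv> gen (F_gen i)"
abbreviation yx :: "nat \<Rightarrow> 'k :: field yh_free" where "yx i \<equiv> gen (X_gen i)"

text \<open>As \<open>t\<^sup>r = 1\<close> is one of the relations below, the power \<open>t\<close> to the \<open>-s\<close>, for \<open>0 \<le> s < r\<close>, is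
  written as \<open>t ^ (r - s)\<close>.\<close>

definition ye :: "nat \<Rightarrow> nat \<Rightarrow> 'k :: field yh_free" where
  "ye r i = const (1 / of_nat r) * (\<Sum>s<r. yt i ^ s * yt (i + 1) ^ (r - s))"

text \<open>A relation \<open>a = b\<close> is recorded as the element \<open>a - b\<close>.\<close>

definition yh_relations :: "nat \<Rightarrow> nat \<Rightarrow> 'k :: field yh_free set" where
  "yh_relations r n =
     {yf i * yf j - yf j * yf i | i j. i \<in> {1..<n} \<and> j \<in> {1..<n} \<and> (i + 2 \<le> j \<or> j + 2 \<le> i)} \<union>
     {yf i * yf (i + 1) * yf i - yf (i + 1) * yf i * yf (i + 1) | i. 1 \<le> i \<and> i + 1 < n} \<union>
     {yt i * yt j - yt j * yt i | i j. i \<in> {1..n} \<and> j \<in> {1..n}} \<union>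
     {yf i * yt j - yt (transpose i (i + 1) j) * yf i | i j. i \<in> {1..<n} \<and> j \<in> {1..n}} \<union>
     {yt i ^ r - 1 | i. i \<in> {1..n}} \<union>
     {yf i ^ 2 - 1 | i. i \<in> {1..<n}} \<union>
     {yx i * yx j - yx j * yx i | i j. i \<in> {1..n} \<and> j \<in> {1..n}} \<union>
     {yf i * yx (i + 1) - (yx i * yf i + ye r i) | i. i \<in> {1..<n}} \<union>
     {yf i * yx j - yx j * yf i | i j. i \<in> {1..<n} \<and> j \<in> {1..n} \<and> j \<noteq> i \<and> j \<noteq> i + 1} \<union>
     {yt j * yx i - yx i * yt j | i j. i \<in> {1..n} \<and> j \<in> {1..n}}"

definition affine_yh :: "nat \<Rightarrow> nat \<Rightarrow> ('k :: field, 'k yh_free set) module" where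
  "affine_yh r n = quot_algebra (free_algebra (yh_gens n)) (yh_relations r n)"

definition affine_proj :: "nat \<Rightarrow> nat \<Rightarrow> 'k :: field yh_free \<Rightarrow> 'k yh_free set" where
  "affine_proj r n = quot_proj (free_algebra (yh_gens n)) (yh_relations r n)"

text \<open>Only the parameters \<open>v 1, \<dots>, v d\<close> matter.\<close>

definition cyc_rel :: "nat \<Rightarrow> nat \<Rightarrow> nat \<Rightarrow> (nat \<Rightarrow> 'k :: field) \<Rightarrow> 'k yh_free set" where
  "cyc_rel r n d v = affine_proj r n (prod_list (map (\<lambda>k. yx 1 - const (v k)) [1..<d + 1]))"

definition cyclotomic_yh ::
    "nat \<Rightarrow> nat \<Rightarrow> nat \<Rightarrow> (nat \<Rightarrow> 'k :: field) \<Rightarrow> ('k, 'k yh_free set set) module" where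
  "cyclotomic_yh r n d v = quot_algebra (affine_yh r n) {cyc_rel r n d v}"

definition cyclotomic_proj ::
    "nat \<Rightarrow> nat \<Rightarrow> nat \<Rightarrow> (nat \<Rightarrow> 'k :: field) \<Rightarrow> 'k yh_free \<Rightarrow> 'k yh_free set set" where
  "cyclotomic_proj r n d v p = quot_proj (affine_yh r n) {cyc_rel r n d v} (affine_proj r n p)"

text \<open>\<open>simple_expr n ks w\<close>: \<open>ks = [i\<^sub>1, \<dots>, i\<^sub>k]\<close> encodes an expression of \<open>w\<close> as the product (composition
  of maps) of the adjacent transpositions \<open>(i, i + 1)\<close>, for \<open>i = i\<^sub>1, \<dots>, i\<^sub>k\<close> in this order.\<close>

definition simple_expr :: "nat \<Rightarrow> nat list \<Rightarrow> (nat \<Rightarrow> nat) \<Rightarrow> bool" where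
  "simple_expr n ks w \<longleftrightarrow>
     set ks \<subseteq> {1..<n} \<and> w = foldr (\<lambda>i u. transpose i (i + 1) \<circ> u) ks id"

definition yh_monomial ::
    "nat \<Rightarrow> (nat \<Rightarrow> nat) \<Rightarrow> (nat \<Rightarrow> nat) \<Rightarrow> nat list \<Rightarrow> 'k :: field yh_free" where
  "yh_monomial n s m ks =
     prod_list (map (\<lambda>i. yt i ^ s i) [1..<n + 1]) *
     prod_list (map (\<lambda>i. yx i ^ m i) [1..<n + 1]) *
     prod_list (map yf ks)"

text \<open>The image of \<open>f\<^sub>w\<close> in the algebra does not depend on the expression \<open>ks\<close> chosen for \<open>w\<close>, so all
  of them may be prescribed at once. The value of \<open>\<rho>\<close> outside the carrier is fixed by
  \<^const>\<open>extensional\<close>, so that \<open>\<rho>\<close> as a HOL function is determined by the linear map.\<close>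

definition is_rho_hat ::
    "nat \<Rightarrow> nat \<Rightarrow> nat \<Rightarrow> (nat \<Rightarrow> 'k :: field) \<Rightarrow> ('k yh_free set set \<Rightarrow> 'k) \<Rightarrow> bool" where
  "is_rho_hat r n d v \<rho> \<longleftrightarrow>
     \<rho> \<in> extensional (carrier (cyclotomic_yh r n d v)) \<and>
     linear_form (cyclotomic_yh r n d v) \<rho> \<and>
     (\<forall>s m w ks.
        (\<forall>i \<in> {1..n}. s i \<le> r - 1) \<and> (\<forall>i \<in> {1..n}. m i \<le> d - 1) \<and>
        w permutes {1..n} \<and> simple_expr n ks w \<longrightarrow>
        \<rho> (cyclotomic_proj r n d v (yh_monomial n s m ks)) =
          (if (\<forall>i \<in> {1..n}. m i = d - 1) \<and> (\<forall>i \<in> {1..n}. s i mod r = 0) \<and> w = id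
           then 1 else 0))"

end

theory Submission
  imports Defs
begin

text \<open>Let \<open>M\<close> be the vector space with a basis of formal monomials \<open>t\<^sup>s x\<^sup>m f\<^sub>w\<close>. Left multiplication by the \<open>t\<^sub>j\<close>
  and (through divided differences) by the \<open>f\<^sub>i\<close> makes sense on \<open>M\<close> and preserves the span \<open>V\<close> of the
  monomials with all \<open>m\<^sub>i < d\<close>. Letting \<open>x\<^sub>1\<close> act on \<open>V\<close> by multiplication followed by reduction modulo
  \<open>(x\<^sub>1 - v\<^sub>1)\<cdots>(x\<^sub>1 - v\<^sub>d)\<close>, and the other \<open>x\<^sub>k\<close> as the relations force them to, turns \<open>V\<close> into a
  module over the cyclotomic algebra; conversely the monomials indexing \<open>V\<close> span the algebra, which is
  therefore \<open>V\<close> itself, as a left module, and the form is a coefficient functional on \<open>V\<close>. The trace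
  property is checked on the generators \<open>t\<^sub>j\<close>, \<open>f\<^sub>i\<close>, where right multiplication on \<open>V\<close> is explicit, and on
  \<open>x\<^sub>1\<close>, where the lower terms of \<open>f\<^sub>w x\<^sub>1 - x\<^bsub>w(1)\<^esub> f\<^sub>w\<close> cancel against those of \<open>x\<^bsub>w(1)\<^esub>\<close> acting on
  \<open>V\<close>. Nondegeneracy holds because, up to terms of lower degree, \<open>x\<^sub>k\<close> just raises an exponent.\<close>

\<comment> \<open>Linear independence of the monomials comes from the action: a truncated monomial
  applied to the vector of 1 is the corresponding basis vector. The price is that the relations must
  be verified on V, and the hard one is x_1 x_2 = x_2 x_1: reduction happens in x_1 only, while f_1
  mixes x_1 with x_2, so the commutator does not vanish formally. It is shown to vanish on V, hence
  the many equalities restricted to V; the other pairs then follow through the recursion for the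
  x_k. Elements are recovered from their effect on the vector of 1, so right multiplications enter
  as operators that commute with the whole action. For f and t they merely change indices. For x_1
  no such operator is written down, and a closed formula for f_w x_1 replaces it. The trace identity
  is stable under products, which is why generators suffice. It makes the radical of the form
  two-sided, and nondegeneracy can then use right multiplication by the f_k, free of lower terms, to
  bring w to the identity.\<close>
alias lookup = Poly_Mapping.lookup
alias keys = Poly_Mapping.keys

section \<open>Linear operators on free vector spaces\<close>

definition vscale :: "'k :: field \<Rightarrow> ('i \<Rightarrow>\<^sub>0 'k) \<Rightarrow> 'i \<Rightarrow>\<^sub>0 'k" where
  "vscale c v = Poly_Mapping.map ((*) c) v"

definition bv :: "'i \<Rightarrow> 'i \<Rightarrow>\<^sub>0 'k :: field" where
  "bv i = Poly_Mapping.single i 1"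

text \<open>The scaling is an argument because the targets are both spaces with
  \<open>vscale\<close> and algebras whose scalars act through a central embedding.\<close>

definition lext :: "('k :: field \<Rightarrow> 'a \<Rightarrow> 'a :: ab_group_add) \<Rightarrow> ('i \<Rightarrow> 'a) \<Rightarrow> ('i \<Rightarrow>\<^sub>0 'k) \<Rightarrow> 'a" where
  "lext \<sigma> h v = (\<Sum>i\<in>keys v. \<sigma> (lookup v i) (h i))"

lemma lookup_vscale [simp]: "lookup (vscale c v) i = c * lookup v i"
  by (simp add: vscale_def Poly_Mapping.map.rep_eq when_def)

lemma lookup_bv: "lookup (bv i) j = (if i = j then 1 else 0)"
  by (simp add: bv_def lookup_single when_def)

lemma keys_bv [simp]: "keys (bv i :: 'i \<Rightarrow>\<^sub>0 'k :: field) = {i}"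
  by (simp add: bv_def)

interpretation vs: vector_space vscale
  by unfold_locales (simp_all add: poly_mapping_eq_iff fun_eq_iff lookup_add algebra_simps)

lemma vscale_single [simp]: "vscale c (Poly_Mapping.single i d) = Poly_Mapping.single i (c * d)"
  by (simp add: poly_mapping_eq_iff fun_eq_iff lookup_single when_def)

lemma single_eq_vscale: "Poly_Mapping.single i c = vscale c (bv i)"
  by (simp add: bv_def)

lemma poly_mapping_expansion:
  fixes v :: "'i \<Rightarrow>\<^sub>0 'k :: field"
  shows "v = (\<Sum>i\<in>keys v. vscale (lookup v i) (bv i))"
proof (rule poly_mapping_eqI)
  fix j
  show "lookup v j =
    lookup (\<Sum>i\<in>keys v. vscale (lookup v i) (bv i)) j"
    by (simp add: lookup_sum lookup_bv if_distrib[of "\<lambda>x. _ * x"] in_keys_iff cong: if_cong)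
qed

lemma span_bv_induct [consumes 1, case_names zero basis add]:
  fixes v :: "'i \<Rightarrow>\<^sub>0 'k :: field"
  assumes "keys v \<subseteq> I" and "P 0"
    and "\<And>i c. i \<in> I \<Longrightarrow> P (vscale c (bv i))"
    and "\<And>u w. P u \<Longrightarrow> P w \<Longrightarrow> P (u + w)"
  shows "P v"
proof -
  have "P (\<Sum>i\<in>J. vscale (c i) (bv i))" if "finite J" "J \<subseteq> I" for J and c :: "'i \<Rightarrow> 'k"
    using that by (induction J) (auto intro: assms)
  from this[of "keys v" "lookup v"] show ?thesis
    using assms(1) poly_mapping_expansion[of v] by simp
qed

lemma lext_vscale_bv [simp]: "lext vscale bv v = v"
  unfolding lext_def by (rule poly_mapping_expansion[symmetric])

context vector_space
begin

lemma lext_superset: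
  assumes "finite I" and "keys v \<subseteq> I"
  shows "lext scale h v = (\<Sum>i\<in>I. scale (lookup v i) (h i))"
  unfolding lext_def by (rule sum.mono_neutral_left) (use assms in \<open>auto simp: in_keys_iff\<close>)

lemma lext_add: "lext scale h (u + v) = lext scale h u + lext scale h v"
proof -
  let ?I = "keys u \<union> keys v"
  have "keys (u + v) \<subseteq> ?I" by (rule Poly_Mapping.keys_add)
  then show ?thesis
    by (simp add: lext_superset[of ?I] lookup_add scale_left_distrib sum.distrib)
qed

lemma lext_vscale: "lext scale h (vscale c v) = scale c (lext scale h v)"
proof -
  have "keys (vscale c v) \<subseteq> keys v" by (auto simp: in_keys_iff)
  then show ?thesis
    by (simp add: lext_superset[of "keys v"] scale_sum_right)
qed

lemma lext_bv [simp]: "lext scale h (bv i) = h i"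
  by (simp add: lext_def lookup_bv)

lemma lext_single: "lext scale h (Poly_Mapping.single i c) = scale c (h i)"
  by (simp add: single_eq_vscale lext_vscale)

lemma lext_zero [simp]: "lext scale h 0 = 0"
  by (simp add: lext_def)

lemma lext_minus: "lext scale h (u - v) = lext scale h u - lext scale h v"
  using lext_add[of h "u - v" v] by simp

lemma lext_sum: "lext scale h (\<Sum>x\<in>I. u x) = (\<Sum>x\<in>I. lext scale h (u x))"
  by (induction I rule: infinite_finite_induct) (simp_all add: lext_add)

end

declare [[typedef_overloaded]]

text \<open>An operator is its matrix, column by column, wrapped in a type: linearity is no side
  condition, equality is tested on basis vectors, and composition as \<open>*\<close> makes the ring
  rules available.\<close>

datatype ('i, 'k :: zero) endo = Endo (col: "'i \<Rightarrow> 'i \<Rightarrow>\<^sub>0 'k")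

definition app :: "('i, 'k :: field) endo \<Rightarrow> ('i \<Rightarrow>\<^sub>0 'k) \<Rightarrow> 'i \<Rightarrow>\<^sub>0 'k" where
  "app A v = lext vscale (col A) v"

lemma app_add_right: "app A (u + v) = app A u + app A v"
  by (simp add: app_def vs.lext_add)

lemma app_vscale_right: "app A (vscale c v) = vscale c (app A v)"
  by (simp add: app_def vs.lext_vscale)

lemma app_zero_right [simp]: "app A 0 = 0"
  by (simp add: app_def)

lemma app_minus_right: "app A (u - v) = app A u - app A v"
  by (simp add: app_def vs.lext_minus)

lemma app_sum_right: "app A (\<Sum>x\<in>I. u x) = (\<Sum>x\<in>I. app A (u x))"
  by (simp add: app_def vs.lext_sum)

lemma app_Endo_bv [simp]: "app (Endo h) (bv i) = h i"
  by (simp add: app_def)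

lemma app_bv: "app A (bv i) = col A i"
  by (simp add: app_def)

lemma endo_eqI: "(\<And>i. app A (bv i) = app B (bv i)) \<Longrightarrow> A = B"
  by (rule endo.expand) (simp add: app_bv fun_eq_iff)

instantiation endo :: (type, field) ring_1
begin

definition "0 = Endo (\<lambda>_. 0)"
definition "1 = Endo bv"
definition "A + B = Endo (\<lambda>i. col A i + col B i)"
definition "- A = Endo (\<lambda>i. - col A i)"
definition "A - B = Endo (\<lambda>i. col A i - col B i)"
definition "A * B = Endo (\<lambda>i. app A (col B i))"

lemma app_add_left: "app (A + B) v = app A v + app B v" for A :: "('a, 'b) endo"
  by (simp add: plus_endo_def app_def lext_def vs.scale_right_distrib sum.distrib)

lemma app_mult: "app (A * B) v = app A (app B v)" for A :: "('a, 'b) endo"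
proof (rule span_bv_induct[of v UNIV])
  fix i :: 'a and c :: 'b
  have "app (A * B) (bv i) = app A (app B (bv i))"
    by (simp add: times_endo_def app_bv)
  then show "app (A * B) (vscale c (bv i)) = app A (app B (vscale c (bv i)))"
    by (simp add: app_vscale_right)
qed (simp_all add: app_add_right)

instance
proof
  fix A B C :: "('a, 'b) endo"
  show "A * B * C = A * (B * C)"
    by (rule endo_eqI) (simp add: app_mult)
  show "(A + B) * C = A * C + B * C"
    by (rule endo_eqI) (simp add: app_mult app_add_left)
  show "A * (B + C) = A * B + A * C"
    by (rule endo_eqI) (simp add: app_mult app_add_left app_add_right)
  show "1 * A = A"
    by (rule endo.expand) (simp add: times_endo_def one_endo_def app_def)
  show "A * 1 = A"
    by (rule endo.expand) (simp add: times_endo_def one_endo_def app_bv)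
  have "(bv i :: 'a \<Rightarrow>\<^sub>0 'b) \<noteq> 0" for i
    by (metis keys_bv keys_zero insert_not_empty)
  then show "(0 :: ('a, 'b) endo) \<noteq> 1"
    by (auto simp: zero_endo_def one_endo_def fun_eq_iff)
qed (simp_all add: plus_endo_def zero_endo_def uminus_endo_def minus_endo_def ac_simps)

end

lemma app_zero_left [simp]: "app 0 v = 0"
  by (simp add: zero_endo_def app_def lext_def)

lemma app_one [simp]: "app 1 v = v"
  by (simp add: one_endo_def app_def)

lemma app_minus_left: "app (A - B) v = app A v - app B v"
  using app_add_left[of "A - B" B v] by simp

lemma app_sum_left: "app (\<Sum>x\<in>I. A x) v = (\<Sum>x\<in>I. app (A x) v)"
  by (induction I rule: infinite_finite_induct) (simp_all add: app_add_left)

definition sc :: "'k :: field \<Rightarrow> ('i, 'k) endo" where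
  "sc c = Endo (\<lambda>i. vscale c (bv i))"

lemma app_sc: "app (sc c) v = vscale c v"
proof (rule span_bv_induct[of v UNIV])
  show "app (sc c) (vscale d (bv i)) = vscale c (vscale d (bv i))" for d i
    by (simp only: app_vscale_right) (simp add: sc_def ac_simps)
qed (simp_all add: app_add_right vs.scale_right_distrib)

section \<open>Evaluation of noncommutative polynomials in an algebra with central scalars\<close>

locale central_scalars =
  fixes \<kappa> :: "'k :: field \<Rightarrow> 'a :: ring_1"
  assumes \<kappa>_add: "\<kappa> (a + b) = \<kappa> a + \<kappa> b"
    and \<kappa>_mult: "\<kappa> (a * b) = \<kappa> a * \<kappa> b"
    and \<kappa>_one [simp]: "\<kappa> 1 = 1"
    and \<kappa>_comm: "\<kappa> c * x = x * \<kappa> c"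
begin

sublocale vector_space "\<lambda>c x. \<kappa> c * x"
  by unfold_locales (simp_all add: \<kappa>_add \<kappa>_mult algebra_simps)

text \<open>The universal property of the free algebra. Three assignments of the generators occur:
  to operators (the representation), to the generators themselves (the identity), and to generators
  or 0 (a retraction).\<close>

definition fhom :: "('g \<Rightarrow> 'a) \<Rightarrow> ('g free_monoid \<Rightarrow>\<^sub>0 'k) \<Rightarrow> 'a" where
  "fhom \<phi> = lext (\<lambda>c x. \<kappa> c * x) (\<lambda>w. prod_list (map \<phi> (letters w)))"

lemma fhom_zero [simp]: "fhom \<phi> 0 = 0"
  by (simp add: fhom_def)

lemma fhom_add: "fhom \<phi> (p + q) = fhom \<phi> p + fhom \<phi> q"
  by (simp add: fhom_def lext_add)

lemma fhom_minus: "fhom \<phi> (p - q) = fhom \<phi> p - fhom \<phi> q"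
  by (simp add: fhom_def lext_minus)

lemma fhom_sum: "fhom \<phi> (\<Sum>x\<in>I. p x) = (\<Sum>x\<in>I. fhom \<phi> (p x))"
  by (simp add: fhom_def lext_sum)

lemma fhom_single:
  "fhom \<phi> (Poly_Mapping.single w c) = \<kappa> c * prod_list (map \<phi> (letters w))"
  by (simp add: fhom_def lext_single)

lemma fhom_gen [simp]: "fhom \<phi> (gen g) = \<phi> g"
  by (simp add: gen_def fhom_single)

lemma fhom_const [simp]: "fhom \<phi> (const c) = \<kappa> c"
  by (simp add: const_def fhom_single zero_free_monoid_def)

lemma fhom_one [simp]: "fhom \<phi> 1 = 1"
proof -
  have "1 = (const 1 :: 'x free_monoid \<Rightarrow>\<^sub>0 'k)" by (simp add: const_def)
  then show ?thesis by (metis fhom_const \<kappa>_one)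
qed

lemma fhom_mult: "fhom \<phi> (p * q) = fhom \<phi> p * fhom \<phi> q"
proof (rule span_bv_induct[of p UNIV])
  show "fhom \<phi> (vscale c (bv u) * q) = fhom \<phi> (vscale c (bv u)) * fhom \<phi> q" for c u
  proof (rule span_bv_induct[of q UNIV])
    fix d w
    let ?u = "prod_list (map \<phi> (letters u))" and ?w = "prod_list (map \<phi> (letters w))"
    have "vscale c (bv u) * vscale d (bv w) =
        Poly_Mapping.single (Word (letters u @ letters w)) (c * d)"
      by (simp add: bv_def mult_single plus_free_monoid_def)
    then have "fhom \<phi> (vscale c (bv u) * vscale d (bv w)) = \<kappa> (c * d) * (?u * ?w)"
      by (simp add: fhom_single)
    also have "\<dots> = (\<kappa> c * ?u) * (\<kappa> d * ?w)"
      by (metis \<kappa>_comm \<kappa>_mult mult.assoc)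
    also have "\<dots> = fhom \<phi> (vscale c (bv u)) * fhom \<phi> (vscale d (bv w))"
      by (simp add: bv_def fhom_single)
    finally show "fhom \<phi> (vscale c (bv u) * vscale d (bv w)) =
      fhom \<phi> (vscale c (bv u)) * fhom \<phi> (vscale d (bv w))" .
  qed (simp_all add: fhom_add distrib_left)
qed (simp_all add: fhom_add distrib_right)

lemma fhom_power: "fhom \<phi> (p ^ k) = fhom \<phi> p ^ k"
  by (induction k) (simp_all add: fhom_mult)

lemma fhom_prod_list: "fhom \<phi> (prod_list ps) = prod_list (map (fhom \<phi>) ps)"
  by (induction ps) (simp_all add: fhom_mult)

end

lemma vscale_eq_const_mult: "vscale c p = const c * p"
  by (simp add: vscale_def const_def mult_map_scale_conv_mult)

lemma const_comm: "const c * p = p * const c"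
proof (rule span_bv_induct[of p UNIV])
  show "const c * vscale d (bv w) = vscale d (bv w) * const c" for d w
    by (simp add: const_def bv_def mult_single ac_simps)
qed (simp_all add: algebra_simps)

interpretation free: central_scalars const
proof
  show "const c * p = p * const c" for c :: 'a and p :: "'b free_monoid \<Rightarrow>\<^sub>0 'a"
    by (rule const_comm)
qed (simp_all add: const_def single_add mult_single)

interpretation opr: central_scalars "sc :: 'k :: field \<Rightarrow> ('i, 'k) endo"
proof
  show "sc c * A = A * sc c" for c and A :: "('i, 'k) endo"
    by (rule endo_eqI) (simp add: app_mult app_sc app_vscale_right)
qed (auto intro!: endo_eqI simp: app_mult app_sc app_add_left vs.scale_left_distrib)

section \<open>The affine operators\<close>

text \<open>The index \<open>(m, s, w)\<close> stands for the monomial \<open>t\<^sup>s x\<^sup>m f\<^sub>w\<close>. The operators are left multiplications,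
  except for \<open>opR u\<close> and \<open>opRT r j\<close>, the right multiplications by \<open>f\<^sub>u\<close> and \<open>t\<^sub>j\<close>.\<close>

type_synonym idx = "(nat \<Rightarrow> nat) \<times> (nat \<Rightarrow> nat) \<times> (nat \<Rightarrow> nat)"

abbreviation adj :: "nat \<Rightarrow> nat \<Rightarrow> nat" where "adj i \<equiv> transpose i (Suc i)"

text \<open>Fixing the arguments beyond \<open>r\<close> makes \<open>t\<^sub>j\<^sup>r = 1\<close> hold for all indices, reduced or not.\<close>

definition rot :: "nat \<Rightarrow> nat \<Rightarrow> nat" where
  "rot r a = (if a < r then Suc a mod r else a)"

definition opS :: "nat \<Rightarrow> (idx, 'k :: field) endo" where
  "opS k = Endo (\<lambda>(m, s, w). bv (m(k := Suc (m k)), s, w))"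

definition opT :: "nat \<Rightarrow> nat \<Rightarrow> (idx, 'k :: field) endo" where
  "opT r j = Endo (\<lambda>(m, s, w). bv (m, s(j := rot r (s j)), w))"

definition opE :: "nat \<Rightarrow> nat \<Rightarrow> nat \<Rightarrow> (idx, 'k :: field) endo" where
  "opE r j k = sc (1 / of_nat r) * (\<Sum>a<r. opT r j ^ a * opT r k ^ (r - a))"

text \<open>With \<open>p c c'\<close> in the role of \<open>x\<^sub>i\<^sup>c x\<^bsub>i+1\<^esub>\<^bsup>c'\<^esup>\<close>, this is the divided difference
  \<open>(x\<^sub>i\<^sup>a x\<^bsub>i+1\<^esub>\<^sup>b - x\<^sub>i\<^sup>b x\<^bsub>i+1\<^esub>\<^sup>a) / (x\<^bsub>i+1\<^esub> - x\<^sub>i)\<close>.\<close>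

definition ddsum :: "(nat \<Rightarrow> nat \<Rightarrow> 'a :: ab_group_add) \<Rightarrow> nat \<Rightarrow> nat \<Rightarrow> 'a" where
  "ddsum p a b = (if a \<le> b then \<Sum>c = a..<b. p c (a + b - 1 - c)
     else - (\<Sum>c = b..<a. p c (a + b - 1 - c)))"

definition opD :: "nat \<Rightarrow> (idx, 'k :: field) endo" where
  "opD i = Endo (\<lambda>(m, s, w). ddsum (\<lambda>c c'. bv (m(i := c, Suc i := c'), s, w)) (m i) (m (Suc i)))"

definition opP :: "nat \<Rightarrow> (idx, 'k :: field) endo" where
  "opP i = Endo (\<lambda>(m, s, w). bv (m \<circ> adj i, s \<circ> adj i, adj i \<circ> w))"

text \<open>Iterating f_i x_{i+1} = x_i f_i + e_i moves f_i past x^m and leaves the permuted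
  monomial times f_i plus e_i times the divided difference. The second summand keeps t^s unpermuted,
  which is harmless as e_i t_i = e_i t_{i+1}.\<close>

definition opF :: "nat \<Rightarrow> nat \<Rightarrow> (idx, 'k :: field) endo" where
  "opF r i = opP i + opE r i (Suc i) * opD i"

definition opR :: "(nat \<Rightarrow> nat) \<Rightarrow> (idx, 'k :: field) endo" where
  "opR u = Endo (\<lambda>(m, s, w). bv (m, s, w \<circ> u))"

text \<open>The changed entry is \<open>w j\<close> because f_w t_j = t_{w(j)} f_w.\<close>

definition opRT :: "nat \<Rightarrow> nat \<Rightarrow> (idx, 'k :: field) endo" where
  "opRT r j = Endo (\<lambda>(m, s, w). bv (m, s(w j := rot r (s (w j))), w))"

lemma opS_bv [simp]: "app (opS k) (bv (m, s, w)) = bv (m(k := Suc (m k)), s, w)"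
  by (simp add: opS_def)

lemma opT_bv [simp]: "app (opT r j) (bv (m, s, w)) = bv (m, s(j := rot r (s j)), w)"
  by (simp add: opT_def)

lemma opD_bv:
  "app (opD i) (bv (m, s, w)) =
     ddsum (\<lambda>c c'. bv (m(i := c, Suc i := c'), s, w)) (m i) (m (Suc i))"
  by (simp add: opD_def)

lemma opP_bv [simp]: "app (opP i) (bv (m, s, w)) = bv (m \<circ> adj i, s \<circ> adj i, adj i \<circ> w)"
  by (simp add: opP_def)

lemma opR_bv [simp]: "app (opR u) (bv (m, s, w)) = bv (m, s, w \<circ> u)"
  by (simp add: opR_def)

lemma opRT_bv [simp]: "app (opRT r j) (bv (m, s, w)) = bv (m, s(w j := rot r (s (w j))), w)"
  by (simp add: opRT_def)

lemma idx_endo_eqI: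
  fixes A B :: "(idx, 'k :: field) endo"
  assumes "\<And>m s w. app A (bv (m, s, w)) = app B (bv (m, s, w))"
  shows "A = B"
  by (rule endo_eqI) (use assms in auto)

section \<open>Commutation rules for divided differences, permutations and e_i\<close>

lemma app_ddsum: "app A (ddsum p a b) = ddsum (\<lambda>c c'. app A (p c c')) a b"
  using app_minus_right[of A 0] by (simp add: ddsum_def app_sum_right)

text \<open>This is the twisted Leibniz rule for multiplication by x_{i+1}: the factor emerges as
  x_i (hence \<open>Suc c\<close>), and one undifferentiated term is added. Where the sum is
  negated, that term cancels its last summand.\<close>

lemma ddsum_Suc_right: "ddsum p a (Suc b) = ddsum (\<lambda>c c'. p (Suc c) c') a b + p a b"
proof (cases "a \<le> b")
  case True
  have "(\<Sum>c = a..<Suc b. p c (a + b - c)) = p a b + (\<Sum>c = Suc a..<Suc b. p c (a + b - c))"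
    using True sum.atLeast_Suc_lessThan[of a "Suc b" "\<lambda>c. p c (a + b - c)"] by simp
  also have "(\<Sum>c = Suc a..<Suc b. p c (a + b - c)) = (\<Sum>c = a..<b. p (Suc c) (a + b - Suc c))"
    by (rule sum.shift_bounds_Suc_ivl)
  finally show ?thesis using True by (simp add: ddsum_def)
next
  case False
  have "(\<Sum>c = b..<a. p (Suc c) (a + b - Suc c)) = (\<Sum>c = Suc b..<Suc a. p c (a + b - c))"
    by (rule sum.shift_bounds_Suc_ivl[symmetric])
  also have "\<dots> = (\<Sum>c = Suc b..<a. p c (a + b - c)) + p a b"
    using False by simp
  finally show ?thesis using False by (auto simp: ddsum_def)
qed

lemma ddsum_Suc_left: "ddsum p (Suc a) b = ddsum (\<lambda>c c'. p c (Suc c')) a b - p a b"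
proof (cases "a < b")
  case True
  have "(\<Sum>c = a..<b. p c (Suc (a + b - Suc c))) = (\<Sum>c = a..<b. p c (a + b - c))"
    by (rule sum.cong) (auto intro!: arg_cong[of _ _ "p _"])
  also have "\<dots> = p a b + (\<Sum>c = Suc a..<b. p c (a + b - c))"
    using True by (simp add: sum.atLeast_Suc_lessThan)
  finally show ?thesis using True by (simp add: ddsum_def)
next
  case False
  have "(\<Sum>c = b..<a. p c (Suc (a + b - Suc c))) = (\<Sum>c = b..<a. p c (a + b - c))"
    by (rule sum.cong) (auto intro!: arg_cong[of _ _ "p _"])
  then show ?thesis using False by (auto simp: ddsum_def)
qed

lemma opD_S_Suc: "opD i * opS (Suc i) = opS i * opD i + 1"
proof (rule idx_endo_eqI)
  fix m s w
  let ?p = "\<lambda>c c'. bv (m(i := c, Suc i := c'), s, w) :: idx \<Rightarrow>\<^sub>0 'a"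
  have "app (opD i * opS (Suc i)) (bv (m, s, w)) = ddsum ?p (m i) (Suc (m (Suc i)))"
    by (simp add: app_mult opD_bv fun_upd_twist)
  also have "\<dots> = ddsum (\<lambda>c c'. app (opS i) (?p c c')) (m i) (m (Suc i)) + bv (m, s, w)"
    unfolding ddsum_Suc_right by (simp add: fun_upd_twist)
  also have "\<dots> = app (opS i * opD i + 1) (bv (m, s, w))"
    by (simp add: app_mult app_add_left opD_bv app_ddsum del: opS_bv)
  finally show "app (opD i * opS (Suc i)) (bv (m, s, w) :: idx \<Rightarrow>\<^sub>0 'a) =
    app (opS i * opD i + 1) (bv (m, s, w))" .
qed

lemma opD_S: "opD i * opS i = opS (Suc i) * opD i - 1"
proof (rule idx_endo_eqI)
  fix m s w
  let ?p = "\<lambda>c c'. bv (m(i := c, Suc i := c'), s, w) :: idx \<Rightarrow>\<^sub>0 'a"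
  have "app (opD i * opS i) (bv (m, s, w)) = ddsum ?p (Suc (m i)) (m (Suc i))"
    by (simp add: app_mult opD_bv fun_upd_twist)
  also have "\<dots> = ddsum (\<lambda>c c'. app (opS (Suc i)) (?p c c')) (m i) (m (Suc i)) - bv (m, s, w)"
    unfolding ddsum_Suc_left by (simp add: fun_upd_twist)
  also have "\<dots> = app (opS (Suc i) * opD i - 1) (bv (m, s, w))"
    by (simp add: app_mult app_minus_left opD_bv app_ddsum del: opS_bv)
  finally show "app (opD i * opS i) (bv (m, s, w) :: idx \<Rightarrow>\<^sub>0 'a) =
    app (opS (Suc i) * opD i - 1) (bv (m, s, w))" .
qed

lemma opD_S_other: "j \<noteq> i \<Longrightarrow> j \<noteq> Suc i \<Longrightarrow> opD i * opS j = opS j * opD i"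
  by (rule idx_endo_eqI) (auto simp: app_mult opD_bv app_ddsum fun_upd_twist)

lemma opD_T: "opD i * opT r j = opT r j * opD i"
  by (rule idx_endo_eqI) (simp add: app_mult opD_bv app_ddsum)

lemma opP_S: "opP i * opS j = opS (adj i j) * opP i"
  by (rule idx_endo_eqI) (auto simp: app_mult fun_eq_iff transpose_def intro!: arg_cong[of _ _ bv])

lemma opP_T: "opP i * opT r j = opT r (adj i j) * opP i"
  by (rule idx_endo_eqI) (auto simp: app_mult fun_eq_iff transpose_def intro!: arg_cong[of _ _ bv])

lemma opS_comm: "opS j * opS k = opS k * opS j"
  by (rule idx_endo_eqI) (auto simp: app_mult fun_upd_twist)

lemma opT_comm: "opT r j * opT r k = opT r k * opT r j"
  by (rule idx_endo_eqI) (auto simp: app_mult fun_upd_twist)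

lemma opS_T: "opS j * opT r k = opT r k * opS j"
  by (rule idx_endo_eqI) (auto simp: app_mult)

lemma opT_power_bv: "app (opT r j ^ a) (bv (m, s, w)) = bv (m, s(j := (rot r ^^ a) (s j)), w)"
  by (induction a) (simp_all add: app_mult, simp add: fun_upd_def cong: if_cong)

lemma rot_power: "a < r \<Longrightarrow> (rot r ^^ b) a = (a + b) mod r"
  by (induction b) (simp_all add: rot_def mod_Suc_eq)

lemma rot_power_self: "(rot r ^^ r) a = a"
proof (cases "a < r")
  case False
  then have "(rot r ^^ b) a = a" for b by (induction b) (simp_all add: rot_def)
  then show ?thesis .
qed (simp add: rot_power)

lemma opT_power_self: "opT r j ^ r = 1"
  by (rule idx_endo_eqI) (simp add: opT_power_bv rot_power_self)

lemma intertwine_power: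
  fixes A x y :: "'a :: monoid_mult"
  assumes "A * x = y * A"
  shows "A * x ^ n = y ^ n * A"
proof (induction n)
  case (Suc n)
  have "A * x ^ Suc n = y * (A * x ^ n)" using assms by (simp add: mult.assoc[symmetric])
  then show ?case using Suc by (simp add: mult.assoc)
qed simp

lemma sc_left_commute: "A * (sc c * B) = sc c * (A * B)"
  by (simp only: mult.assoc[symmetric] opr.\<kappa>_comm[of c A])

lemma intertwine_opE:
  assumes "A * opT r j = opT r j' * A" and "A * opT r k = opT r k' * A"
  shows "A * opE r j k = opE r j' k' * A"
proof -
  have *: "A * (opT r j ^ a * opT r k ^ b) = opT r j' ^ a * opT r k' ^ b * A" for a b
  proof -
    have "A * (opT r j ^ a * opT r k ^ b) = opT r j' ^ a * (A * opT r k ^ b)"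
      using intertwine_power[OF assms(1), of a] by (simp add: mult.assoc[symmetric])
    then show ?thesis
      using intertwine_power[OF assms(2), of b] by (simp add: mult.assoc)
  qed
  have "A * opE r j k = sc (1 / of_nat r) * (A * (\<Sum>a<r. opT r j ^ a * opT r k ^ (r - a)))"
    unfolding opE_def by (rule sc_left_commute)
  also have "\<dots> = opE r j' k' * A"
    by (simp only: opE_def sum_distrib_left sum_distrib_right * mult.assoc)
  finally show ?thesis .
qed

lemmas comm_opE = intertwine_opE[where j' = j and k' = k for j k]

lemma opT_E: "opT r l * opE r j k = opE r j k * opT r l"
  by (rule comm_opE) (rule opT_comm)+

lemma opS_E: "opS l * opE r j k = opE r j k * opS l"
  by (rule comm_opE) (rule opS_T)+

text \<open>Applied to summands with \<open>g r = g 0\<close>, where it says that a sum over a full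
  period does not change under a shift.\<close>

lemma sum_lessThan_shift:
  fixes g :: "nat \<Rightarrow> 'a :: ab_group_add"
  shows "(\<Sum>a<r. g (Suc a)) = (\<Sum>a<r. g a) + (g r - g 0)"
  by (induction r) simp_all

text \<open>Multiplication by t_j t_k^(-1) permutes the summands t_j^a t_k^(-a) cyclically.\<close>

lemma opE_T_right: "opE r j k * opT r j = opE r j k * (opT r k :: (idx, 'k :: field) endo)"
proof -
  let ?t = "opT r j :: (idx, 'k) endo" and ?u = "opT r k :: (idx, 'k) endo"
  let ?g = "\<lambda>a. ?t ^ a * ?u ^ (Suc r - a)"
  have "(\<Sum>a<r. ?t ^ a * ?u ^ (r - a)) * ?t = (\<Sum>a<r. ?g (Suc a))"
    unfolding sum_distrib_right
  proof (rule sum.cong)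
    fix a
    have "?u ^ (r - a) * ?t = ?t * ?u ^ (r - a)"
      using intertwine_power[OF opT_comm, of r j k "r - a"] by (rule sym)
    then show "?t ^ a * ?u ^ (r - a) * ?t = ?g (Suc a)"
      by (simp add: mult.assoc) (simp add: mult.assoc[symmetric] power_commutes)
  qed simp
  also have "\<dots> = (\<Sum>a<r. ?g a) + (?g r - ?g 0)"
    by (rule sum_lessThan_shift)
  \<comment> \<open>The exponent \<open>Suc r - a\<close> includes the extra factor, so both
    boundary terms are equal to t_k.\<close>
  also have "?g r - ?g 0 = 0"
    by (simp add: opT_power_self)
  also have "(\<Sum>a<r. ?g a) + 0 = (\<Sum>a<r. ?t ^ a * ?u ^ (r - a)) * ?u"
    unfolding sum_distrib_right add_0_right
    by (rule sum.cong) (simp_all add: Suc_diff_le mult.assoc power_commutes)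
  finally show ?thesis by (simp add: opE_def mult.assoc)
qed

text \<open>The substitution a -> r - a exchanges the two exponents and turns the range 0..r-1 into
  1..r, which t^r = 1 allows to shift back.\<close>

lemma opE_sym: "opE r j k = (opE r k j :: (idx, 'k :: field) endo)"
proof -
  let ?t = "opT r j :: (idx, 'k) endo" and ?u = "opT r k :: (idx, 'k) endo"
  let ?h = "\<lambda>a. ?u ^ a * ?t ^ (r - a)"
  have "(\<Sum>a<r. ?t ^ a * ?u ^ (r - a)) = (\<Sum>a<r. ?h (Suc (r - Suc a)))"
  proof (rule sum.cong)
    fix a assume "a \<in> {..<r}"
    then have "Suc (r - Suc a) = r - a" "r - (r - a) = a" by auto
    moreover have "?u ^ (r - a) * ?t ^ a = ?t ^ a * ?u ^ (r - a)"
      by (rule intertwine_power) (rule intertwine_power[symmetric], rule opT_comm)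
    ultimately show "?t ^ a * ?u ^ (r - a) = ?h (Suc (r - Suc a))" by (simp only:)
  qed simp
  also have "\<dots> = (\<Sum>a<r. ?h (Suc a))"
    by (rule sum.nat_diff_reindex)
  also have "\<dots> = (\<Sum>a<r. ?h a) + (?h r - ?h 0)"
    by (rule sum_lessThan_shift)
  also have "?h r - ?h 0 = 0"
    by (simp add: opT_power_self)
  finally show ?thesis by (simp add: opE_def)
qed

lemma opE_T_adj: "opE r i (Suc i) * opT r (adj i j) = opE r i (Suc i) * opT r j"
  using opE_T_right[of r i "Suc i"] by (auto simp: transpose_def)

text \<open>The permuting summand turns t_j into t_{s_i(j)}, the divided difference does not touch
  t_j, and the two agree because e_i does not distinguish t_i from t_{i+1}.\<close>

lemma opF_T: "opF r i * opT r j = opT r (adj i j) * opF r i"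
proof -
  have "opE r i (Suc i) * opD i * opT r j = opE r i (Suc i) * opT r j * opD i"
    by (simp add: mult.assoc opD_T)
  also have "\<dots> = opT r (adj i j) * opE r i (Suc i) * opD i"
    by (simp add: opE_T_adj opT_E)
  finally show ?thesis
    by (simp add: opF_def distrib_left distrib_right opP_T mult.assoc)
qed

lemma opF_E: "opF r i * opE r j k = opE r (adj i j) (adj i k) * opF r i"
  by (rule intertwine_opE) (rule opF_T)+

lemma opF_E_self: "opF r i * opE r i (Suc i) = opE r i (Suc i) * opF r i"
  by (simp add: opF_E opE_sym[of r "Suc i"])

lemma opF_S_Suc: "opF r i * opS (Suc i) = opS i * opF r i + opE r i (Suc i)"
  by (simp add: opF_def algebra_simps opP_S opD_S_Suc) (simp add: opS_E mult.assoc[symmetric])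

lemma opF_S: "opF r i * opS i = opS (Suc i) * opF r i - opE r i (Suc i)"
  by (simp add: opF_def algebra_simps opP_S opD_S) (simp add: opS_E mult.assoc[symmetric])

lemma opF_S_other: "j \<noteq> i \<Longrightarrow> j \<noteq> Suc i \<Longrightarrow> opF r i * opS j = opS j * opF r i"
  by (simp add: opF_def algebra_simps opP_S opD_S_other) (simp add: opS_E mult.assoc[symmetric])

text \<open>A symmetric monomial has zero divided difference. With exponents 0 this is the situation
  to which \<open>intertwine_zeroI\<close> reduces the relations between the f_i.\<close>

lemma opF_bv_plain:
  assumes "m i = m (Suc i)"
  shows "app (opF r i) (bv (m, s, w)) = bv (m, s \<circ> adj i, adj i \<circ> w)"
proof -
  have "m \<circ> adj i = m" using assms by (auto simp: fun_eq_iff transpose_def)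
  then show ?thesis using assms by (simp add: opF_def app_add_left app_mult opD_bv ddsum_def)
qed

text \<open>An operator that intertwines multiplications by the variables is determined by its values at
  monomials which do not involve them.\<close>

lemma intertwine_zeroI:
  fixes A :: "(idx, 'k :: field) endo"
  assumes "finite K" and "\<And>k. k \<in> K \<Longrightarrow> \<exists>l. A * opS k = opS l * A"
    and "\<And>m s w. (\<And>k. k \<in> K \<Longrightarrow> m k = 0) \<Longrightarrow> app A (bv (m, s, w)) = 0"
  shows "A = 0"
proof (rule idx_endo_eqI)
  fix m s w
  show "app A (bv (m, s, w)) = app 0 (bv (m, s, w))"
  proof (induction "\<Sum>k\<in>K. m k" arbitrary: m rule: less_induct)
    case less
    show ?case
    proof (cases "\<forall>k\<in>K. m k = 0")
      case True
      then show ?thesis using assms(3) by simp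
    next
      case False
      then obtain k where k: "k \<in> K" "m k > 0" by auto
      let ?m = "m(k := m k - 1)"
      have "sum ?m K < sum m K"
        by (rule sum_strict_mono_ex1) (use assms(1) k in auto)
      then have z: "app A (bv (?m, s, w)) = 0" using less by simp
      obtain l where l: "A * opS k = opS l * A" using assms(2) k by blast
      have "app A (bv (m, s, w)) = app A (app (opS k) (bv (?m, s, w)))" using k by simp
      also have "\<dots> = app (A * opS k) (bv (?m, s, w))" by (simp only: app_mult)
      also have "\<dots> = 0" by (simp only: l app_mult z app_zero_right)
      finally show ?thesis by simp
    qed
  qed
qed

section \<open>Coxeter relations for the operators f_i\<close>

lemma opF_square: "opF r i * opF r i = (1 :: (idx, 'k :: field) endo)"
proof -
  let ?F = "opF r i :: (idx, 'k) endo" and ?E = "opE r i (Suc i) :: (idx, 'k) endo"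
  \<comment> \<open>The corrections from the two factors cancel because f_i commutes with
    e_i.\<close>
  have "?F * ?F * opS (Suc i) = ?F * opS i * ?F + ?F * ?E"
    by (simp add: mult.assoc opF_S_Suc distrib_left)
  also have "\<dots> = opS (Suc i) * (?F * ?F)"
    by (simp add: opF_S left_diff_distrib opF_E_self) (simp add: mult.assoc)
  finally have 1: "?F * ?F * opS (Suc i) = opS (Suc i) * (?F * ?F)" .
  have "?F * ?F * opS i = ?F * opS (Suc i) * ?F - ?F * ?E"
    by (simp add: mult.assoc opF_S right_diff_distrib)
  also have "\<dots> = opS i * (?F * ?F)"
    by (simp add: opF_S_Suc distrib_right opF_E_self) (simp add: mult.assoc)
  finally have 2: "?F * ?F * opS i = opS i * (?F * ?F)" .
  have "?F * ?F - 1 = 0"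
  proof (rule intertwine_zeroI[of "{i, Suc i}"])
    show "\<exists>l. (?F * ?F - 1) * opS k = opS l * (?F * ?F - 1)" if "k \<in> {i, Suc i}" for k
      using that 1 2 by (intro exI[of _ k]) (auto simp: left_diff_distrib right_diff_distrib)
    show "app (?F * ?F - 1) (bv (m, s, w)) = 0" if "\<And>k. k \<in> {i, Suc i} \<Longrightarrow> m k = 0" for m s w
      using that by (simp add: app_minus_left app_mult opF_bv_plain comp_assoc) (simp add: o_assoc)
  qed simp
  then show ?thesis by simp
qed

lemma opF_far:
  assumes "i + 2 \<le> j \<or> j + 2 \<le> i"
  shows "opF r i * opF r j = opF r j * (opF r i :: (idx, 'k :: field) endo)"
proof -
  let ?F = "opF r i :: (idx, 'k) endo" and ?G = "opF r j :: (idx, 'k) endo"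
  have E: "?F * opE r j (Suc j) = opE r j (Suc j) * ?F" "?G * opE r i (Suc i) = opE r i (Suc i) * ?G"
    using assms by (auto simp: opF_E transpose_def)
  have ne: "i \<noteq> j" "i \<noteq> Suc j" "Suc i \<noteq> j" "Suc i \<noteq> Suc j" using assms by auto
  note S = opF_S_other[of _ i r] opF_S_other[of _ j r]
  \<comment> \<open>Only one of the two transpositions moves k, so the index on the right is s_i s_j
    applied to k.\<close>
  have comm: "(?F * ?G - ?G * ?F) * opS k = opS (if k \<in> {i, Suc i} then adj i k else adj j k) * (?F * ?G - ?G * ?F)"
    if "k \<in> {i, Suc i, j, Suc j}" for k
  proof -
    have l: "?F * opS i = opS (Suc i) * ?F - opE r i (Suc i)"
      "?F * opS (Suc i) = opS i * ?F + opE r i (Suc i)"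
      "?G * opS j = opS (Suc j) * ?G - opE r j (Suc j)"
      "?G * opS (Suc j) = opS j * ?G + opE r j (Suc j)"
      "?F * opS j = opS j * ?F" "?F * opS (Suc j) = opS (Suc j) * ?F"
      "?G * opS i = opS i * ?G" "?G * opS (Suc i) = opS (Suc i) * ?G"
      using ne by (simp_all add: opF_S opF_S_Suc opF_S_other)
    have l': "?F * (opS i * A) = opS (Suc i) * (?F * A) - opE r i (Suc i) * A"
      "?F * (opS (Suc i) * A) = opS i * (?F * A) + opE r i (Suc i) * A"
      "?G * (opS j * A) = opS (Suc j) * (?G * A) - opE r j (Suc j) * A"
      "?G * (opS (Suc j) * A) = opS j * (?G * A) + opE r j (Suc j) * A"
      "?F * (opS j * A) = opS j * (?F * A)" "?F * (opS (Suc j) * A) = opS (Suc j) * (?F * A)"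
      "?G * (opS i * A) = opS i * (?G * A)" "?G * (opS (Suc i) * A) = opS (Suc i) * (?G * A)"
      for A
      by (simp_all add: l mult.assoc[symmetric] distrib_right left_diff_distrib)
    show ?thesis
      using that ne by (auto simp: left_diff_distrib right_diff_distrib distrib_left mult.assoc l l' E)
  qed
  have "?F * ?G - ?G * ?F = 0"
  proof (rule intertwine_zeroI[of "{i, Suc i, j, Suc j}"])
    have "adj i \<circ> adj j = adj j \<circ> adj i"
      using assms by (auto simp: fun_eq_iff transpose_def)
    then have "f \<circ> adj i \<circ> adj j = f \<circ> adj j \<circ> adj i" "adj i \<circ> (adj j \<circ> f) = adj j \<circ> (adj i \<circ> f)"
      for f :: "nat \<Rightarrow> nat"
      by (simp_all add: o_assoc) (simp_all add: comp_assoc)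
    then show "app (?F * ?G - ?G * ?F) (bv (m, s, w)) = 0"
      if "\<And>k. k \<in> {i, Suc i, j, Suc j} \<Longrightarrow> m k = 0" for m s w
      using that by (simp add: app_minus_left app_mult opF_bv_plain)
  qed (use comm in blast)+
  then show ?thesis by simp
qed

lemma adj_braid: "adj i \<circ> adj (Suc i) \<circ> adj i = adj (Suc i) \<circ> adj i \<circ> adj (Suc i)"
  by (auto simp: fun_eq_iff transpose_def)

lemma opF_braid: "opF r i * opF r (Suc i) * opF r i = opF r (Suc i) * opF r i * (opF r (Suc i) :: (idx, 'k :: field) endo)"
proof -
  let ?F = "opF r i :: (idx, 'k) endo" and ?G = "opF r (Suc i) :: (idx, 'k) endo"
  let ?e = "opE r i (Suc i)" and ?f = "opE r (Suc i) (Suc (Suc i))" and ?g = "opE r i (Suc (Suc i))"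
  let ?x = "opS i" and ?y = "opS (Suc i)" and ?z = "opS (Suc (Suc i))"
  let ?U = "?F * ?G * ?F - ?G * ?F * ?G"
  have l: "?F * ?x = ?y * ?F - ?e" "?F * ?y = ?x * ?F + ?e" "?F * ?z = ?z * ?F"
    "?G * ?y = ?z * ?G - ?f" "?G * ?z = ?y * ?G + ?f" "?G * ?x = ?x * ?G"
    "?F * ?e = ?e * ?F" "?G * ?f = ?f * ?G" "?F * ?f = ?g * ?F" "?G * ?e = ?g * ?G"
    "?F * ?g = ?f * ?F" "?G * ?g = ?e * ?G" "?F * ?F = 1" "?G * ?G = 1"
    by (simp_all only: opF_S opF_S_Suc opF_E_self opF_square)
      (simp_all add: opF_S_other opF_E transpose_def)
  have l': "?F * (?x * A) = ?y * (?F * A) - ?e * A" "?F * (?y * A) = ?x * (?F * A) + ?e * A"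
    "?F * (?z * A) = ?z * (?F * A)"
    "?G * (?y * A) = ?z * (?G * A) - ?f * A" "?G * (?z * A) = ?y * (?G * A) + ?f * A"
    "?G * (?x * A) = ?x * (?G * A)"
    "?F * (?e * A) = ?e * (?F * A)" "?G * (?f * A) = ?f * (?G * A)" "?F * (?f * A) = ?g * (?F * A)"
    "?G * (?e * A) = ?g * (?G * A)" "?F * (?g * A) = ?f * (?F * A)" "?G * (?g * A) = ?e * (?G * A)"
    "?F * (?F * A) = A" "?G * (?G * A) = A" for A
    by (simp_all add: l mult.assoc[symmetric] distrib_right left_diff_distrib)
  \<comment> \<open>Both sides of the braid relation reverse the three variables. Pushing a variable
    through by \<open>l\<close> leaves the same corrections on both sides once
    \<open>?F * ?F = 1\<close> and \<open>?G * ?G = 1\<close> are applied.\<close>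
  have c: "?U * ?x = ?z * ?U" "?U * ?y = ?y * ?U" "?U * ?z = ?x * ?U"
    by (simp_all add: algebra_simps l l')
  have "?U = 0"
  proof (rule intertwine_zeroI[of "{i, Suc i, Suc (Suc i)}"])
    have "f \<circ> adj i \<circ> adj (Suc i) \<circ> adj i = f \<circ> adj (Suc i) \<circ> adj i \<circ> adj (Suc i)"
      "adj i \<circ> (adj (Suc i) \<circ> (adj i \<circ> f)) = adj (Suc i) \<circ> (adj i \<circ> (adj (Suc i) \<circ> f))"
      for f :: "nat \<Rightarrow> nat"
      using adj_braid[of i] by (metis o_assoc)+
    then show "app ?U (bv (m, s, w)) = 0" if "\<And>k. k \<in> {i, Suc i, Suc (Suc i)} \<Longrightarrow> m k = 0" for m s w
      using that by (simp add: app_minus_left app_mult opF_bv_plain)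
  qed (use c in blast)+
  then show ?thesis by simp
qed

lemma opR_comm: "opR u * opS k = opS k * opR u" "opR u * opT r j = opT r j * opR u"
  "opR u * opD i = opD i * opR u" "opR u * opP i = opP i * opR u"
  by (rule idx_endo_eqI; simp add: app_mult opD_bv app_ddsum comp_assoc)+

lemma opR_E: "opR u * opE r j k = opE r j k * opR u"
  by (rule comm_opE) (rule opR_comm)+

lemma opR_F: "opR u * opF r i = opF r i * opR u"
  by (simp add: opF_def algebra_simps opR_comm) (simp add: opR_E opR_comm mult.assoc[symmetric], simp add: opR_comm mult.assoc)

lemma opRT_comm: "opRT r j * opS k = opS k * opRT r j" "opRT r j * opT r l = opT r l * opRT r j"
  "opRT r j * opD i = opD i * opRT r j"
  by (rule idx_endo_eqI; auto simp add: app_mult opD_bv app_ddsum fun_upd_twist)+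

lemma opRT_P: "opRT r j * opP i = opP i * opRT r j"
  by (rule idx_endo_eqI) (auto simp: app_mult fun_eq_iff transpose_def intro!: arg_cong[of _ _ bv])

lemma opRT_E: "opRT r j * opE r k l = opE r k l * opRT r j"
  by (rule comm_opE) (rule opRT_comm)+

lemma opRT_F: "opRT r j * opF r i = opF r i * opRT r j"
  by (simp add: opF_def algebra_simps opRT_P)
    (simp add: opRT_E opRT_comm mult.assoc[symmetric], simp add: opRT_comm mult.assoc)

section \<open>Words in the adjacent transpositions\<close>

lemma add_1_eq_Suc: "i + 1 = Suc i" by simp

definition perm :: "nat list \<Rightarrow> nat \<Rightarrow> nat" where
  "perm ks = foldr (\<lambda>i u. adj i \<circ> u) ks id"

lemma perm_simps [simp]: "perm [] = id" "perm (i # ks) = adj i \<circ> perm ks"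
  by (simp_all add: perm_def)

lemma simple_expr_iff: "simple_expr n ks w \<longleftrightarrow> set ks \<subseteq> {1..<n} \<and> w = perm ks"
  by (simp add: simple_expr_def perm_def add_1_eq_Suc)

lemma perm_append: "perm (ks @ ls) = perm ks \<circ> perm ls"
  by (induction ks) (simp_all add: comp_assoc)

lemma perm_rev: "perm (rev ks) \<circ> perm ks = id" "perm ks \<circ> perm (rev ks) = id"
proof -
  have *: "perm (rev ks) \<circ> perm ks = id" for ks
  proof (induction ks)
    case (Cons i ks)
    have *: "adj i \<circ> (adj i \<circ> p) = p" for p :: "nat \<Rightarrow> nat"
      by (simp add: o_assoc)
    show ?case
      by (simp only: rev.simps perm_append perm_simps comp_id comp_assoc * Cons)
  qed simp
  from this[of ks] this[of "rev ks"]
  show "perm (rev ks) \<circ> perm ks = id" "perm ks \<circ> perm (rev ks) = id" by simp_all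
qed

lemma perm_permutes: "set ks \<subseteq> {1..<n} \<Longrightarrow> perm ks permutes {1..n}"
proof (induction ks)
  case (Cons i ks)
  then have "adj i permutes {1..n}" by (intro permutes_swap_id) auto
  with Cons show ?case unfolding perm_simps by (intro permutes_compose) auto
qed (simp add: permutes_id)

lemma perm_upt: "k \<le> l \<Longrightarrow> perm [k..<l] l = k"
proof (induction k rule: inc_induct)
  case (step k)
  then show ?case by (simp add: upt_conv_Cons)
qed simp

text \<open>Normal form along the chain of symmetric groups: with k = w (Suc l), the cycle
  \<open>perm [k..<Suc l]\<close> sends \<open>Suc l\<close> to k as w does, so that removing it
  leaves a permutation that fixes \<open>Suc l\<close>.\<close>

primrec canon_word :: "nat \<Rightarrow> (nat \<Rightarrow> nat) \<Rightarrow> nat list" where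
  "canon_word 0 w = []"
| "canon_word (Suc l) w = [w (Suc l)..<Suc l] @ canon_word l (perm (rev [w (Suc l)..<Suc l]) \<circ> w)"

lemma canon_word_rest:
  assumes "w permutes {1..Suc l}"
  shows "w (Suc l) \<in> {1..Suc l}" and "perm (rev [w (Suc l)..<Suc l]) \<circ> w permutes {1..l}"
proof -
  let ?k = "w (Suc l)"
  show k: "?k \<in> {1..Suc l}" using assms by (subst permutes_in_image) auto
  let ?w = "perm (rev [?k..<Suc l]) \<circ> w"
  have "perm (rev [?k..<Suc l]) permutes {1..Suc l}"
    using k by (intro perm_permutes) auto
  then have "?w permutes {1..Suc l}" using assms by (rule permutes_compose[rotated])
  moreover have "?w (Suc l) = Suc l"
  proof -
    have "?k = perm [?k..<Suc l] (Suc l)" using k by (intro perm_upt[symmetric]) auto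
    then have "?w (Suc l) = (perm (rev [?k..<Suc l]) \<circ> perm [?k..<Suc l]) (Suc l)"
      by (metis comp_apply)
    then show ?thesis by (simp only: perm_rev id_apply)
  qed
  moreover have "x = Suc l" if "x \<in> {1..Suc l} - {1..l}" for x using that by auto
  ultimately show "?w permutes {1..l}" by (metis permutes_superset)
qed

lemma canon_word_correct: "w permutes {1..l} \<Longrightarrow> perm (canon_word l w) = w \<and> set (canon_word l w) \<subseteq> {1..<l}"
proof (induction l arbitrary: w)
  case (Suc l)
  let ?u = "[w (Suc l)..<Suc l]" and ?w = "perm (rev [w (Suc l)..<Suc l]) \<circ> w"
  have IH: "perm (canon_word l ?w) = ?w" "set (canon_word l ?w) \<subseteq> {1..<l}"
    using Suc.IH[OF canon_word_rest(2)[OF Suc.prems]] by blast+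
  have "perm (canon_word (Suc l) w) = perm ?u \<circ> ?w"
    by (simp only: canon_word.simps perm_append IH)
  also have "\<dots> = w"
    by (simp only: comp_assoc[symmetric] perm_rev id_comp)
  finally have "perm (canon_word (Suc l) w) = w" .
  moreover have "set (canon_word (Suc l) w) \<subseteq> {1..<Suc l}"
    unfolding canon_word.simps set_append
  proof (rule Un_least)
    show "set ?u \<subseteq> {1..<Suc l}" using canon_word_rest(1)[OF Suc.prems] by auto
    show "set (canon_word l ?w) \<subseteq> {1..<Suc l}" using IH(2) by (rule order_trans) auto
  qed
  ultimately show ?case by blast
qed simp

section \<open>The truncated module\<close>

declare One_nat_def [simp del]

lemma intertwine_mult:
  fixes A :: "'a :: semigroup_mult"
  assumes "A * B = B' * A'" and "A' * C = C' * A''"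
  shows "A * (B * C) = B' * C' * A''"
  by (simp only: mult.assoc[symmetric] assms(1)) (simp only: mult.assoc assms(2))

lemma app_mult_eq: "A * B = C \<Longrightarrow> app A (app B u) = app C u"
  by (simp add: app_mult[symmetric])

lemma app_app_eq: "A * B = C * D \<Longrightarrow> app A (app B u) = app C (app D u)"
  by (simp add: app_mult[symmetric])

section \<open>Coordinate subspaces and operators between them\<close>

definition spn :: "'i set \<Rightarrow> ('i \<Rightarrow>\<^sub>0 'k :: field) set" where
  "spn I = {u. keys u \<subseteq> I}"

lemma spn_bv [simp]: "bv i \<in> spn I \<longleftrightarrow> i \<in> I"
  by (simp add: spn_def)

lemma spn_zero [simp]: "0 \<in> spn I"
  by (simp add: spn_def)

lemma spn_lookup: "u \<in> spn I \<longleftrightarrow> (\<forall>i. i \<notin> I \<longrightarrow> lookup u i = 0)"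
  by (auto simp: spn_def in_keys_iff)

lemma spn_add: "u \<in> spn I \<Longrightarrow> v \<in> spn I \<Longrightarrow> u + v \<in> spn I"
  by (simp add: spn_lookup lookup_add)

lemma spn_minus: "u \<in> spn I \<Longrightarrow> v \<in> spn I \<Longrightarrow> u - v \<in> spn I"
  by (simp add: spn_lookup lookup_minus)

lemma spn_uminus: "u \<in> spn I \<Longrightarrow> - u \<in> spn I"
  by (simp add: spn_lookup)

lemma spn_vscale: "u \<in> spn I \<Longrightarrow> vscale c u \<in> spn I"
  by (simp add: spn_lookup)

lemma spn_sum: "(\<And>x. x \<in> B \<Longrightarrow> u x \<in> spn I) \<Longrightarrow> (\<Sum>x\<in>B. u x) \<in> spn I"
  by (simp add: spn_lookup lookup_sum)

lemma spn_mono: "u \<in> spn I \<Longrightarrow> I \<subseteq> J \<Longrightarrow> u \<in> spn J"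
  by (auto simp: spn_def)

lemma spn_ddsum:
  assumes "\<And>c c'. c < max a b \<Longrightarrow> c' < max a b \<Longrightarrow> c + c' + 1 = a + b \<Longrightarrow> p c c' \<in> spn I"
  shows "ddsum p a b \<in> spn I"
  by (auto simp: ddsum_def intro!: spn_sum spn_uminus assms)

lemma spn_induct [consumes 1, case_names zero basis add]:
  assumes "u \<in> spn I" and "P 0" and "\<And>i c. i \<in> I \<Longrightarrow> P (vscale c (bv i))"
    and "\<And>u w. P u \<Longrightarrow> P w \<Longrightarrow> P (u + w)"
  shows "P u"
  by (rule span_bv_induct[of u I]) (use assms in \<open>auto simp: spn_def\<close>)

definition pres :: "('i, 'k :: field) endo \<Rightarrow> 'i set \<Rightarrow> 'i set \<Rightarrow> bool" where
  "pres A I J \<longleftrightarrow> (\<forall>u\<in>spn I. app A u \<in> spn J)"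

lemma presD: "pres A I J \<Longrightarrow> u \<in> spn I \<Longrightarrow> app A u \<in> spn J"
  by (simp add: pres_def)

lemma presI: "(\<And>i. i \<in> I \<Longrightarrow> app A (bv i) \<in> spn J) \<Longrightarrow> pres A I J"
  unfolding pres_def
proof (intro ballI)
  fix u :: "'a \<Rightarrow>\<^sub>0 'b"
  assume "\<And>i. i \<in> I \<Longrightarrow> app A (bv i) \<in> spn J" "u \<in> spn I"
  from this(2,1) show "app A u \<in> spn J"
    by (induction rule: spn_induct) (simp_all add: app_add_right app_vscale_right spn_add spn_vscale)
qed

lemma pres_mult: "pres A J K \<Longrightarrow> pres B I J \<Longrightarrow> pres (A * B) I K"
  by (simp add: pres_def app_mult)

lemma pres_add: "pres A I J \<Longrightarrow> pres B I J \<Longrightarrow> pres (A + B) I J"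
  by (simp add: pres_def app_add_left spn_add)

lemma pres_minus: "pres A I J \<Longrightarrow> pres B I J \<Longrightarrow> pres (A - B) I J"
  by (simp add: pres_def app_minus_left spn_minus)

lemma pres_sc [simp]: "pres (sc c) I I"
  by (simp add: pres_def app_sc spn_vscale)

lemma pres_one [simp]: "pres 1 I I"
  by (simp add: pres_def)

lemma pres_power: "pres A I I \<Longrightarrow> pres (A ^ k) I I"
  by (induction k) (simp_all add: pres_mult)

lemma pres_sum: "(\<And>x. x \<in> B \<Longrightarrow> pres (A x) I J) \<Longrightarrow> pres (\<Sum>x\<in>B. A x) I J"
  by (simp add: pres_def app_sum_left spn_sum)

lemma pres_prod_list: "(\<And>A. A \<in> set As \<Longrightarrow> pres A I I) \<Longrightarrow> pres (prod_list As) I I"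
  by (induction As) (simp_all add: pres_mult[of _ I])

lemma pres_opE:
  fixes I :: "idx set"
  assumes "pres (opT r j :: (idx, 'k :: field) endo) I I" and "pres (opT r k :: (idx, 'k) endo) I I"
  shows "pres (opE r j k :: (idx, 'k) endo) I I"
  unfolding opE_def by (intro pres_mult[of _ I] pres_sum pres_sc pres_power) (rule assms)+

lemma eq_on_spn:
  assumes "\<And>i. i \<in> I \<Longrightarrow> app A (bv i) = app B (bv i)" and "u \<in> spn I"
  shows "app A u = app B u"
  using assms(2,1)
  by (induction rule: spn_induct) (simp_all add: app_add_right app_vscale_right)

text \<open>The coefficient of \<open>x\<^sub>1\<^sup>a\<close>, as an operator.\<close>

definition opK :: "nat \<Rightarrow> (idx, 'k :: field) endo" where
  "opK a = Endo (\<lambda>(m, s, w). if m 1 = a then bv (m(1 := 0), s, w) else 0)"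

lemma opK_bv [simp]:
  "app (opK a) (bv (m, s, w)) = (if m 1 = a then bv (m(1 := 0), s, w) else 0)"
  by (simp add: opK_def)

lemma lookup_opK:
  "lookup (app (opK a) u) (m, s, w) =
     (if m 1 = 0 then lookup u (m(1 := a), s, w) else 0)"
proof (rule span_bv_induct[of u UNIV])
  fix i :: idx and c
  obtain m' s' w' where i: "i = (m', s', w')" by (cases i)
  have "m'(1 := 0) = m \<longleftrightarrow> m 1 = 0 \<and> m' = m(1 := a)" if "m' 1 = a"
    using that by (auto simp: fun_eq_iff)
  then show "lookup (app (opK a) (vscale c (bv i))) (m, s, w) =
    (if m 1 = 0 then lookup (vscale c (bv i)) (m(1 := a), s, w) else 0)"
    by (auto simp: app_vscale_right i lookup_bv)
qed (simp_all only: app_add_right lookup_add, simp_all)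

lemma opK_S1_Suc: "opK (Suc a) * opS 1 = opK a"
  by (rule idx_endo_eqI) (simp add: app_mult)

lemma opK_S: "k \<noteq> 1 \<Longrightarrow> opK a * opS k = opS k * opK a"
  by (rule idx_endo_eqI) (auto simp: app_mult fun_upd_twist)

lemma opK_T: "opK a * opT r j = opT r j * opK a"
  by (rule idx_endo_eqI) (simp add: app_mult)

lemma opK_E: "opK a * opE r j k = opE r j k * opK a"
  by (rule comm_opE) (rule opK_T)+

lemma opK_R: "opR u * opK a = opK a * opR u"
  by (rule idx_endo_eqI) (simp add: app_mult)

lemma opK_RT: "opRT r j * opK a = opK a * opRT r j"
  by (rule idx_endo_eqI) (simp add: app_mult)

lemma ddsum_zero: "ddsum (\<lambda>_ _. 0) a b = 0"
  by (simp add: ddsum_def)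

lemma opK_D: "i \<ge> 2 \<Longrightarrow> opK a * opD i = opD i * opK a"
  by (rule idx_endo_eqI) (auto simp: app_mult opD_bv app_ddsum fun_upd_twist ddsum_zero)

lemma opK_P: "i \<ge> 2 \<Longrightarrow> opK a * opP i = opP i * opK a"
  by (rule idx_endo_eqI) (auto simp: app_mult fun_eq_iff transpose_def intro!: arg_cong[of _ _ bv])

lemma opK_F: "i \<ge> 2 \<Longrightarrow> opK a * opF r i = opF r i * opK a"
  by (simp add: opF_def algebra_simps opK_P)
    (simp add: opK_E mult.assoc[symmetric], simp add: opK_D mult.assoc)

text \<open>At \<open>vs\<close> and \<open>S 1\<close> this is multiplication by the cyclotomic
  polynomial; at \<open>vs\<close> and \<open>opX 1\<close> it is the relation that has to act as
  zero.\<close>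

definition pl :: "'k :: field list \<Rightarrow> ('i, 'k) endo \<Rightarrow> ('i, 'k) endo" where
  "pl cs A = prod_list (map (\<lambda>c. A - sc c) cs)"

lemma pl_Nil [simp]: "pl [] A = 1"
  by (simp add: pl_def)

lemma pl_Cons [simp]: "pl (c # cs) A = (A - sc c) * pl cs A"
  by (simp add: pl_def)

lemma pl_intertwine: "B * A = A' * B \<Longrightarrow> B * pl cs A = pl cs A' * B"
proof (induction cs)
  case (Cons c cs)
  have "B * (A - sc c) = (A' - sc c) * B"
    using Cons.prems opr.\<kappa>_comm[of c B] by (simp add: left_diff_distrib right_diff_distrib)
  then have "B * pl (c # cs) A = (A' - sc c) * (B * pl cs A)"
    by (simp add: mult.assoc[symmetric])
  then show ?case using Cons by (simp add: mult.assoc)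
qed simp

text \<open>The polynomial is monic of degree \<open>length cs\<close>, so multiplying by it moves
  the leading coefficient of g in x_1 unchanged from exponent e to
  \<open>length cs + e\<close>.\<close>

lemma opK_pl:
  assumes "\<And>a. e < a \<Longrightarrow> app (opK a) g = 0"
  shows "length cs + e \<le> a \<Longrightarrow>
    app (opK a) (app (pl cs (opS 1)) g) = (if a = length cs + e then app (opK e) g else 0)"
proof (induction cs arbitrary: a)
  case Nil
  then show ?case using assms[of a] by auto
next
  case (Cons c cs)
  then obtain a' where a': "a = Suc a'" by (cases a) auto
  let ?h = "app (pl cs (opS 1)) g"
  have "app (opK a) (app (opS 1) ?h) = app (opK a') ?h"
    unfolding a' by (rule app_mult_eq) (rule opK_S1_Suc)
  moreover have "app (opK a) ?h = 0"
    using Cons.IH[of a] Cons.prems by auto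
  ultimately have "app (opK a) (app (pl (c # cs) (opS 1)) g) = app (opK a') ?h"
    by (simp add: app_mult app_minus_left app_minus_right app_sc app_vscale_right)
  then show ?case using Cons a' by simp
qed

locale yokonuma =
  fixes n r d :: nat and v :: "nat \<Rightarrow> 'k :: field"
  assumes n_pos: "n \<ge> 1" and r_pos: "r \<ge> 1" and d_pos: "d \<ge> 1"
begin

abbreviation "S \<equiv> opS :: nat \<Rightarrow> (idx, 'k) endo"
abbreviation "T \<equiv> opT r :: nat \<Rightarrow> (idx, 'k) endo"
abbreviation "E \<equiv> opE r :: nat \<Rightarrow> nat \<Rightarrow> (idx, 'k) endo"
abbreviation "F \<equiv> opF r :: nat \<Rightarrow> (idx, 'k) endo"

definition vs :: "'k list" where "vs = map v [1..<d + 1]"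

lemma length_vs [simp]: "length vs = d"
  by (simp add: vs_def)

text \<open>On the truncated module, \<open>x\<^sub>1\<close> creates at most one term with exponent \<open>d\<close>, so that subtracting one
  multiple of the cyclotomic polynomial reduces it. The recursion is
  \<open>x\<^bsub>k+1\<^esub> = f\<^sub>k x\<^sub>k f\<^sub>k + e\<^sub>k f\<^sub>k\<close>; the value at \<open>0\<close> is junk.\<close>

fun opX :: "nat \<Rightarrow> (idx, 'k) endo" where
  "opX 0 = 0"
| "opX (Suc 0) = S 1 - pl vs (S 1) * opK (d - 1)"
| "opX (Suc (Suc k)) =
     F (Suc k) * opX (Suc k) * F (Suc k) + E (Suc k) (Suc (Suc k)) * F (Suc k)"

lemma opX_1: "opX 1 = S 1 - pl vs (S 1) * opK (d - 1)"
  using opX.simps(2) by (simp only: One_nat_def)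

lemma opX_Suc: "k \<ge> 1 \<Longrightarrow> opX (Suc k) = F k * opX k * F k + E k (Suc k) * F k"
  by (cases k) simp_all

declare opX.simps [simp del]

lemma opX_0 [simp]: "opX 0 = 0"
  by (simp add: opX.simps)

lemma opX_induct [case_names zero one Suc]:
  assumes "P 0" and "P 1" and "\<And>k. k \<ge> 1 \<Longrightarrow> P k \<Longrightarrow> P (Suc k)"
  shows "P k"
proof (induction k)
  case (Suc k)
  then show ?case using assms(2) assms(3)[of k] by (cases "k = 0") (simp_all add: One_nat_def)
qed fact

section \<open>Relations of the x_k with t_j, e_i and f_i\<close>

lemma opX_intertwine:
  assumes "A * S 1 = S 1 * A" and "\<And>a. A * opK a = opK a * A"
  shows "A * opX 1 = opX 1 * A"
proof -
  have "A * (pl vs (S 1) * opK (d - 1)) = pl vs (S 1) * (A * opK (d - 1))"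
    using pl_intertwine[OF assms(1), of vs] by (simp add: mult.assoc[symmetric])
  then show ?thesis
    by (simp add: opX_1 assms left_diff_distrib right_diff_distrib mult.assoc)
qed

lemma opT_X: "T j * opX k = opX k * T j"
proof (induction k arbitrary: j rule: opX_induct)
  case one
  show ?case by (intro opX_intertwine) (simp_all add: opS_T opK_T)
next
  case (Suc i)
  let ?i = i
  have tf: "T j * F ?i = F ?i * T (adj ?i j)" by (simp add: opF_T)
  have 1: "T j * (F ?i * opX ?i * F ?i) = F ?i * opX ?i * F ?i * T j"
    by (rule intertwine_mult[OF intertwine_mult[OF tf Suc(2)]]) (simp add: opF_T)
  have "T j * (E ?i (Suc ?i) * F ?i) = E ?i (Suc ?i) * T j * F ?i"
    by (simp add: opT_E mult.assoc[symmetric])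
  also have "\<dots> = E ?i (Suc ?i) * F ?i * T j"
    by (simp add: opF_T mult.assoc) (simp add: mult.assoc[symmetric] opE_T_adj)
  finally show ?case
    using 1 Suc by (simp add: opX_Suc distrib_left distrib_right)
qed simp

lemma opX_E: "opX k * E i j = E i j * opX k"
  by (rule comm_opE) (rule opT_X[symmetric])+

lemma opX_comm:
  assumes "A * S 1 = S 1 * A" and "\<And>a. A * opK a = opK a * A"
    and "\<And>i. A * F i = F i * A" and "\<And>i j. A * E i j = E i j * A"
  shows "A * opX k = opX k * A"
proof (induction k rule: opX_induct)
  case one
  show ?case using opX_intertwine[OF assms(1,2)] by simp
next
  case (Suc i)
  let ?i = i
  have "A * (F ?i * opX ?i * F ?i) = F ?i * opX ?i * F ?i * A"
    by (rule intertwine_mult[OF intertwine_mult[OF assms(3) Suc(2)] assms(3)])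
  moreover have "A * (E ?i (Suc ?i) * F ?i) = E ?i (Suc ?i) * F ?i * A"
    by (rule intertwine_mult[OF assms(4) assms(3)])
  ultimately show ?case using Suc by (simp add: opX_Suc distrib_left distrib_right)
qed simp

lemma opR_X: "opR u * opX k = opX k * opR u"
  by (rule opX_comm) (rule opR_comm opK_R opR_F opR_E)+

lemma opRT_X: "opRT r j * opX k = opX k * opRT r j"
  by (rule opX_comm) (rule opRT_comm opK_RT opRT_F opRT_E)+

lemma opF_X_Suc: "i \<ge> 1 \<Longrightarrow> F i * opX (Suc i) = opX i * F i + E i (Suc i)"
  by (simp add: opX_Suc distrib_left mult.assoc[symmetric] opF_square opF_E_self)
    (simp add: mult.assoc opF_square)

lemma opF_X: "i \<ge> 1 \<Longrightarrow> F i * opX i = opX (Suc i) * F i - E i (Suc i)"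
  by (simp add: opX_Suc distrib_right mult.assoc opF_square)

text \<open>x_j is built from x_1 and the f_k and e_k with k < j; all these k differ from i by at
  least 2.\<close>

lemma opF_X_gt: "1 \<le> j \<Longrightarrow> j < i \<Longrightarrow> F i * opX j = opX j * F i"
proof (induction j rule: opX_induct)
  case one
  then show ?case
    by (intro opX_intertwine) (simp_all add: opF_S_other opK_F)
next
  case (Suc j)
  let ?j = j
  have *: "F i * opX ?j = opX ?j * F i" "F i * F ?j = F ?j * F i"
    using Suc opF_far[of i ?j r] by simp_all
  have "F i * (F ?j * opX ?j * F ?j) = F ?j * opX ?j * F ?j * F i"
    by (rule intertwine_mult[OF intertwine_mult[OF *(2) *(1)] *(2)])
  moreover have "F i * E ?j (Suc ?j) = E ?j (Suc ?j) * F i"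
    using Suc by (simp add: opF_E transpose_def)
  then have "F i * (E ?j (Suc ?j) * F ?j) = E ?j (Suc ?j) * F ?j * F i"
    by (rule intertwine_mult) (rule *)
  ultimately show ?case using Suc by (simp add: opX_Suc distrib_left distrib_right)
qed simp

text \<open>The braid relation turns f_i, as it enters f_{i+1} f_i x_i f_i f_{i+1} from the left,
  into f_{i+1}; this passes x_i and leaves on the right as f_i by the braid relation again.\<close>

lemma opF_X_lt_2:
  assumes "i \<ge> 1"
  shows "F i * opX (Suc (Suc i)) = opX (Suc (Suc i)) * F i"
proof -
  let ?F = "F i" and ?G = "F (Suc i)" and ?X = "opX i"
  let ?e = "E i (Suc i)" and ?f = "E (Suc i) (Suc (Suc i))" and ?g = "E i (Suc (Suc i))"
  have b1: "?F * (?G * ?F) = ?G * (?F * ?G)"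
    using opF_braid[of r i] by (simp add: mult.assoc)
  have b2: "?F * (?G * (?F * A)) = ?G * (?F * (?G * A))" for A
    using arg_cong[OF b1, of "\<lambda>B. B * A"] by (simp add: mult.assoc)
  note b = b1 b2
  have sq: "?F * ?F = 1" "?G * ?G = 1" "?F * (?F * A) = A" "?G * (?G * A) = A" for A
    by (simp_all add: opF_square mult.assoc[symmetric])
  have gx: "?G * ?X = ?X * ?G" "?G * (?X * A) = ?X * (?G * A)" for A
    using opF_X_gt[of i "Suc i"] assms by (simp_all add: mult.assoc[symmetric])
  have e: "?F * (?f * A) = ?g * (?F * A)" "?G * (?e * A) = ?g * (?G * A)" "?F * (?g * A) = ?f * (?F * A)" for A
    by (simp_all add: mult.assoc[symmetric] opF_E transpose_def)
  have x: "opX (Suc (Suc i)) =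
      ?G * (?F * (?X * (?F * ?G))) + ?g * (?G * (?F * ?G)) + ?f * ?G"
    using assms by (simp add: opX_Suc distrib_left distrib_right mult.assoc e)
  have "?F * opX (Suc (Suc i)) = ?G * (?F * (?X * (?G * (?F * ?G)))) + ?f * (?G * ?F) + ?g * (?F * ?G)"
    unfolding x by (simp add: distrib_left e b gx sq)
  \<comment> \<open>To produce a factor f_i on the right, f_i f_{i+1} is expanded to f_{i+1} f_i
    f_{i+1} f_i by the braid relation and f_i^2 = 1.\<close>
  also have "?g * (?F * ?G) = ?g * (?G * (?F * (?G * ?F)))"
    by (simp add: b sq flip: b)
  also have "?G * (?F * (?X * (?G * (?F * ?G)))) + ?f * (?G * ?F) + \<dots> = opX (Suc (Suc i)) * ?F"
    unfolding x by (simp add: distrib_right mult.assoc b)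
  finally show ?thesis .
qed

lemma opF_X_lt:
  assumes "i \<ge> 1" and "i + 2 \<le> j"
  shows "F i * opX j = opX j * F i"
  using assms(2)
proof (induction j rule: dec_induct)
  case base
  then show ?case using opF_X_lt_2[of i] assms by simp
next
  case (step j)
  have *: "F i * opX j = opX j * F i" "F i * F j = F j * F i"
    using step opF_far[of i j r] by simp_all
  have "F i * (F j * opX j * F j) = F j * opX j * F j * F i"
    by (rule intertwine_mult[OF intertwine_mult[OF *(2) *(1)] *(2)])
  moreover have "F i * E j (Suc j) = E j (Suc j) * F i"
    using step by (simp add: opF_E transpose_def)
  then have "F i * (E j (Suc j) * F j) = E j (Suc j) * F j * F i"
    by (rule intertwine_mult) (rule *)
  moreover have "j \<ge> 1" using step by simp
  ultimately show ?case by (simp add: opX_Suc distrib_left distrib_right)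
qed

text \<open>Index functions live on all naturals; their values outside 1..n are pinned to 0 so that
  each monomial has one index.\<close>

definition Aff :: "idx set" where
  "Aff = {(m, s, w). (\<forall>i. i \<notin> {1..n} \<longrightarrow> m i = 0 \<and> s i = 0) \<and> (\<forall>i\<in>{1..n}. s i < r) \<and>
     w permutes {1..n}}"

definition Trn :: "idx set" where
  "Trn = {(m, s, w). (m, s, w) \<in> Aff \<and> (\<forall>i\<in>{1..n}. m i < d)}"

lemma Trn_Aff: "Trn \<subseteq> Aff"
  by (auto simp: Trn_def)

lemma Trn_lt: "(m, s, w) \<in> Trn \<Longrightarrow> m i < d"
  using d_pos by (cases "i \<in> {1..n}") (auto simp: Trn_def Aff_def)

lemma adj_mem: "i \<in> {1..<n} \<Longrightarrow> adj i j \<in> {1..n} \<longleftrightarrow> j \<in> {1..n}"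
  by (auto simp: transpose_def)

lemma Aff_P:
  assumes "(m, s, w) \<in> Aff" and "i \<in> {1..<n}"
  shows "(m \<circ> adj i, s \<circ> adj i, adj i \<circ> w) \<in> Aff"
proof -
  have "adj i permutes {1..n}" using assms(2) by (intro permutes_swap_id) auto
  then show ?thesis
    using assms adj_mem[OF assms(2)] by (auto simp: Aff_def intro: permutes_compose)
qed

lemma rot_less: "a < r \<Longrightarrow> rot r a < r"
  by (simp add: rot_def)

lemma Aff_T: "(m, s, w) \<in> Aff \<Longrightarrow> j \<in> {1..n} \<Longrightarrow> (m, s(j := rot r (s j)), w) \<in> Aff"
  by (auto simp: Aff_def rot_less)

lemma Aff_upd: "(m, s, w) \<in> Aff \<Longrightarrow> k \<in> {1..n} \<Longrightarrow> (m(k := a), s, w) \<in> Aff"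
  by (auto simp: Aff_def)

lemma pres_S_Aff: "k \<in> {1..n} \<Longrightarrow> pres (S k) Aff Aff"
  by (rule presI) (auto simp: Aff_upd)

lemma pres_T_Aff: "j \<in> {1..n} \<Longrightarrow> pres (T j) Aff Aff"
  by (rule presI) (auto simp: Aff_T)

lemma pres_E_Aff: "j \<in> {1..n} \<Longrightarrow> k \<in> {1..n} \<Longrightarrow> pres (E j k) Aff Aff"
  by (intro pres_opE pres_T_Aff)

lemma pres_D_Aff: "i \<in> {1..<n} \<Longrightarrow> pres (opD i) Aff Aff"
  by (rule presI) (auto simp: opD_bv intro!: spn_ddsum Aff_upd)

lemma pres_P_Aff: "i \<in> {1..<n} \<Longrightarrow> pres (opP i) Aff Aff"
  by (rule presI) (auto intro!: Aff_P)

lemma pres_F_Aff: "i \<in> {1..<n} \<Longrightarrow> pres (F i) Aff Aff"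
  unfolding opF_def
  by (intro pres_add pres_mult[of _ Aff] pres_P_Aff pres_E_Aff pres_D_Aff) auto

lemma pres_K_Aff: "pres (opK a) Aff Aff"
  by (rule presI) (use n_pos in \<open>auto intro!: Aff_upd\<close>)

lemma pres_pl: "pres A I I \<Longrightarrow> pres (pl cs A) I I"
  unfolding pl_def by (intro pres_prod_list) (auto intro!: pres_minus)

lemma pres_T_Trn: "j \<in> {1..n} \<Longrightarrow> pres (T j) Trn Trn"
  by (rule presI) (auto simp: Trn_def Aff_T)

lemma pres_E_Trn: "j \<in> {1..n} \<Longrightarrow> k \<in> {1..n} \<Longrightarrow> pres (E j k) Trn Trn"
  by (intro pres_opE pres_T_Trn)

text \<open>A divided difference only produces exponents below the larger of the two it acts on, so
  bounds on exponents survive f_i. There are two predicates because the permuting part moves a bound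
  from one position to the other.\<close>

lemma pres_F_bound:
  assumes "i \<in> {1..<n}"
    and "\<And>m c c'. Q m \<Longrightarrow> c < max (m i) (m (Suc i)) \<Longrightarrow> c' < max (m i) (m (Suc i)) \<Longrightarrow> Q' (m(i := c, Suc i := c'))"
    and "\<And>m. Q m \<Longrightarrow> Q' (m \<circ> adj i)"
  shows "pres (F i) {(m, s, w) \<in> Aff. Q m} {(m, s, w) \<in> Aff. Q' m}"
proof -
  let ?I = "{(m, s, w) \<in> Aff. Q m}" and ?J = "{(m, s, w) \<in> Aff. Q' m}"
  have "pres (opP i) ?I ?J"
    by (rule presI) (use assms(1,3) in \<open>auto intro!: Aff_P\<close>)
  moreover have "pres (opD i) ?I ?J"
    by (rule presI) (use assms(1,2) in \<open>auto simp: opD_bv intro!: spn_ddsum Aff_upd\<close>)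
  moreover have "pres (T j) ?J ?J" if "j \<in> {1..n}" for j
    using that by (intro presI) (auto simp: Aff_T)
  ultimately show ?thesis
    using assms(1) unfolding opF_def by (intro pres_add pres_mult[of _ ?J] pres_opE) auto
qed

lemma Trn_eq: "Trn = {(m, s, w) \<in> Aff. \<forall>i. m i < d}"
  using Trn_lt by (auto simp: Trn_def)

lemma pres_F_Trn: "i \<in> {1..<n} \<Longrightarrow> pres (F i) Trn Trn"
  unfolding Trn_eq by (rule pres_F_bound) (auto simp: less_max_iff_disj intro: less_trans)

lemma pres_R_Trn: "u permutes {1..n} \<Longrightarrow> pres (opR u) Trn Trn"
  by (rule presI) (auto simp: Trn_def Aff_def intro: permutes_compose)

lemma opK_zero_iff: "app (opK a) u = 0 \<longleftrightarrow> (\<forall>(m, s, w)\<in>keys u. m 1 \<noteq> a)"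
proof
  assume "app (opK a) u = 0"
  then have "lookup u (m, s, w) = 0" if "m 1 = a" for m s w
    using lookup_opK[of a u "m(1 := 0)" s w] that by auto
  then show "\<forall>(m, s, w)\<in>keys u. m 1 \<noteq> a" by (auto simp: in_keys_iff)
next
  assume *: "\<forall>(m, s, w)\<in>keys u. m 1 \<noteq> a"
  show "app (opK a) u = 0"
  proof (rule poly_mapping_eqI)
    fix i :: idx
    obtain m s w where i: "i = (m, s, w)" by (cases i)
    have "(m(1 := a), s, w) \<notin> keys u" using * by force
    then show "lookup (app (opK a) u) i = lookup 0 i"
      by (simp add: i lookup_opK in_keys_iff)
  qed
qed

lemma opK_Trn:
  assumes "u \<in> spn Trn" and "d \<le> a"
  shows "app (opK a) u = 0"
  unfolding opK_zero_iff
proof clarify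
  fix m s w assume "(m, s, w) \<in> keys u" "a = m 1"
  moreover from this have "m 1 < d" using assms(1) Trn_lt[of m s w 1] by (auto simp: spn_def)
  ultimately show False using assms(2) by simp
qed

lemma opK_opK:
  fixes u :: "idx \<Rightarrow>\<^sub>0 'k"
  shows "app (opK 0) (app (opK a) u) = app (opK a) u"
    and "b > 0 \<Longrightarrow> app (opK b) (app (opK a) u) = 0"
proof -
  have "opK 0 * opK a = (opK a :: (idx, 'k) endo)"
    by (rule idx_endo_eqI) (simp add: app_mult)
  then show "app (opK 0) (app (opK a) u) = app (opK a) u" by (rule app_mult_eq)
  assume "b > 0"
  then have "opK b * opK a = (0 :: (idx, 'k) endo)"
    by (intro idx_endo_eqI) (simp add: app_mult)
  then show "app (opK b) (app (opK a) u) = 0" by (simp add: app_mult_eq)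
qed

lemma opK_pl_opK:
  assumes "length cs \<le> a"
  shows "app (opK a) (app (pl cs (S 1)) (app (opK b) u)) =
    (if a = length cs then app (opK b) u else 0)"
  using opK_pl[of 0 "app (opK b) u" cs a] assms by (simp add: opK_opK)

lemma pres_X1_Trn: "pres (opX 1) Trn Trn"
  unfolding pres_def
proof
  fix u :: "idx \<Rightarrow>\<^sub>0 'k" assume u: "u \<in> spn Trn"
  \<comment> \<open>Only the other exponents are bounded at first; the exponent of x_1 is controlled
    afterwards through its coefficients.\<close>
  let ?I = "{(m, s, w) \<in> Aff. \<forall>i. i \<noteq> 1 \<longrightarrow> m i < d}"
  have "pres (S 1) ?I ?I"
    by (rule presI) (use n_pos in \<open>auto intro!: Aff_upd\<close>)
  moreover have "pres (opK a) ?I ?I" for a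
    by (rule presI) (use n_pos in \<open>auto intro!: Aff_upd\<close>)
  ultimately have "pres (opX 1) ?I ?I"
    unfolding opX_1 by (intro pres_minus pres_mult[of _ ?I] pres_pl)
  then have X: "app (opX 1) u \<in> spn ?I"
    using u by (auto intro: presD spn_mono simp: Trn_eq)
  \<comment> \<open>For a = d the coefficient created by \<open>S 1\<close> and the leading
    coefficient of the subtracted multiple are both \<open>app (opK (d - 1)) u\<close>; for a > d
    both vanish.\<close>
  have "app (opK a) (app (opX 1) u) = 0" if "d \<le> a" for a
  proof -
    have "a > 0" using that d_pos by linarith
    then obtain a' where a': "a = Suc a'" using gr0_implies_Suc by blast
    have "app (opK a) (app (S 1) u) = app (opK a') u"
      unfolding a' by (rule app_mult_eq) (rule opK_S1_Suc)
    moreover have "app (opK a') u = 0" if "a \<noteq> d"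
      using opK_Trn[OF u, of a'] that \<open>d \<le> a\<close> a' by simp
    moreover have "d - 1 = a'" if "a = d" using that a' by simp
    ultimately show ?thesis
      using that by (auto simp: opX_1 app_minus_left app_minus_right app_mult opK_pl_opK)
  qed
  note * = this
  have "m 1 < d" if "(m, s, w) \<in> keys (app (opX 1) u)" for m s w
  proof (rule ccontr)
    assume "\<not> m 1 < d"
    with * have "app (opK (m 1)) (app (opX 1) u) = 0" by simp
    with that show False unfolding opK_zero_iff by auto
  qed
  note 1 = this
  have "(m, s, w) \<in> Trn" if k: "(m, s, w) \<in> keys (app (opX 1) u)" for m s w
  proof -
    have I: "(m, s, w) \<in> ?I" using X k unfolding spn_def by blast
    have "m i < d" for i using I 1[OF k] by (cases "i = 1") auto
    then show ?thesis using I by (simp add: Trn_eq)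
  qed
  then show "app (opX 1) u \<in> spn Trn" unfolding spn_def by auto
qed

lemma pres_X_Trn: "k \<in> {1..n} \<Longrightarrow> pres (opX k) Trn Trn"
proof (induction k rule: opX_induct)
  case (Suc k)
  then have "pres (opX k) Trn Trn" "pres (F k) Trn Trn" "pres (E k (Suc k)) Trn Trn"
    by (simp_all add: pres_F_Trn pres_E_Trn)
  then show ?case
    using Suc by (simp add: opX_Suc) (intro pres_add pres_mult[of _ Trn])
qed (use pres_X1_Trn in simp_all)

text \<open>A nonzero multiple of a monic polynomial of degree d in x_1 has degree at least d in
  x_1, whereas truncated vectors have smaller degree.\<close>

lemma pl_S1_Trn_zero:
  assumes "app (pl vs (S 1)) g \<in> spn Trn"
  shows "app (pl vs (S 1)) g = 0"
proof (rule ccontr)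
  assume "app (pl vs (S 1)) g \<noteq> 0"
  then have g: "keys g \<noteq> {}" by auto
  let ?M = "(\<lambda>(m, s, w). m 1) ` keys g"
  define e where "e = Max ?M"
  have "m 1 \<le> e" if "(m, s, w) \<in> keys g" for m s w
    unfolding e_def using that by (intro Max_ge) (auto intro: rev_image_eqI)
  then have "app (opK a) g = 0" if "e < a" for a
    using that unfolding opK_zero_iff by fastforce
  then have "app (opK (d + e)) (app (pl vs (S 1)) g) = app (opK e) g"
    using opK_pl[of e g vs "d + e"] by simp
  moreover have "e \<in> ?M" unfolding e_def using g by (intro Max_in) auto
  then have "app (opK e) g \<noteq> 0" unfolding opK_zero_iff by auto
  ultimately show False using opK_Trn[OF assms, of "d + e"] by simp
qed

text \<open>Let p have the roots \<open>cs\<close>. Then f_1 p(x_1) = p(x_2) f_1 - e_1 (p(x_2) -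
  p(x_1)) / (x_2 - x_1), and the coefficient of x_1^(d-1) in the quotient is 1 if p has degree d and
  0 if its degree is smaller.\<close>

lemma opK_F_pl:
  assumes "d \<ge> length cs" and g: "g = app (opK a) u"
  shows "app (opK (d - 1)) (app (F 1) (app (pl cs (S 1)) g)) =
    app (pl cs (S 2)) (app (opK (d - 1)) (app (F 1) g)) -
      (if length cs = d then app (E 1 2) g else 0)"
  using assms(1)
proof (induction cs)
  case Nil
  then show ?case using d_pos by simp
next
  case (Cons c cs)
  let ?h = "app (pl cs (S 1)) g" and ?K = "opK (d - 1) :: (idx, 'k) endo"
  have FS: "F 1 * S 1 = S 2 * F 1 - E 1 2"
    using opF_S[of r 1] by (simp add: numeral_2_eq_2 One_nat_def)
  have FSz: "app (F 1) (app (S 1) z) = app (S 2) (app (F 1) z) - app (E 1 2) z" for z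
    using app_mult_eq[OF FS] by (simp add: app_minus_left app_mult)
  have "app (F 1) (app (pl (c # cs) (S 1)) g) =
      app (S 2) (app (F 1) ?h) - app (E 1 2) ?h - vscale c (app (F 1) ?h)"
    by (simp add: app_mult app_minus_left app_minus_right app_sc app_vscale_right FSz)
  moreover have "app ?K (app (S 2) z) = app (S 2) (app ?K z)" for z
    by (rule app_app_eq) (rule opK_S, simp)
  moreover have "app ?K (app (E 1 2) z) = app (E 1 2) (app ?K z)" for z
    by (rule app_app_eq) (rule opK_E)
  moreover have "app ?K ?h = (if length (c # cs) = d then g else 0)"
    using opK_pl_opK[of cs "d - 1" a u] Cons.prems by (auto simp: g)
  ultimately show ?case
    using Cons by (auto simp: app_mult app_minus_left app_minus_right app_sc app_vscale_right)
qed

text \<open>Root by root: (x_1 - c)(x_2 - c) is symmetric, hence commutes with f_1.\<close>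

lemma opF_pl_pl: "F 1 * (pl cs (S 1) * pl cs (S 2)) = pl cs (S 1) * pl cs (S 2) * F 1"
proof (induction cs)
  case (Cons c cs)
  let ?x = "S 1" and ?y = "S 2" and ?c = "sc c :: (idx, 'k) endo"
  have FS: "F 1 * ?x = ?y * F 1 - E 1 2" "F 1 * ?y = ?x * F 1 + E 1 2"
    using opF_S[of r 1] opF_S_Suc[of r 1] by (simp_all add: numeral_2_eq_2 One_nat_def)
  have FS': "F 1 * (?x * A) = ?y * (F 1 * A) - E 1 2 * A" for A
    using FS(1) by (simp add: mult.assoc[symmetric] left_diff_distrib)
  have c: "F 1 * ?c = ?c * F 1" "F 1 * (?c * A) = ?c * (F 1 * A)" "?x * ?c = ?c * ?x" "?y * ?c = ?c * ?y"
    "?x * (?c * A) = ?c * (?x * A)" "?y * (?c * A) = ?c * (?y * A)" for A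
    by (simp_all only: sc_left_commute) (simp_all only: opr.\<kappa>_comm)
  have 1: "F 1 * ((?x - ?c) * (?y - ?c)) = (?x - ?c) * (?y - ?c) * F 1"
    by (simp add: left_diff_distrib right_diff_distrib distrib_left mult.assoc FS FS' c opS_E)
      (simp add: opS_comm[of 2 1] mult.assoc[symmetric])
  have "pl cs ?x * (?y - ?c) = (?y - ?c) * pl cs ?x"
    using pl_intertwine[of "?y - ?c" ?x ?x cs]
    by (simp add: left_diff_distrib right_diff_distrib opS_comm[of 2 1] c)
  then have 2: "pl (c # cs) ?x * pl (c # cs) ?y = ((?x - ?c) * (?y - ?c)) * (pl cs ?x * pl cs ?y)"
    by (simp add: mult.assoc) (simp add: mult.assoc[symmetric])
  show ?case unfolding 2 by (rule intertwine_mult[OF 1 Cons])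
qed simp

text \<open>The commutator of \<open>x\<^sub>1\<close> and \<open>x\<^sub>2\<close> takes values which are truncated and, at the same time, multiples of
  the cyclotomic polynomial in \<open>x\<^sub>1\<close>.\<close>

lemma opX_1_2:
  assumes u: "u \<in> spn Trn" and "n \<ge> 2"
  shows "app (opX 1) (app (opX 2) u) = app (opX 2) (app (opX 1) u)"
proof -
  let ?x = "S 1" and ?y = "S 2" and ?K = "opK (d - 1) :: (idx, 'k) endo"
  let ?C = "pl vs (S 1)" and ?C' = "pl vs (S 2)" and ?F = "F 1" and ?E = "E 1 2" and ?X = "opX 2"
  have "?F * ?x = ?y * ?F - ?E" "?F * ?y = ?x * ?F + ?E"
    using opF_S[of r 1] opF_S_Suc[of r 1] by (simp_all add: numeral_2_eq_2 One_nat_def)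
  then have FS: "?F * ?x = ?y * ?F - ?E" "?x * ?F = ?F * ?y - ?E" by simp_all
  have FS': "?x * (?F * A) = ?F * (?y * A) - ?E * A" for A
    using FS(2) by (simp add: mult.assoc[symmetric] left_diff_distrib)
  have com: "?y * ?K = ?K * ?y" "?y * ?C = ?C * ?y" "?E * ?C = ?C * ?E" "?E * ?K = ?K * ?E" "?y * ?x = ?x * ?y"
    by (simp_all add: opK_S opK_E opS_comm[of 2 1] opS_E pl_intertwine)
  have com': "?y * (?K * A) = ?K * (?y * A)" "?y * (?C * A) = ?C * (?y * A)" "?E * (?C * A) = ?C * (?E * A)"
    "?E * (?K * A) = ?K * (?E * A)" "?y * (?x * A) = ?x * (?y * A)" for A
    by (simp_all only: mult.assoc[symmetric] com)
  have FF: "?F * ?F = 1" by (rule opF_square)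
  have "opX 2 = ?F * opX 1 * ?F + ?E * ?F"
    using opX_Suc[of 1] by (simp add: numeral_2_eq_2 One_nat_def)
  also have "\<dots> = ?y - ?F * (?C * (?K * ?F))"
    by (simp add: opX_1 left_diff_distrib right_diff_distrib mult.assoc[symmetric] FS)
      (simp add: mult.assoc FF)
  finally have X2: "?X = ?y - ?F * (?C * (?K * ?F))" .
  have "opX 1 * ?X - ?X * opX 1 = ?x * ?X - ?C * (?K * ?X) - ?X * (?x - ?C * ?K)"
    by (simp add: opX_1 left_diff_distrib mult.assoc)
  also have "?x * ?X - ?X * (?x - ?C * ?K) =
      ?C * (?E * (?K * ?F) + ?y * ?K) - ?F * (?C * (?K * ?E + ?K * (?F * (?C * ?K))))"
    unfolding X2
    by (simp add: left_diff_distrib right_diff_distrib distrib_left mult.assoc FS FS' com com')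
  then have "?x * ?X - ?C * (?K * ?X) - ?X * (?x - ?C * ?K) =
      ?C * (?E * (?K * ?F) + ?y * ?K - ?K * ?X) - ?F * (?C * (?K * ?E + ?K * (?F * (?C * ?K))))"
    by (simp add: right_diff_distrib algebra_simps)
  finally have D: "opX 1 * ?X - ?X * opX 1 =
      ?C * (?E * (?K * ?F) + ?y * ?K - ?K * ?X) - ?F * (?C * (?K * ?E + ?K * (?F * (?C * ?K))))" .
  \<comment> \<open>By \<open>opK_F_pl\<close> the correction by e_1 cancels against
    \<open>?K * ?E\<close>, and a multiple of the polynomial in x_2 remains. Together with
    \<open>?C\<close> it is symmetric and passes f_1, so that the second summand of \<open>D\<close>
    becomes a multiple of \<open>?C\<close> as well.\<close>
  have "app (?K * ?E + ?K * (?F * (?C * ?K))) u = app ?C' (app ?K (app ?F (app ?K u)))"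
    using opK_F_pl[of vs "app ?K u" "d - 1" u]
    by (simp add: app_add_left app_mult[symmetric] com mult.assoc)
  then have "app (?F * (?C * (?K * ?E + ?K * (?F * (?C * ?K))))) u =
      app (?F * (?C * ?C')) (app ?K (app ?F (app ?K u)))"
    by (simp add: app_mult)
  also have "\<dots> = app ?C (app (?C' * ?F) (app ?K (app ?F (app ?K u))))"
    by (simp add: opF_pl_pl) (simp add: app_mult)
  finally have "app (opX 1 * ?X - ?X * opX 1) u =
    app ?C (app (?E * (?K * ?F) + ?y * ?K - ?K * ?X) u - app (?C' * ?F) (app ?K (app ?F (app ?K u))))"
    by (simp add: D app_minus_left app_mult[of ?C] app_minus_right)
  moreover have "app (opX 1 * ?X - ?X * opX 1) u \<in> spn Trn"
    by (rule presD[OF _ u]) (use \<open>n \<ge> 2\<close> in \<open>intro pres_minus pres_mult[of _ Trn] pres_X_Trn; simp\<close>)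
  ultimately have "app (opX 1 * ?X - ?X * opX 1) u = 0"
    using pl_S1_Trn_zero by metis
  then show ?thesis by (simp add: app_minus_left app_mult)
qed

end

section \<open>Commutation of the x_k on the truncated module\<close>

context yokonuma
begin

text \<open>Commutation of the x_k is established on the truncated module only, so the relations are
  stated as equality there.\<close>

definition eqV :: "(idx, 'k) endo \<Rightarrow> (idx, 'k) endo \<Rightarrow> bool" where
  "eqV A B \<longleftrightarrow> (\<forall>u\<in>spn Trn. app A u = app B u)"

lemma eqVD: "eqV A B \<Longrightarrow> u \<in> spn Trn \<Longrightarrow> app A u = app B u"
  by (simp add: eqV_def)

lemma eqV_refl [simp]: "eqV A A"
  by (simp add: eqV_def)

lemma eqV_sym: "eqV A B \<Longrightarrow> eqV B A"
  by (simp add: eqV_def)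

lemma eqV_add: "eqV A A' \<Longrightarrow> eqV B B' \<Longrightarrow> eqV (A + B) (A' + B')"
  by (simp add: eqV_def app_add_left)

text \<open>x_{k+1} is an expression in x_k, f_k and e_k. The hypothesis on x_k is applied to
  \<open>app (F k) u\<close>, which lies in the truncated module again.\<close>

lemma eqV_X_step:
  assumes A: "A * F k = F k * A" "A * E k (Suc k) = E k (Suc k) * A"
    and k: "k \<in> {1..<n}" and X: "eqV (A * opX k) (opX k * A)"
  shows "eqV (A * opX (Suc k)) (opX (Suc k) * A)"
proof -
  have "eqV (F k * ((A * opX k) * F k)) (F k * ((opX k * A) * F k))"
    unfolding eqV_def
  proof
    fix u :: "idx \<Rightarrow>\<^sub>0 'k" assume "u \<in> spn Trn"
    then have "app (F k) u \<in> spn Trn" using k by (intro presD[OF pres_F_Trn])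
    from eqVD[OF X this]
    show "app (F k * ((A * opX k) * F k)) u = app (F k * ((opX k * A) * F k)) u"
      by (simp add: app_mult)
  qed
  moreover have "F k * ((A * opX k) * F k) = A * (F k * opX k * F k)"
    by (simp add: mult.assoc[symmetric] A)
  moreover have "F k * ((opX k * A) * F k) = (F k * opX k * F k) * A"
    by (simp add: mult.assoc A)
  moreover have "A * (E k (Suc k) * F k) = E k (Suc k) * F k * A"
    by (rule intertwine_mult) (rule A)+
  ultimately have "eqV (A * (F k * opX k * F k) + A * (E k (Suc k) * F k))
      (F k * opX k * F k * A + E k (Suc k) * F k * A)"
    by (intro eqV_add) simp_all
  then show ?thesis using k by (simp add: opX_Suc distrib_left distrib_right)
qed

text \<open>From k = 2 on, x_1 commutes with f_k, so the vanishing of the commutator of x_1 and x_2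
  propagates upwards.\<close>

lemma opX_1_comm: "k \<in> {1..n} \<Longrightarrow> eqV (opX 1 * opX k) (opX k * opX 1)"
proof (induction k rule: opX_induct)
  case (Suc k)
  show ?case
  proof (cases "k = 1")
    case True
    then have "Suc k = 2" "n \<ge> 2" using Suc by (simp_all add: One_nat_def numeral_2_eq_2)
    then show ?thesis using opX_1_2 by (auto simp: eqV_def app_mult)
  next
    case False
    with Suc show ?thesis
      by (intro eqV_X_step) (simp_all add: opF_X_gt opX_E)
  qed
qed simp_all

text \<open>Induction on the smaller index: passing from x_j to x_{j+1} only requires that f_j
  commute with x_k, which holds for k > j + 1.\<close>

lemma opX_less_comm: "1 \<le> j \<Longrightarrow> j < k \<Longrightarrow> k \<le> n \<Longrightarrow> eqV (opX k * opX j) (opX j * opX k)"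
proof (induction j rule: opX_induct)
  case one
  then show ?case using eqV_sym[OF opX_1_comm[of k]] by simp
next
  case (Suc j)
  then show ?case by (intro eqV_X_step) (simp_all add: opF_X_lt opX_E)
qed simp

lemma opX_comm_Trn:
  assumes "j \<in> {1..n}" and "k \<in> {1..n}"
  shows "eqV (opX j * opX k) (opX k * opX j)"
  using assms opX_less_comm[of j k] opX_less_comm[of k j]
  by (cases j k rule: linorder_cases) (auto intro: eqV_sym)

section \<open>Monomials on which x_k acts without reduction\<close>

definition Low :: "nat \<Rightarrow> idx set" where
  "Low k = {(m, s, w) \<in> Aff. (\<forall>i. m i < d) \<and> m k + 1 < d}"

text \<open>f_k exchanges the roles of x_k and x_{k+1} and keeps the bound, as divided differences
  produce exponents at most d - 2. By the induction hypothesis f_k x_k f_k + e_k f_k may then be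
  computed with the unreduced \<open>S k\<close>, where it equals \<open>S (Suc k)\<close>.\<close>

lemma opX_S:
  assumes "k \<in> {1..n}" and "u \<in> spn (Low k)"
  shows "app (opX k) u = app (S k) u"
  using assms
proof (induction k arbitrary: u rule: opX_induct)
  case one
  have "app (opK (d - 1)) u = 0"
    unfolding opK_zero_iff using one(2) by (fastforce simp: spn_def Low_def)
  then show ?case by (simp add: opX_1 app_minus_left app_mult)
next
  case (Suc k)
  have k: "k \<in> {1..<n}" using Suc by auto
  have "pres (F k) (Low (Suc k)) (Low k)"
    unfolding Low_def using k
  proof (rule pres_F_bound)
    fix m :: "nat \<Rightarrow> nat" and c c'
    assume m: "(\<forall>i. m i < d) \<and> m (Suc k) + 1 < d" and c: "c < max (m k) (m (Suc k))" "c' < max (m k) (m (Suc k))"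
    have "m k < d" "m (Suc k) < d" using m by auto
    then have "c + 1 < d" "c' + 1 < d" using c by linarith+
    then show "(\<forall>i. (m(k := c, Suc k := c')) i < d) \<and> (m(k := c, Suc k := c')) k + 1 < d"
      using m by auto
  qed simp
  from presD[OF this Suc(4)] have "app (opX k) (app (F k) u) = app (S k) (app (F k) u)"
    by (intro Suc.IH) (use k in auto)
  then have "app (opX (Suc k)) u = app (F k * S k * F k + E k (Suc k) * F k) u"
    using Suc by (simp add: opX_Suc app_add_left app_mult)
  also have "F k * S k * F k + E k (Suc k) * F k = S (Suc k)"
    by (simp add: opF_S left_diff_distrib mult.assoc opF_square)
  finally show ?case .
qed simp

lemma opX_bv:
  assumes "(m, s, w) \<in> Trn" and "k \<in> {1..n}" and "m k + 1 < d"
  shows "app (opX k) (bv (m, s, w)) = bv (m(k := Suc (m k)), s, w)"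
  using assms by (subst opX_S) (auto simp: Trn_eq Low_def)

lemma Trn_upd: "(m, s, w) \<in> Trn \<Longrightarrow> k \<in> {1..n} \<Longrightarrow> a < d \<Longrightarrow> (m(k := a), s, w) \<in> Trn"
  by (auto simp: Trn_eq Aff_upd)

lemma opX_power_bv:
  assumes "(m, s, w) \<in> Trn" and "k \<in> {1..n}" and "m k + a < d"
  shows "app (opX k ^ a) (bv (m, s, w)) = bv (m(k := m k + a), s, w)"
  using assms(3)
proof (induction a)
  case (Suc a)
  then show ?case
    using opX_bv[OF Trn_upd[OF assms(1,2), of "m k + a"] assms(2)]
    by (simp add: app_mult fun_upd_def cong: if_cong)
qed simp

lemma pl_opX_1:
  assumes "length cs + 1 \<le> d" and g: "g = app (opK a) u"
  shows "app (pl cs (opX 1)) g = app (pl cs (S 1)) g"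
  using assms(1)
proof (induction cs)
  case (Cons c cs)
  have "app (opK (d - 1)) (app (pl cs (S 1)) g) = 0"
    unfolding g using Cons.prems by (subst opK_pl_opK) auto
  then have "app (opX 1) (app (pl cs (S 1)) g) = app (S 1) (app (pl cs (S 1)) g)"
    by (simp add: opX_1 app_minus_left app_mult)
  then show ?case using Cons by (simp add: app_mult app_minus_left)
qed simp

text \<open>All factors but the outermost act without reduction and produce x_1^(d-1) with the given
  vector as leading coefficient. The outermost one triggers the reduction, which subtracts exactly
  the product of all factors.\<close>

lemma pl_opX_1_opK: "app (pl vs (opX 1)) (app (opK a) u) = 0"
proof -
  obtain c cs where vs: "vs = c # cs" using length_vs d_pos by (cases vs) auto
  have l: "length cs = d - 1" using length_vs unfolding vs by simp
  let ?g = "app (opK a) u"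
  have "app (pl cs (opX 1)) ?g = app (pl cs (S 1)) ?g"
    using l d_pos by (intro pl_opX_1) auto
  moreover have "app (opK (d - 1)) (app (pl cs (S 1)) ?g) = ?g"
    using l by (subst opK_pl_opK) auto
  ultimately have "app (pl (c # cs) (opX 1)) ?g = app (pl (c # cs) (S 1)) ?g - app (pl vs (S 1)) ?g"
    by (simp add: app_mult app_minus_left opX_1)
  then show ?thesis by (simp add: vs)
qed

lemma pl_opX_1_zero: "eqV (pl vs (opX 1)) 0"
  unfolding eqV_def
proof
  fix u :: "idx \<Rightarrow>\<^sub>0 'k" assume "u \<in> spn Trn"
  then show "app (pl vs (opX 1)) u = app 0 u"
  proof (rule eq_on_spn[rotated])
    fix i assume "i \<in> Trn"
    obtain m s w where i: "i = (m, s, w)" by (cases i)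
    let ?b = "bv (m(1 := 0), s, w) :: idx \<Rightarrow>\<^sub>0 'k" and ?A = "opX 1 ^ m 1"
    have m: "(m, s, w) \<in> Trn" using \<open>i \<in> Trn\<close> i by simp
    \<comment> \<open>Every truncated monomial is a power of x_1 applied to one free of x_1, and the
      polynomial in x_1 commutes with that power.\<close>
    have b: "bv i = app ?A ?b"
      using opX_power_bv[OF Trn_upd[OF m, of 1 0], of 1 "m 1"] n_pos d_pos Trn_lt[OF m] i by simp
    have "app (opK 0) ?b = ?b" by simp
    then have z: "app (pl vs (opX 1)) ?b = 0" using pl_opX_1_opK[of 0 ?b] by (simp only:)
    have "app (pl vs (opX 1)) (app ?A ?b) = app ?A (app (pl vs (opX 1)) ?b)"
      by (rule app_app_eq[symmetric]) (rule pl_intertwine, rule power_commutes)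
    then show "app (pl vs (opX 1)) (bv i) = app 0 (bv i)"
      by (simp only: b z app_zero_right app_zero_left)
  qed
qed

section \<open>The representation of the free algebra\<close>

fun phi :: "yh_gen \<Rightarrow> (idx, 'k) endo" where
  "phi (T_gen j) = T j"
| "phi (F_gen i) = F i"
| "phi (X_gen k) = opX k"

definition Phi :: "'k yh_free \<Rightarrow> (idx, 'k) endo" where
  "Phi = opr.fhom phi"

lemma Phi_simps [simp]:
  "Phi 0 = 0" "Phi 1 = 1" "Phi (p + q) = Phi p + Phi q" "Phi (p - q) = Phi p - Phi q"
  "Phi (p * q) = Phi p * Phi q" "Phi (p ^ k) = Phi p ^ k" "Phi (const c) = sc c" "Phi (gen g) = phi g"
  by (simp_all add: Phi_def opr.fhom_add opr.fhom_minus opr.fhom_mult opr.fhom_power)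

lemma Phi_sum: "Phi (\<Sum>x\<in>I. p x) = (\<Sum>x\<in>I. Phi (p x))"
  by (simp add: Phi_def opr.fhom_sum)

lemma Phi_prod_list: "Phi (prod_list ps) = prod_list (map Phi ps)"
  by (simp add: Phi_def opr.fhom_prod_list)

lemma Phi_ye [simp]: "Phi (ye r i) = E i (Suc i)"
  by (simp add: ye_def opE_def Phi_sum add_1_eq_Suc)

lemma Phi_relations:
  assumes "p \<in> yh_relations r n"
  shows "eqV (Phi p) 0"
proof -
  \<comment> \<open>All relations except the commutation of the x_k are treated as identities of
    operators.\<close>
  have 0: "Phi p = 0 \<Longrightarrow> eqV (Phi p) 0" by simp
  have x: "eqV (opX i * opX j - opX j * opX i) 0" if "i \<in> {1..n}" "j \<in> {1..n}" for i j
    using opX_comm_Trn[OF that] by (simp add: eqV_def app_minus_left)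
  have F_other: "F i * opX j = opX j * F i"
    if "i \<in> {1..<n}" "j \<in> {1..n}" "j \<noteq> i" "j \<noteq> i + 1" for i j
    using that opF_X_gt[of j i] opF_X_lt[of i j] by (cases "j < i") auto
  show ?thesis
    using assms unfolding yh_relations_def Un_iff
    apply (elim disjE)
             apply (rule 0, auto simp: add_1_eq_Suc opF_far)[1]
            apply (rule 0, auto simp: add_1_eq_Suc opF_braid)[1]
           apply (rule 0, auto simp: opT_comm)[1]
          apply (rule 0, auto simp: add_1_eq_Suc opF_T)[1]
         apply (rule 0, auto simp: opT_power_self)[1]
        apply (rule 0, auto simp: opF_square power2_eq_square)[1]
       apply (auto simp: x)[1]
      apply (rule 0, auto simp: add_1_eq_Suc opF_X_Suc)[1]
     apply (rule 0, auto simp: F_other)[1]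
    apply (rule 0, auto simp: opT_X)[1]
    done
qed

definition cyc :: "'k yh_free" where
  "cyc = prod_list (map (\<lambda>k. yx 1 - const (v k)) [1..<d + 1])"

lemma Phi_cyc: "eqV (Phi cyc) 0"
proof -
  have "Phi cyc = pl vs (opX 1)"
    by (simp add: cyc_def Phi_prod_list pl_def vs_def o_def)
  then show ?thesis using pl_opX_1_zero by simp
qed

definition car :: "'k yh_free set" where
  "car = {p. \<forall>w\<in>keys p. set (letters w) \<subseteq> yh_gens n}"

lemma pres_phi: "g \<in> yh_gens n \<Longrightarrow> pres (phi g) Trn Trn"
  by (auto simp: yh_gens_def pres_T_Trn pres_F_Trn pres_X_Trn)

lemma pres_Phi: "p \<in> car \<Longrightarrow> pres (Phi p) Trn Trn"
  unfolding Phi_def opr.fhom_def lext_def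
  by (intro pres_sum pres_mult[of _ Trn] pres_sc pres_prod_list)
    (auto simp: car_def intro!: pres_phi)

lemma Phi_comm:
  assumes "\<And>g. A * phi g = phi g * A"
  shows "A * Phi p = Phi p * A"
proof -
  have "A * prod_list (map phi l) = prod_list (map phi l) * A" for l
  proof (induction l)
    case (Cons g l)
    show ?case unfolding list.map prod_list.Cons by (rule intertwine_mult[OF assms Cons])
  qed simp
  then show ?thesis
    unfolding Phi_def opr.fhom_def lext_def sum_distrib_left sum_distrib_right
    by (intro sum.cong) (simp_all add: sc_left_commute mult.assoc)
qed

lemma Phi_R: "opR u * Phi p = Phi p * opR u"
proof (rule Phi_comm)
  show "opR u * phi g = phi g * opR u" for g
    by (cases g) (simp_all add: opR_comm opR_F opR_X)
qed

lemma Phi_RT: "opRT r j * Phi p = Phi p * opRT r j"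
proof (rule Phi_comm)
  show "opRT r j * phi g = phi g * opRT r j" for g
    by (cases g) (simp_all add: opRT_comm opRT_F opRT_X)
qed

abbreviation bw :: "(nat \<Rightarrow> nat) \<Rightarrow> idx \<Rightarrow>\<^sub>0 'k" where
  "bw w \<equiv> bv (\<lambda>_. 0, \<lambda>_. 0, w)"

lemma bw_Trn: "w permutes {1..n} \<Longrightarrow> bw w \<in> spn Trn"
  using r_pos d_pos by (auto simp: Trn_eq Aff_def)

lemma opF_bw [simp]: "app (F i) (bw w) = bw (adj i \<circ> w)"
  by (simp add: opF_bv_plain o_def)

lemma F_word_bw: "app (prod_list (map F ks)) (bw w) = bw (perm ks \<circ> w)"
proof (induction ks)
  case (Cons i ks)
  have "app (prod_list (map F (i # ks))) (bw w) = app (F i) (bw (perm ks \<circ> w))"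
    by (simp only: list.map prod_list.Cons app_mult Cons)
  then show ?case by (simp only: opF_bw perm_simps comp_assoc)
qed simp

definition mop :: "(nat \<Rightarrow> nat) \<Rightarrow> (nat \<Rightarrow> nat) \<Rightarrow> (idx, 'k) endo" where
  "mop m s = prod_list (map (\<lambda>i. T i ^ s i) [1..<n + 1]) * prod_list (map (\<lambda>i. opX i ^ m i) [1..<n + 1])"

lemma Phi_monomial: "Phi (yh_monomial n s m ks) = mop m s * prod_list (map F ks)"
  by (simp add: yh_monomial_def mop_def Phi_prod_list o_def)

text \<open>The form is prescribed for exponent functions that are arbitrary outside 1..n;
  \<open>rst\<close> turns them into genuine indices.\<close>

definition rst :: "(nat \<Rightarrow> nat) \<Rightarrow> nat \<Rightarrow> nat" where
  "rst f = (\<lambda>i. if i \<in> {1..n} then f i else 0)"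

lemma prod_X_bv:
  assumes "(m0, s, w) \<in> Trn" and "set l \<subseteq> {1..n}" and "distinct l"
    and "\<And>i. i \<in> set l \<Longrightarrow> m0 i = 0" and "\<And>i. i \<in> set l \<Longrightarrow> m i < d"
  shows "app (prod_list (map (\<lambda>i. opX i ^ m i) l)) (bv (m0, s, w)) =
      bv (\<lambda>i. if i \<in> set l then m i else m0 i, s, w) \<and>
    (\<lambda>i. if i \<in> set l then m i else m0 i, s, w) \<in> Trn"
  using assms(2-)
proof (induction l)
  case (Cons k l)
  let ?m = "\<lambda>i. if i \<in> set l then m i else m0 i"
  have m: "?m(k := m k) = (\<lambda>i. if i \<in> set (k # l) then m i else m0 i)" by auto
  have IH: "app (prod_list (map (\<lambda>i. opX i ^ m i) l)) (bv (m0, s, w)) = bv (?m, s, w)"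
    "(?m, s, w) \<in> Trn"
    using Cons by auto
  have "?m k = 0" using Cons.prems by auto
  then have "app (opX k ^ m k) (bv (?m, s, w)) = bv (?m(k := m k), s, w)"
    using opX_power_bv[OF IH(2), of k "m k"] Cons.prems by simp
  moreover have "(?m(k := m k), s, w) \<in> Trn"
    using Trn_upd[OF IH(2)] Cons.prems by simp
  ultimately show ?case unfolding m by (simp add: app_mult IH(1))
qed (use assms(1) in simp)

lemma prod_T_bv:
  assumes "distinct l" and "\<And>i. i \<in> set l \<Longrightarrow> s0 i = 0" and "\<And>i. i \<in> set l \<Longrightarrow> s i < r"
  shows "app (prod_list (map (\<lambda>i. T i ^ s i) l)) (bv (m, s0, w)) =
      bv (m, \<lambda>i. if i \<in> set l then s i else s0 i, w)"
  using assms
proof (induction l)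
  case (Cons k l)
  let ?s = "\<lambda>i. if i \<in> set l then s i else s0 i"
  have m: "?s(k := s k) = (\<lambda>i. if i \<in> set (k # l) then s i else s0 i)" by auto
  have "?s k = 0" using Cons.prems by auto
  moreover have "0 < r" "s k < r" using r_pos Cons.prems by auto
  ultimately have "(rot r ^^ s k) (?s k) = s k" by (simp only: rot_power) simp
  then have "app (T k ^ s k) (bv (m, ?s, w)) = bv (m, ?s(k := s k), w)"
    by (simp add: opT_power_bv)
  then show ?case unfolding m using Cons by (simp add: app_mult)
qed simp

text \<open>Exponents are raised from 0 within the truncation range, so no reduction occurs.
  Distinct monomials thus give distinct basis vectors, which is their linear independence.\<close>

lemma mop_bw:
  assumes "w permutes {1..n}" and "\<And>i. i \<in> {1..n} \<Longrightarrow> m i < d" and "\<And>i. i \<in> {1..n} \<Longrightarrow> s i < r"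
  shows "app (mop m s) (bw w) = bv (rst m, rst s, w)"
proof -
  have l: "set [1..<n + 1] = {1..n}" by auto
  have 0: "(\<lambda>_. 0, \<lambda>_. 0, w) \<in> Trn" using bw_Trn[OF assms(1)] by simp
  have "app (prod_list (map (\<lambda>i. opX i ^ m i) [1..<n + 1])) (bw w) = bv (rst m, \<lambda>_. 0, w)"
    using prod_X_bv[OF 0, of "[1..<n + 1]" m] assms unfolding l rst_def by simp
  moreover have "app (prod_list (map (\<lambda>i. T i ^ s i) [1..<n + 1])) (bv (rst m, \<lambda>_. 0, w)) =
      bv (rst m, rst s, w)"
    using prod_T_bv[of "[1..<n + 1]" "\<lambda>_. 0" s "rst m" w] assms unfolding l rst_def by simp
  ultimately show ?thesis by (simp add: mop_def app_mult)
qed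

lemma Trn_rst: "(m, s, w) \<in> Trn \<Longrightarrow> rst m = m \<and> rst s = s"
  by (auto simp: Trn_eq Aff_def rst_def)

lemma mop_bw_Trn: "(m, s, w) \<in> Trn \<Longrightarrow> app (mop m s) (bw w) = bv (m, s, w)"
  by (subst mop_bw) (auto simp: Trn_rst, auto simp: Trn_eq Aff_def)

section \<open>The trace form\<close>

definition top :: "nat \<Rightarrow> nat" where
  "top = rst (\<lambda>_. d - 1)"

definition rho :: "(idx \<Rightarrow>\<^sub>0 'k) \<Rightarrow> 'k" where
  "rho u = lookup u (top, \<lambda>_. 0, id)"

lemma rho_simps [simp]:
  "rho (u + u') = rho u + rho u'" "rho (u - u') = rho u - rho u'" "rho (vscale c u) = c * rho u" "rho 0 = 0"
  "rho (sum f I) = (\<Sum>x\<in>I. rho (f x))"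
  by (simp_all add: rho_def lookup_add lookup_minus lookup_sum)

lemma rho_bv: "rho (bv (m, s, w)) = (if m = top \<and> s = (\<lambda>_. 0) \<and> w = id then 1 else 0)"
  by (simp add: rho_def lookup_bv)

lemma rho_out: "u \<in> spn I \<Longrightarrow> (top, \<lambda>_. 0, id) \<notin> I \<Longrightarrow> rho u = 0"
  by (simp add: rho_def spn_lookup)

lemma top_eq: "k \<in> {1..n} \<Longrightarrow> top k + 1 = d"
  using d_pos by (simp add: top_def rst_def)

lemma top_adj: "k \<in> {1..<n} \<Longrightarrow> f \<circ> adj k = top \<longleftrightarrow> f = top"
proof -
  assume k: "k \<in> {1..<n}"
  have t: "top \<circ> adj k = top"
    using k adj_mem[OF k] by (auto simp: top_def rst_def fun_eq_iff)
  have "f = top" if "f \<circ> adj k = top"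
  proof -
    have "f = f \<circ> adj k \<circ> adj k" by (simp add: comp_assoc)
    then show ?thesis using that t by simp
  qed
  then show ?thesis using t by auto
qed

lemma comp_adj_id: "adj k \<circ> w = id \<longleftrightarrow> w \<circ> adj k = id" "s \<circ> adj k = (\<lambda>_. 0) \<longleftrightarrow> s = (\<lambda>_. 0)"
proof -
  have "adj k \<circ> w = id \<longleftrightarrow> w = adj k"
  proof
    assume "adj k \<circ> w = id"
    then have "adj k \<circ> (adj k \<circ> w) = adj k" by simp
    then show "w = adj k" by (simp add: o_assoc)
  qed simp
  moreover have "w \<circ> adj k = id \<longleftrightarrow> w = adj k"
  proof
    assume "w \<circ> adj k = id"
    then have "w \<circ> adj k \<circ> adj k = adj k" by simp
    then show "w = adj k" by (simp add: comp_assoc)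
  qed simp
  ultimately show "adj k \<circ> w = id \<longleftrightarrow> w \<circ> adj k = id" by simp
  show "s \<circ> adj k = (\<lambda>_. 0) \<longleftrightarrow> s = (\<lambda>_. 0)"
    by (auto simp: fun_eq_iff) (metis transpose_involutory)
qed

text \<open>With both exponents below d - 1, a divided difference is invisible to
  \<open>rho\<close>, even after one of the two exponents has been raised.\<close>

lemma pres_D_low:
  assumes "k \<in> {1..<n}"
  shows "pres (opD k) Trn {(m, s, w) \<in> Trn. m k + 1 < d \<and> m (Suc k) + 1 < d}"
proof (rule presI)
  fix i assume "i \<in> Trn"
  obtain m s w where i: "i = (m, s, w)" by (cases i)
  then have m: "(m, s, w) \<in> Trn" using \<open>i \<in> Trn\<close> by simp
  have "m k < d" "m (Suc k) < d" using Trn_lt[OF m] by auto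
  then have "c + 1 < d" if "c < max (m k) (m (Suc k))" for c using that by linarith
  moreover from this have "c < d" if "c < max (m k) (m (Suc k))" for c using that by force
  ultimately show "app (opD k) (bv i) \<in> spn {(m, s, w) \<in> Trn. m k + 1 < d \<and> m (Suc k) + 1 < d}"
    unfolding i opD_bv using assms m by (intro spn_ddsum) (auto intro!: Trn_upd)
qed

text \<open>Only the permuting summand of f_k contributes. Its effect on m and s is invisible
  because \<open>top\<close> and s = 0 are symmetric, and s_k w = id exactly when w s_k =
  id.\<close>

lemma rho_F:
  assumes "u \<in> spn Trn" and k: "k \<in> {1..<n}"
  shows "rho (app (F k) u) = rho (app (opR (adj k)) u)"
proof -
  let ?I = "{(m, s, w) \<in> Trn. m k + 1 < d \<and> m (Suc k) + 1 < d}"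
  have "app (opD k) u \<in> spn ?I" by (rule presD[OF pres_D_low[OF k] assms(1)])
  moreover have "pres (E k (Suc k)) ?I ?I"
    using k by (intro pres_opE presI) (auto simp: Trn_eq Aff_T)
  ultimately have "rho (app (E k (Suc k)) (app (opD k) u)) = 0"
    using top_eq[of k] k by (intro rho_out[of _ ?I]) (auto intro: presD)
  moreover have "rho (app (opP k) u) = rho (app (opR (adj k)) u)"
    using assms(1)
  proof (induction rule: spn_induct)
    case (basis i c)
    then show ?case
      by (cases i) (simp add: app_vscale_right rho_bv top_adj[OF k] comp_adj_id)
  qed (simp_all add: app_add_right)
  ultimately show ?thesis by (simp add: opF_def app_add_left app_mult)
qed

lemma rho_S_F:
  assumes "u \<in> spn Trn" and k: "k \<in> {1..<n}"
  shows "rho (app (S k) (app (F k) u)) = rho (app (opR (adj k)) (app (S (Suc k)) u))"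
proof -
  let ?I = "{(m, s, w) \<in> Trn. m k + 1 < d \<and> m (Suc k) + 1 < d}"
  \<comment> \<open>Raising the exponent of x_k may bring it to d - 1; the bound on x_{k+1} is what
    keeps the term away from \<open>top\<close>.\<close>
  let ?J = "{(m, s, w) \<in> Aff. m (Suc k) + 1 < d}"
  have "app (opD k) u \<in> spn ?I" by (rule presD[OF pres_D_low[OF k] assms(1)])
  then have "app (opD k) u \<in> spn ?J" by (rule spn_mono) (auto simp: Trn_eq)
  moreover have "pres (E k (Suc k)) ?J ?J"
    using k by (intro pres_opE presI) (auto simp: Aff_T)
  moreover have "pres (S k) ?J ?J"
    using k by (intro presI) (auto simp: Aff_upd)
  ultimately have "rho (app (S k) (app (E k (Suc k)) (app (opD k) u))) = 0"
    using top_eq[of "Suc k"] k by (intro rho_out[of _ ?J]) (auto intro: presD)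
  moreover have "rho (app (S k) (app (opP k) u)) = rho (app (opR (adj k)) (app (S (Suc k)) u))"
    using assms(1)
  proof (induction rule: spn_induct)
    case (basis i c)
    obtain m s w where i: "i = (m, s, w)" by (cases i)
    have "(m \<circ> adj k)(k := Suc (m (Suc k))) = m(Suc k := Suc (m (Suc k))) \<circ> adj k"
      by (auto simp: fun_eq_iff transpose_def)
    then show ?case
      by (simp add: i app_vscale_right rho_bv top_adj[OF k] comp_adj_id)
  qed (simp_all add: app_add_right)
  ultimately show ?thesis by (simp add: opF_def app_add_left app_add_right app_mult)
qed

text \<open>This is v_1 + ... + v_d, minus the coefficient of x_1^(d-1) in the cyclotomic
  polynomial. What counts below is that it does not depend on k.\<close>

definition sigma :: 'k where
  "sigma = - rho (app (pl vs (S 1)) (bv (top(1 := 0), \<lambda>_. 0, id)))"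

lemma rho_X_1:
  assumes "u \<in> spn Trn"
  shows "rho (app (opX 1) u) = rho (app (S 1) u) + sigma * rho u"
proof -
  have "rho (app (pl vs (S 1)) (app (opK (d - 1)) u)) = - sigma * rho u"
    using assms
  proof (induction rule: spn_induct)
    case (basis i c)
    obtain m s w where i: "i = (m, s, w)" by (cases i)
    have top1: "top 1 = d - 1" using top_eq[of 1] n_pos by auto
    show ?case
    proof (cases "i = (top, \<lambda>_. 0, id)")
      case True
      then show ?thesis by (simp add: app_vscale_right top1 rho_bv sigma_def)
    next
      case False
      have "rho (app (pl vs (S 1)) (bv (m(1 := 0), s, w))) = 0" if "m 1 = d - 1"
      proof -
        \<comment> \<open>Multiplication by x_1 changes only its exponent, so \<open>top\<close> is
          reached only from an index that agrees with it elsewhere.\<close>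
        let ?I = "{(m', s', w'). m'(1 := 0) = m(1 := 0) \<and> s' = s \<and> w' = w}"
        have "pres (S 1) ?I ?I" by (rule presI) auto
        then have "app (pl vs (S 1)) (bv (m(1 := 0), s, w)) \<in> spn ?I"
          by (intro presD[OF pres_pl]) simp_all
        moreover have "(top, \<lambda>_. 0, id) \<notin> ?I"
        proof
          assume *: "(top, \<lambda>_. 0, id) \<in> ?I"
          then have "top(1 := 0, 1 := d - 1) = m(1 := 0, 1 := d - 1)" by auto
          then have "top = m" using top1 that by (simp add: fun_upd_idem)
          with * False i show False by simp
        qed
        ultimately show ?thesis by (rule rho_out)
      qed
      then show ?thesis using False by (auto simp: i app_vscale_right rho_bv)
    qed
  qed (simp_all add: app_add_right algebra_simps)
  then show ?thesis by (simp add: opX_1 app_minus_left app_mult)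
qed

lemma opR_opR: "app (opR u) (app (opR u') x) = app (opR (u' \<circ> u)) (x :: idx \<Rightarrow>\<^sub>0 'k)"
proof -
  have "opR u * opR u' = (opR (u' \<circ> u) :: (idx, 'k) endo)"
    by (rule idx_endo_eqI) (simp add: app_mult comp_assoc)
  then show ?thesis by (rule app_mult_eq)
qed

lemma opR_id [simp]: "opR id = (1 :: (idx, 'k) endo)"
  by (rule idx_endo_eqI) simp

text \<open>The corrections on the right record how \<open>x\<^sub>k\<close> differs from a mere shift of exponents.\<close>

lemma rho_X:
  assumes "k \<in> {1..n}" and "u \<in> spn Trn"
  shows "rho (app (opX k) u) = rho (app (S k) u) + sigma * rho u +
    (\<Sum>j = 1..<k. rho (app (E j k) (app (opR (transpose j k)) u)))"
  using assms
proof (induction k arbitrary: u rule: opX_induct)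
  case one
  then show ?case using rho_X_1 by simp
next
  case (Suc k)
  let ?R = "opR (adj k) :: (idx, 'k) endo"
  have k: "k \<in> {1..<n}" "k \<in> {1..n}" using Suc by auto
  have RT: "pres ?R Trn Trn" using k by (intro pres_R_Trn permutes_swap_id) auto
  have FT: "pres (F k) Trn Trn" using k by (rule_tac pres_F_Trn)
  have XT: "pres (opX k) Trn Trn" using k by (rule_tac pres_X_Trn)
  have Ru: "app ?R u \<in> spn Trn" and FRu: "app (F k) (app ?R u) \<in> spn Trn"
    using Suc.prems RT FT by (auto intro: presD)
  have RR: "app ?R (app ?R x) = x" for x
    by (simp add: opR_opR)
  have RF: "app ?R (app (F k) x) = app (F k) (app ?R x)" and RX: "app ?R (app (opX k) x) = app (opX k) (app ?R x)"
    and RS: "app ?R (app (S j) x) = app (S j) (app ?R x)"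
    and RE: "app (opR w) (app (E i j) x) = app (E i j) (app (opR w) x)"
    and RF': "app (opR w) (app (F i) x) = app (F i) (app (opR w) x)" for x w i j
    by (rule app_app_eq; simp add: opR_comm opR_F opR_X opR_E)+
  have "app (F k) u \<in> spn Trn" using Suc.prems FT by (auto intro: presD)
  \<comment> \<open>By \<open>rho_F\<close> the outer f_k becomes a right multiplication; it
    commutes with the action and so reaches u, and the induction hypothesis is applied to f_k u
    f_k.\<close>
  then have "rho (app (F k) (app (opX k) (app (F k) u))) = rho (app (opX k) (app (F k) (app ?R u)))"
    using rho_F[of "app (opX k) (app (F k) u)" k] k XT by (simp add: presD RX RF)
  also have "\<dots> = rho (app (S k) (app (F k) (app ?R u))) + sigma * rho (app (F k) (app ?R u)) +
    (\<Sum>j = 1..<k. rho (app (E j k) (app (opR (transpose j k)) (app (F k) (app ?R u)))))"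
    by (rule Suc.IH) (use k FRu in simp_all)
  also have "rho (app (S k) (app (F k) (app ?R u))) = rho (app (S (Suc k)) u)"
    using rho_S_F[OF Ru k(1)] by (simp add: RS RR)
  also have "rho (app (F k) (app ?R u)) = rho u"
    using rho_F[OF Ru k(1)] by (simp add: RR)
  also have "(\<Sum>j = 1..<k. rho (app (E j k) (app (opR (transpose j k)) (app (F k) (app ?R u))))) =
    (\<Sum>j = 1..<k. rho (app (E j (Suc k)) (app (opR (transpose j (Suc k))) u)))"
  proof (rule sum.cong)
    fix j assume j: "j \<in> {1..<k}"
    let ?y = "app (E j (Suc k)) (app (opR (transpose j k)) (app ?R u))"
    have "E j k * F k = F k * E j (Suc k)"
      using j by (simp add: opF_E transpose_def)
    then have "app (E j k) (app (opR (transpose j k)) (app (F k) (app ?R u))) = app (F k) ?y"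
      unfolding RF' by (rule app_app_eq)
    moreover have "?y \<in> spn Trn"
      by (rule presD[OF pres_E_Trn presD[OF pres_R_Trn Ru]]) (use j k in \<open>auto intro: permutes_swap_id\<close>)
    ultimately have "rho (app (E j k) (app (opR (transpose j k)) (app (F k) (app ?R u)))) = rho (app ?R ?y)"
      using rho_F k by simp
    \<comment> \<open>Conjugation by s_k turns the summand for (j, k) into that for (j, k + 1); the
      missing summand j = k comes from e_k f_k at the end.\<close>
    moreover have "adj k \<circ> (transpose j k \<circ> adj k) = transpose j (Suc k)"
      using j by (auto simp: fun_eq_iff transpose_def)
    ultimately show "rho (app (E j k) (app (opR (transpose j k)) (app (F k) (app ?R u)))) =
        rho (app (E j (Suc k)) (app (opR (transpose j (Suc k))) u))"
      by (simp add: RE opR_opR comp_assoc)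
  qed simp
  finally have 1: "rho (app (F k) (app (opX k) (app (F k) u))) = rho (app (S (Suc k)) u) + sigma * rho u +
    (\<Sum>j = 1..<k. rho (app (E j (Suc k)) (app (opR (transpose j (Suc k))) u)))" .
  have "app (E k (Suc k)) (app (F k) u) = app (F k) (app (E k (Suc k)) u)"
    by (rule app_app_eq) (simp add: opF_E_self)
  moreover have "app (E k (Suc k)) u \<in> spn Trn"
    using k Suc.prems by (intro presD[OF pres_E_Trn]) auto
  ultimately have "rho (app (E k (Suc k)) (app (F k) u)) = rho (app (E k (Suc k)) (app ?R u))"
    using rho_F k by (simp add: RE)
  then show ?case
    using 1 Suc.hyps by (simp add: opX_Suc app_add_left app_mult)
qed simp

section \<open>Moving f_w past x_1\<close>

lemma adj_transpose: "adj i \<circ> (transpose j k \<circ> w) = transpose (adj i j) (adj i k) \<circ> (adj i \<circ> w)"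
  by (auto simp: fun_eq_iff transpose_def)

lemma opF_E_bw: "app (F i) (app (E j k) (bw w)) = app (E (adj i j) (adj i k)) (bw (adj i \<circ> w))"
proof -
  have "app (F i) (app (E j k) (bw w)) = app (E (adj i j) (adj i k)) (app (F i) (bw w))"
    by (rule app_app_eq) (rule opF_E)
  then show ?thesis by simp
qed

text \<open>Induction on an arbitrary word, reduced or not: f_i carries the summand for j to that
  for s_i(j). If w(1) = i, the correction in f_i x_i is the new summand j = i; if w(1) = i + 1, the
  correction cancels the old summand j = i; otherwise s_i permutes the range of j.\<close>

lemma F_word_X_1:
  assumes "set ks \<subseteq> {1..<n}"
  shows "app (prod_list (map F ks)) (app (opX 1) (bw id)) =
    app (opX (perm ks 1)) (bw (perm ks)) -
      (\<Sum>j = 1..<perm ks 1. app (E j (perm ks 1)) (bw (transpose j (perm ks 1) \<circ> perm ks)))"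
  using assms
proof (induction ks)
  case (Cons i ks)
  define w where "w = perm ks"
  define k where "k = w 1"
  have i: "i \<in> {1..<n}" "i \<ge> 1" using Cons.prems by auto
  have "w permutes {1..n}" unfolding w_def using Cons.prems by (intro perm_permutes) auto
  then have "k \<in> {1..n}" unfolding k_def using n_pos by (subst permutes_in_image) auto
  let ?t = "\<lambda>j k w. app (E j k) (bw (transpose j k \<circ> w))"
  have tF: "app (F i) (?t j k w) = ?t (adj i j) (adj i k) (adj i \<circ> w)" for j k w
    by (simp add: opF_E_bw adj_transpose)
  have IH: "app (prod_list (map F ks)) (app (opX 1) (bw id)) =
      app (opX k) (bw w) - (\<Sum>j = 1..<k. ?t j k w)"
    unfolding k_def w_def by (rule Cons.IH) (use Cons.prems in auto)
  have L: "app (prod_list (map F (i # ks))) (app (opX 1) (bw id)) =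
      app (F i) (app (opX k) (bw w)) - (\<Sum>j = 1..<k. ?t (adj i j) (adj i k) (adj i \<circ> w))"
    by (simp only: list.map prod_list.Cons app_mult IH app_minus_right app_sum_right tF)
  have FX: "app (F i) (app (opX k) (bw w)) = app (opX (adj i k)) (bw (adj i \<circ> w)) +
      (if k = Suc i then app (E i (Suc i)) (bw w) else if k = i then - app (E i (Suc i)) (bw w) else 0)"
  proof -
    consider "k = i" | "k = Suc i" | "k \<noteq> i" "k \<noteq> Suc i" by auto
    then show ?thesis
    proof cases
      case 1
      then show ?thesis
        using app_mult_eq[OF opF_X[OF i(2)], of "bw w"] by (simp add: app_minus_left app_mult)
    next
      case 2
      then show ?thesis
        using app_mult_eq[OF opF_X_Suc[OF i(2)], of "bw w"] by (simp add: app_add_left app_mult)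
    next
      case 3
      then have "F i * opX k = opX k * F i"
        using opF_X_gt[of k i] opF_X_lt[of i k] i \<open>k \<in> {1..n}\<close> by (cases "k < i") auto
      from app_app_eq[OF this, of "bw w"] show ?thesis using 3 by simp
    qed
  qed
  have step: "app (F i) (app (opX k) (bw w)) - (\<Sum>j = 1..<k. ?t (adj i j) (adj i k) (adj i \<circ> w)) =
    app (opX (adj i k)) (bw (adj i \<circ> w)) - (\<Sum>j = 1..<adj i k. ?t j (adj i k) (adj i \<circ> w))"
  proof -
    have self: "adj i \<circ> (adj i \<circ> w) = w" "transpose (Suc i) i \<circ> (adj i \<circ> w) = w"
      by (simp_all add: o_assoc transpose_commute[of "Suc i"])
    consider "k = i" | "k = Suc i" | "k \<noteq> i" "k \<noteq> Suc i" by auto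
    then show ?thesis
    proof cases
      case 1
      have "(\<Sum>j = 1..<i. ?t (adj i j) (Suc i) (adj i \<circ> w)) = (\<Sum>j = 1..<i. ?t j (Suc i) (adj i \<circ> w))"
        by (rule sum.cong) simp_all
      then show ?thesis using i unfolding FX by (simp add: 1 self)
    next
      case 2
      have "(\<Sum>j = 1..<i. ?t (adj i j) i (adj i \<circ> w)) = (\<Sum>j = 1..<i. ?t j i (adj i \<circ> w))"
        by (rule sum.cong) simp_all
      then show ?thesis using i unfolding FX by (simp add: 2 self opE_sym[of r "Suc i"])
    next
      case 3
      have adjk: "adj i k = k" using 3 by simp
      have "bij_betw (adj i) {1..<k} {1..<k}"
        by (rule bij_betwI[where g = "adj i"]) (use 3 i in \<open>auto simp: transpose_def\<close>)
      then have "(\<Sum>j = 1..<k. ?t (adj i j) k (adj i \<circ> w)) = (\<Sum>j = 1..<k. ?t j k (adj i \<circ> w))"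
        by (rule sum.reindex_bij_betw)
      then show ?thesis unfolding FX using 3 by (simp add: adjk)
    qed
  qed
  have p: "perm (i # ks) = adj i \<circ> w" "(adj i \<circ> w) 1 = adj i k"
    by (simp_all add: w_def k_def)
  show ?case unfolding L p by (rule step)
qed simp

end

lemma comm_prod_list:
  fixes C :: "'a :: monoid_mult"
  shows "(\<And>A. A \<in> set As \<Longrightarrow> C * A = A * C) \<Longrightarrow> C * prod_list As = prod_list As * C"
proof (induction As)
  case (Cons A As)
  then have "C * A = A * C" "C * prod_list As = prod_list As * C" by auto
  then show ?case unfolding prod_list.Cons by (rule intertwine_mult)
qed simp

section \<open>Trace identities for the generators\<close>

context yokonuma
begin

lemma commV_mult:
  assumes "eqV (A * C) (C * A)" and "eqV (B * C) (C * B)" and "pres B Trn Trn"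
  shows "eqV (A * B * C) (C * (A * B))"
  using assms by (simp add: eqV_def pres_def app_mult)

lemma commV_prod_list:
  assumes "\<And>A. A \<in> set As \<Longrightarrow> eqV (A * C) (C * A) \<and> pres A Trn Trn"
  shows "eqV (prod_list As * C) (C * prod_list As) \<and> pres (prod_list As) Trn Trn"
  using assms
proof (induction As)
  case (Cons A As)
  then have *: "eqV (A * C) (C * A)" "pres A Trn Trn"
    "eqV (prod_list As * C) (C * prod_list As)" "pres (prod_list As) Trn Trn"
    by auto
  show ?case unfolding prod_list.Cons
    using commV_mult[OF *(1,3,4)] pres_mult[OF *(2,4)] by simp
qed simp

lemma commV_power:
  assumes "eqV (A * C) (C * A)" and "pres A Trn Trn"
  shows "eqV (A ^ k * C) (C * A ^ k) \<and> pres (A ^ k) Trn Trn"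
proof (induction k)
  case (Suc k)
  then show ?case
    unfolding power_Suc using commV_mult[OF assms(1), of "A ^ k"] pres_mult[OF assms(2)] by blast
qed simp

lemma mop_X:
  assumes "k \<in> {1..n}"
  shows "eqV (mop m s * opX k) (opX k * mop m s) \<and> pres (mop m s) Trn Trn"
proof -
  have "eqV (T i ^ a * opX k) (opX k * T i ^ a) \<and> pres (T i ^ a) Trn Trn" if "i \<in> {1..n}" for i a
    using that by (intro commV_power pres_T_Trn) (simp_all add: opT_X)
  then have 1: "eqV (prod_list (map (\<lambda>i. T i ^ s i) [1..<n + 1]) * opX k)
      (opX k * prod_list (map (\<lambda>i. T i ^ s i) [1..<n + 1])) \<and>
      pres (prod_list (map (\<lambda>i. T i ^ s i) [1..<n + 1])) Trn Trn"
    by (intro commV_prod_list) auto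
  have "eqV (opX i ^ a * opX k) (opX k * opX i ^ a) \<and> pres (opX i ^ a) Trn Trn" if "i \<in> {1..n}" for i a
    using that assms by (intro commV_power pres_X_Trn opX_comm_Trn)
  then have 2: "eqV (prod_list (map (\<lambda>i. opX i ^ m i) [1..<n + 1]) * opX k)
      (opX k * prod_list (map (\<lambda>i. opX i ^ m i) [1..<n + 1])) \<and>
      pres (prod_list (map (\<lambda>i. opX i ^ m i) [1..<n + 1])) Trn Trn"
    by (intro commV_prod_list) auto
  show ?thesis
    unfolding mop_def using 1 2 commV_mult pres_mult by blast
qed

lemma mop_E: "E j k * mop m s = mop m s * E j k"
proof -
  have "E j k * A = A * E j k \<Longrightarrow> E j k * A ^ a = A ^ a * E j k" for A a
    by (rule intertwine_power)
  then have "E j k * prod_list (map (\<lambda>i. T i ^ s i) [1..<n + 1]) =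
      prod_list (map (\<lambda>i. T i ^ s i) [1..<n + 1]) * E j k"
    "E j k * prod_list (map (\<lambda>i. opX i ^ m i) [1..<n + 1]) =
      prod_list (map (\<lambda>i. opX i ^ m i) [1..<n + 1]) * E j k"
    by (auto intro!: comm_prod_list simp: opT_E opX_E)
  then show ?thesis unfolding mop_def by (rule intertwine_mult)
qed

lemma rho_E_zero: "w \<noteq> id \<Longrightarrow> rho (app (E j k) (bv (m, s, w))) = 0"
proof -
  assume "w \<noteq> id"
  have "pres (E j k) {(m', s', w'). w' = w} {(m', s', w'). w' = w}"
    by (intro pres_opE presI) auto
  then have "app (E j k) (bv (m, s, w)) \<in> spn {(m', s', w'). w' = w}"
    by (rule presD) simp
  then show ?thesis using \<open>w \<noteq> id\<close> by (auto intro: rho_out)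
qed

lemma rho_S_zero: "w \<noteq> id \<Longrightarrow> rho (app (S k) (bv (m, s, w))) = 0"
  by (simp add: rho_bv)

lemma transpose_comp_eq_id: "transpose j k \<circ> w = id \<longleftrightarrow> w \<circ> transpose j k = id"
proof
  assume "transpose j k \<circ> w = id"
  then have "transpose j k \<circ> (transpose j k \<circ> w) = transpose j k" by simp
  then have "w = transpose j k" by (simp add: o_assoc)
  then show "w \<circ> transpose j k = id" by simp
next
  assume "w \<circ> transpose j k = id"
  then have "(w \<circ> transpose j k) \<circ> transpose j k = transpose j k" by simp
  then have "w = transpose j k" by (simp add: comp_assoc)
  then show "transpose j k \<circ> w = id" by simp
qed

text \<open>The corrections in \<open>rho_X\<close> cancel against those in \<open>F_word_X_1\<close>.\<close>

lemma rho_monomial_X_1: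
  assumes "(m, s, perm ks) \<in> Trn" and "set ks \<subseteq> {1..<n}"
  shows "rho (app (mop m s * prod_list (map F ks)) (app (opX 1) (bw id))) =
    rho (app (opX 1) (app (mop m s * prod_list (map F ks)) (bw id)))"
proof -
  define w where "w = perm ks"
  define k where "k = w 1"
  have w: "w permutes {1..n}" unfolding w_def by (rule perm_permutes) fact
  then have k: "k \<in> {1..n}" unfolding k_def using n_pos by (subst permutes_in_image) auto
  have T: "(m, s, w) \<in> Trn" using assms(1) by (simp add: w_def)
  have mop: "app (mop m s) (bw u) = bv (m, s, u)" if "u permutes {1..n}" for u
    using mop_bw_Trn[of m s u] T that by (simp add: Trn_eq Aff_def)
  let ?g = "\<lambda>j. app (E j k) (bw (transpose j k \<circ> w))"
  have "app (mop m s) (app (opX k) (bw w)) = app (opX k) (app (mop m s) (bw w))"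
    using eqVD[OF conjunct1[OF mop_X[OF k]] bw_Trn[OF w]] by (simp add: app_mult)
  then have X: "app (mop m s) (app (opX k) (bw w)) = app (opX k) (bv (m, s, w))"
    by (simp only: mop[OF w])
  have G: "app (mop m s) (?g j) = app (E j k) (bv (m, s, transpose j k \<circ> w))" if "j \<in> {1..<k}" for j
  proof -
    have "transpose j k \<circ> w permutes {1..n}"
      using that k by (intro permutes_compose[OF w] permutes_swap_id) auto
    then show ?thesis
      using app_app_eq[OF mop_E[symmetric], of m s j k] by (simp only: mop)
  qed
  have "rho (app (mop m s * prod_list (map F ks)) (app (opX 1) (bw id))) =
      rho (app (mop m s) (app (opX k) (bw w) - (\<Sum>j = 1..<k. ?g j)))"
    by (simp only: app_mult F_word_X_1[OF assms(2)] w_def k_def)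
  also have "\<dots> = rho (app (opX k) (bv (m, s, w))) - (\<Sum>j = 1..<k. rho (app (mop m s) (?g j)))"
    by (simp only: app_minus_right app_sum_right X rho_simps)
  also have "(\<Sum>j = 1..<k. rho (app (mop m s) (?g j))) =
      (\<Sum>j = 1..<k. rho (app (E j k) (app (opR (transpose j k)) (bv (m, s, w)))))"
  proof (rule sum.cong)
    fix j assume j: "j \<in> {1..<k}"
    \<comment> \<open>The transposition stands to the left of w on one side and to the right on the
      other; \<open>rho\<close> sees only the identity, and both products are the identity for the
      same w.\<close>
    show "rho (app (mop m s) (?g j)) = rho (app (E j k) (app (opR (transpose j k)) (bv (m, s, w))))"
      unfolding G[OF j] opR_bv
    proof (cases "transpose j k \<circ> w = id")
      case True
      moreover from this have "w \<circ> transpose j k = id" by (simp only: transpose_comp_eq_id)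
      ultimately show "rho (app (E j k) (bv (m, s, transpose j k \<circ> w))) =
        rho (app (E j k) (bv (m, s, w \<circ> transpose j k)))" by (simp only:)
    next
      case False
      moreover from this have "w \<circ> transpose j k \<noteq> id" by (simp only: transpose_comp_eq_id not_False_eq_True)
      ultimately show "rho (app (E j k) (bv (m, s, transpose j k \<circ> w))) =
        rho (app (E j k) (bv (m, s, w \<circ> transpose j k)))"
        by (metis rho_E_zero)
    qed
  qed simp
  also have "rho (app (opX k) (bv (m, s, w))) - \<dots> = rho (app (S k) (bv (m, s, w))) + sigma * rho (bv (m, s, w))"
    using rho_X[OF k, of "bv (m, s, w)"] T by simp
  \<comment> \<open>For w = id, k is 1; for any other w both sides are 0.\<close>
  also have "rho (app (S k) (bv (m, s, w))) = rho (app (S 1) (bv (m, s, w)))"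
    by (cases "w = id") (simp_all only: k_def id_apply rho_S_zero not_False_eq_True)
  also have "rho (app (S 1) (bv (m, s, w))) + sigma * rho (bv (m, s, w)) = rho (app (opX 1) (bv (m, s, w)))"
    using rho_X_1[of "bv (m, s, w)"] T by simp
  also have "bv (m, s, w) = app (mop m s * prod_list (map F ks)) (bw id)"
    by (simp only: app_mult F_word_bw comp_id w_def[symmetric] mop[OF w])
  finally show ?thesis .
qed

text \<open>On the vector of 1, f_k acts from the left as from the right. The right multiplication
  passes A, and outside A \<open>rho_F\<close> turns it back into a left multiplication.\<close>

lemma rho_right_F:
  assumes "k \<in> {1..<n}" and "\<And>u. opR u * A = A * opR u" and "pres A Trn Trn"
  shows "rho (app A (app (F k) (bw id))) = rho (app (F k) (app A (bw id)))"
proof -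
  have "app A (app (F k) (bw id)) = app A (app (opR (adj k)) (bw id))" by simp
  also have "\<dots> = app (opR (adj k)) (app A (bw id))"
    by (rule app_app_eq[symmetric]) (rule assms(2))
  also have "rho \<dots> = rho (app (F k) (app A (bw id)))"
    using assms(1,3) bw_Trn[OF permutes_id] by (intro rho_F[symmetric]) (auto intro: presD)
  finally show ?thesis .
qed

text \<open>The two operators rotate s at j and at w(j), and \<open>rho\<close> sees only w = id,
  where these positions coincide.\<close>

lemma rho_T_RT: "rho (app (T j) u) = rho (app (opRT r j) u)"
proof (rule span_bv_induct[of u UNIV])
  fix i :: idx and c :: 'k
  show "rho (app (T j) (vscale c (bv i))) = rho (app (opRT r j) (vscale c (bv i)))"
    by (cases i) (auto simp: app_vscale_right rho_bv)
qed (simp_all add: app_add_right)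

lemma rho_right_T:
  assumes "opRT r j * A = A * opRT r j"
  shows "rho (app A (app (T j) (bw id))) = rho (app (T j) (app A (bw id)))"
proof -
  have "app A (app (T j) (bw id)) = app A (app (opRT r j) (bw id))" by simp
  also have "\<dots> = app (opRT r j) (app A (bw id))"
    by (rule app_app_eq[symmetric]) (rule assms)
  finally show ?thesis by (simp only: rho_T_RT)
qed

section \<open>Nondegeneracy\<close>

definition deg :: "(nat \<Rightarrow> nat) \<Rightarrow> nat" where
  "deg m = (\<Sum>i = 1..n. m i)"

text \<open>The bound is strict so that \<open>G 0\<close> is empty, which is where the descent on
  the degree ends.\<close>

definition G :: "nat \<Rightarrow> idx set" where
  "G j = {(m, s, w) \<in> Trn. deg m < j}"

text \<open>The leading part of \<open>x\<^sub>k\<close> with respect to the degree.\<close>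

definition opH :: "nat \<Rightarrow> (idx, 'k) endo" where
  "opH k = Endo (\<lambda>(m, s, w). if m k + 1 < d then bv (m(k := Suc (m k)), s, w) else 0)"

lemma opH_bv [simp]: "app (opH k) (bv (m, s, w)) = (if m k + 1 < d then bv (m(k := Suc (m k)), s, w) else 0)"
  by (simp add: opH_def)

lemma deg_upd: "k \<in> {1..n} \<Longrightarrow> deg (m(k := a)) + m k = deg m + a"
proof -
  assume k: "k \<in> {1..n}"
  have "deg (m(k := a)) = a + (\<Sum>i\<in>{1..n} - {k}. m i)"
    unfolding deg_def using k by (subst sum.remove[of _ k]) (auto intro!: sum.cong)
  moreover have "deg m = m k + (\<Sum>i\<in>{1..n} - {k}. m i)"
    unfolding deg_def using k by (subst sum.remove[of _ k]) auto
  ultimately show ?thesis by simp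
qed

lemma deg_adj: "i \<in> {1..<n} \<Longrightarrow> deg (m \<circ> adj i) = deg m"
proof -
  assume "i \<in> {1..<n}"
  then have "adj i permutes {1..n}" by (intro permutes_swap_id) auto
  then show ?thesis unfolding deg_def
    using sum.permute[of "adj i" "{1..n}" m] by simp
qed

lemma pres_G_E: "j \<in> {1..n} \<Longrightarrow> k \<in> {1..n} \<Longrightarrow> pres (E j k) (G l) (G l)"
  by (intro pres_opE presI) (auto simp: G_def Trn_eq Aff_T)

lemma pres_G_P: "i \<in> {1..<n} \<Longrightarrow> pres (opP i) (G l) (G l)"
  by (rule presI) (auto simp: G_def Trn_eq deg_adj intro!: Aff_P)

lemma pres_G_H: "k \<in> {1..n} \<Longrightarrow> pres (opH k) (G l) (G (Suc l))"
proof (rule presI)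
  fix i assume "k \<in> {1..n}" and "i \<in> G l"
  moreover obtain m s w where "i = (m, s, w)" by (cases i)
  ultimately show "app (opH k) (bv i) \<in> spn (G (Suc l))"
    using deg_upd[of k m "Suc (m k)"] by (auto simp: G_def intro!: Trn_upd)
qed

lemma pres_G_D: "i \<in> {1..<n} \<Longrightarrow> pres (opD i) (G (Suc l)) (G l)"
proof (rule presI)
  fix x assume i: "i \<in> {1..<n}" and "x \<in> G (Suc l)"
  moreover obtain m s w where x: "x = (m, s, w)" by (cases x)
  ultimately have m: "(m, s, w) \<in> Trn" "deg m < Suc l" by (auto simp: G_def)
  have "(m(i := c, Suc i := c'), s, w) \<in> G l"
    if "c < max (m i) (m (Suc i))" "c' < max (m i) (m (Suc i))" "c + c' + 1 = m i + m (Suc i)" for c c'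
  proof -
    have "m i < d" "m (Suc i) < d" using Trn_lt[OF m(1)] by auto
    then have "c < d" "c' < d" using that by linarith+
    moreover have "deg (m(i := c)) + m i = deg m + c"
      "deg (m(i := c, Suc i := c')) + m (Suc i) = deg (m(i := c)) + c'"
      using deg_upd[of i m c] deg_upd[of "Suc i" "m(i := c)" c'] i by simp_all
    then have "deg (m(i := c, Suc i := c')) + 1 = deg m" using that(3) by linarith
    ultimately show ?thesis using m i by (auto simp: G_def intro!: Trn_upd)
  qed
  then show "app (opD i) (bv x) \<in> spn (G l)"
    unfolding x opD_bv by (intro spn_ddsum) simp
qed

lemma G_mono: "l \<le> l' \<Longrightarrow> G l \<subseteq> G l'"
  by (auto simp: G_def)

lemma pres_G_FP: "i \<in> {1..<n} \<Longrightarrow> pres (F i - opP i) (G (Suc l)) (G l)"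
  unfolding opF_def using pres_mult[OF pres_G_E pres_G_D, of i "Suc i" i] by simp

lemma pres_mono: "pres A I J \<Longrightarrow> I' \<subseteq> I \<Longrightarrow> J \<subseteq> J' \<Longrightarrow> pres A I' J'"
  unfolding pres_def by (meson spn_mono)

lemma pres_G_F: "i \<in> {1..<n} \<Longrightarrow> pres (F i) (G l) (G l)"
proof -
  assume i: "i \<in> {1..<n}"
  have "pres (F i - opP i) (G l) (G l)"
    by (rule pres_mono[OF pres_G_FP[OF i] G_mono]) auto
  from pres_add[OF this pres_G_P[OF i]] show ?thesis by simp
qed

lemma opP_H: "opP i * opH i * opP i = opH (Suc i)"
proof (rule idx_endo_eqI)
  fix m s w :: "nat \<Rightarrow> nat"
  have "(m \<circ> adj i)(i := Suc (m (Suc i))) \<circ> adj i = m(Suc i := Suc (m (Suc i)))"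
    by (auto simp: fun_eq_iff transpose_def)
  moreover have "adj i \<circ> (adj i \<circ> w) = w" "s \<circ> adj i \<circ> adj i = s"
    by (simp_all add: o_assoc, simp add: comp_assoc)
  ultimately show "app (opP i * opH i * opP i) (bv (m, s, w)) = app (opH (Suc i)) (bv (m, s, w))"
    by (simp add: app_mult)
qed

lemma pl_S1_lower:
  assumes "m 1 = 0"
  shows "app (pl cs (S 1) - S 1 ^ length cs) (bv (m, s, w)) \<in> spn {(m(1 := a), s, w) | a. a < length cs}"
proof (induction cs)
  case (Cons c cs)
  let ?I = "\<lambda>l. {(m(1 := a), s, w) | a. a < l}" and ?b = "bv (m, s, w)"
  have S: "pres (S 1) (?I l) (?I (Suc l))" for l
    by (rule presI) auto
  have "app (S 1 ^ l) ?b = bv (m(1 := l), s, w)" for l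
    using assms by (induction l) (simp_all add: app_mult fun_upd_idem)
  then have P: "app (S 1 ^ length cs) ?b \<in> spn (?I (Suc (length cs)))" by auto
  let ?y = "app (pl cs (S 1) - S 1 ^ length cs) ?b"
  have "?y \<in> spn (?I (Suc (length cs)))" by (rule spn_mono[OF Cons]) (blast intro: less_SucI)
  then have "app (S 1) ?y - vscale c (?y + app (S 1 ^ length cs) ?b) \<in> spn (?I (Suc (length cs)))"
    using presD[OF S Cons] P by (intro spn_minus spn_vscale spn_add)
  moreover have "app (pl (c # cs) (S 1) - S 1 ^ length (c # cs)) ?b =
      app (S 1) ?y - vscale c (?y + app (S 1 ^ length cs) ?b)"
    by (simp add: app_minus_left app_minus_right app_mult app_sc)
  ultimately show ?case by (simp only: length_Cons)
qed simp

lemma S1_power_bv: "app (S 1 ^ l) (bv (m, s, w)) = bv (m(1 := m 1 + l), s, w)"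
  by (induction l) (simp_all add: app_mult, simp add: fun_upd_def cong: if_cong)

text \<open>For k = 1 the two differ only where x_1^d is reduced, and the reduction lowers the
  degree. For k + 1, f_k is the permutation plus a part that lowers the degree by one, and
  conjugating \<open>opH k\<close> by the permutation gives \<open>opH (Suc k)\<close>.\<close>

lemma pres_G_X_H: "k \<in> {1..n} \<Longrightarrow> pres (opX k - opH k) (G (Suc l)) (G (Suc l))"
proof (induction k rule: opX_induct)
  case one
  show ?case
  proof (rule presI)
    fix i assume "i \<in> G (Suc l)"
    moreover obtain m s w where i: "i = (m, s, w)" by (cases i)
    ultimately have m: "(m, s, w) \<in> Trn" "deg m < Suc l" by (auto simp: G_def)
    show "app (opX 1 - opH 1) (bv i) \<in> spn (G (Suc l))"
    proof (cases "m 1 + 1 < d")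
      case True
      then show ?thesis using opX_bv[OF m(1) one] by (simp add: i app_minus_left)
    next
      case False
      then have m1: "m 1 = d - 1" "d = m 1 + 1" using Trn_lt[OF m(1), of 1] by auto
      let ?b = "bv (m(1 := 0), s, w) :: idx \<Rightarrow>\<^sub>0 'k"
      have "app (S 1) (bv i) = app (S 1 ^ d) ?b"
        using m1(2) unfolding i S1_power_bv by (simp add: add_1_eq_Suc)
      then have "app (opX 1 - opH 1) (bv i) = - app (pl vs (S 1) - S 1 ^ length vs) ?b"
        using False m1(1) by (simp add: i app_minus_left opX_1 app_mult)
      moreover have "app (pl vs (S 1) - S 1 ^ length vs) ?b \<in> spn (G (Suc l))"
      proof (rule spn_mono[OF pl_S1_lower])
        have "(m(1 := a), s, w) \<in> G (Suc l)" if "a < d" for a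
        proof -
          have "deg (m(1 := a)) \<le> deg m" using that m1(2) deg_upd[OF one, of m a] by linarith
          then show ?thesis using that m one by (auto simp: G_def intro!: Trn_upd)
        qed
        then show "{((m(1 := 0))(1 := a), s, w) |a. a < length vs} \<subseteq> G (Suc l)" by auto
      qed simp
      ultimately show ?thesis by (simp add: spn_uminus)
    qed
  qed
next
  case (Suc k)
  then have k: "k \<in> {1..<n}" "k \<in> {1..n}" by auto
  \<comment> \<open>This expands \<open>F k = opP k + (F k - opP k)\<close> and
    \<open>opX k = opH k + (opX k - opH k)\<close>; a factor \<open>F k - opP k\<close> takes back
    the degree that \<open>opH k\<close> adds.\<close>
  have "opX (Suc k) - opH (Suc k) = F k * (opX k - opH k) * F k +
      (F k - opP k) * (opH k * F k) + opP k * (opH k * (F k - opP k)) + E k (Suc k) * F k"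
    using Suc.hyps by (simp add: opX_Suc opP_H[symmetric] algebra_simps)
  moreover have "pres (F k * (opX k - opH k) * F k) (G (Suc l)) (G (Suc l))"
    using k by (intro pres_mult[of _ "G (Suc l)"] pres_G_F Suc.IH)
  moreover have "pres ((F k - opP k) * (opH k * F k)) (G (Suc l)) (G (Suc l))"
    using k by (intro pres_mult[OF pres_G_FP] pres_mult[OF pres_G_H] pres_G_F)
  moreover have "pres (opP k * (opH k * (F k - opP k))) (G (Suc l)) (G (Suc l))"
    using k by (intro pres_mult[OF pres_G_P] pres_mult[OF pres_G_H] pres_G_FP)
  moreover have "pres (E k (Suc k) * F k) (G (Suc l)) (G (Suc l))"
    using k by (intro pres_mult[OF pres_G_E] pres_G_F) auto
  ultimately show ?case by (simp only: pres_add)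
qed simp

lemma lookup_opH:
  "lookup (app (opH k) u) (m(k := Suc (m k)), s, w) =
     (if m k + 1 < d then lookup u (m, s, w) else 0)"
proof (rule span_bv_induct[of u UNIV])
  fix i :: idx and c
  obtain m' s' w' where i: "i = (m', s', w')" by (cases i)
  have "m'(k := Suc (m' k)) = m(k := Suc (m k)) \<longleftrightarrow> m' = m"
    by (metis fun_upd_idem fun_upd_upd fun_upd_same nat.inject)
  then show "lookup (app (opH k) (vscale c (bv i))) (m(k := Suc (m k)), s, w) =
    (if m k + 1 < d then lookup (vscale c (bv i)) (m, s, w) else 0)"
    by (auto simp: app_vscale_right i lookup_bv)
qed (simp_all only: app_add_right lookup_add, simp_all)

lemma lookup_opR_adj:
  "lookup (app (opR (adj k)) u) (m, s, w) = lookup u (m, s, w \<circ> adj k)"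
proof (rule span_bv_induct[of u UNIV])
  fix i :: idx and c
  obtain m' s' w' where i: "i = (m', s', w')" by (cases i)
  have "w' \<circ> adj k = w \<longleftrightarrow> w' = w \<circ> adj k"
    by (auto simp: comp_assoc)
  then show "lookup (app (opR (adj k)) (vscale c (bv i))) (m, s, w) =
    lookup (vscale c (bv i)) (m, s, w \<circ> adj k)"
    by (auto simp: app_vscale_right i lookup_bv)
qed (simp_all only: app_add_right lookup_add, simp_all)

lemma rot_inj: "rot r a = rot r b \<longleftrightarrow> a = b"
proof -
  have "(rot r ^^ r) c = (rot r ^^ (r - 1)) (rot r c)" for c
    using r_pos by (metis funpow_swap1 funpow_simps_right(2) comp_apply Suc_diff_1 less_eq_Suc_le One_nat_def)
  then show ?thesis by (metis rot_power_self)
qed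

lemma lookup_opT:
  "lookup (app (T j) u) (m, s(j := rot r (s j)), w) = lookup u (m, s, w)"
proof (rule span_bv_induct[of u UNIV])
  fix i :: idx and c
  obtain m' s' w' where i: "i = (m', s', w')" by (cases i)
  have "s'(j := rot r (s' j)) = s(j := rot r (s j)) \<longleftrightarrow> s' = s"
    by (metis fun_upd_idem fun_upd_upd fun_upd_same rot_inj)
  then show "lookup (app (T j) (vscale c (bv i))) (m, s(j := rot r (s j)), w) =
    lookup (vscale c (bv i)) (m, s, w)"
    by (auto simp: app_vscale_right i lookup_bv)
qed (simp_all only: app_add_right lookup_add, simp_all)

text \<open>\<open>U\<close> will consist of the coordinate vectors of the radical of the form. The
  f_k enter through right multiplication, which merely changes w and creates no lower terms.\<close>

context
  fixes U :: "(idx \<Rightarrow>\<^sub>0 'k) set"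
  assumes U_Trn: "U \<subseteq> spn Trn"
    and U_X: "\<And>u k. u \<in> U \<Longrightarrow> k \<in> {1..n} \<Longrightarrow> app (opX k) u \<in> U"
    and U_T: "\<And>u j. u \<in> U \<Longrightarrow> j \<in> {1..n} \<Longrightarrow> app (T j) u \<in> U"
    and U_R: "\<And>u k. u \<in> U \<Longrightarrow> k \<in> {1..<n} \<Longrightarrow> app (opR (adj k)) u \<in> U"
    and U_rho: "\<And>u. u \<in> U \<Longrightarrow> rho u = 0"
begin

text \<open>Right multiplication by the letters brings the chosen permutation to the identity, where
  \<open>rho\<close> reads off the coefficient.\<close>

lemma U_word:
  "set ks \<subseteq> {1..<n} \<Longrightarrow> u \<in> U \<Longrightarrow> lookup u (top, \<lambda>_. 0, perm (rev ks)) = 0"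
proof (induction ks arbitrary: u)
  case Nil
  then show ?case using U_rho[of u] by (simp only: rho_def rev.simps perm_simps)
next
  case (Cons k ks)
  have "perm (rev (k # ks)) = perm (rev ks) \<circ> adj k"
    by (simp only: rev.simps perm_append perm_simps comp_id)
  then have "lookup u (top, \<lambda>_. 0, perm (rev (k # ks))) =
      lookup (app (opR (adj k)) u) (top, \<lambda>_. 0, perm (rev ks))"
    by (simp only: lookup_opR_adj)
  then show ?case using Cons.IH[of "app (opR (adj k)) u"] Cons.prems U_R by simp
qed

text \<open>The measure counts the rotations still needed to bring every entry of s to 0; applying
  t_j where s j > 0 lowers it by one.\<close>

lemma U_top:
  assumes "(top, s, w) \<in> Aff" and "u \<in> U"
  shows "lookup u (top, s, w) = 0"
  using assms
proof (induction "\<Sum>i = 1..n. (r - s i) mod r" arbitrary: u s rule: less_induct)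
  case less
  show ?case
  proof (cases "\<exists>j\<in>{1..n}. s j > 0")
    case True
    then obtain j where j: "j \<in> {1..n}" "s j > 0" by auto
    let ?s = "s(j := rot r (s j))"
    have sj: "s j < r" using less.prems j by (auto simp: Aff_def)
    have "(r - rot r (s j)) mod r < (r - s j) mod r"
    proof (cases "Suc (s j) = r")
      case False
      then show ?thesis using sj j by (simp add: rot_def)
    next
      case True
      then have "rot r (s j) = 0" "r - s j = 1" "r > 1" using sj j by (auto simp: rot_def)
      then show ?thesis by simp
    qed
    then have "(\<Sum>i = 1..n. (r - ?s i) mod r) < (\<Sum>i = 1..n. (r - s i) mod r)"
      using j by (intro sum_strict_mono_ex1) auto
    moreover have "(top, ?s, w) \<in> Aff" using Aff_T[OF less.prems(1) j(1)] .
    moreover have "app (T j) u \<in> U" using less.prems j U_T by auto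
    ultimately have "lookup (app (T j) u) (top, ?s, w) = 0" by (rule less.hyps)
    then show ?thesis by (simp only: lookup_opT)
  next
    case False
    then have "s = (\<lambda>_. 0)" using less.prems by (auto simp: Aff_def fun_eq_iff)
    moreover have "w permutes {1..n}" using less.prems by (simp add: Aff_def)
    then have "perm (canon_word n w) = w" "set (canon_word n w) \<subseteq> {1..<n}" using canon_word_correct by auto
    ultimately show ?thesis
      using U_word[of "rev (canon_word n w)" u] less.prems by simp
  qed
qed

text \<open>Descent for all elements of \<open>U\<close> at once, from the maximal degree n (d - 1).
  A term of the highest remaining degree with m other than \<open>top\<close> can be raised by some
  x_k beyond the bound valid for x_k u; as x_k agrees with \<open>opH k\<close> to leading order,
  its coefficient is 0. Terms at \<open>top\<close> are covered by \<open>U_top\<close>.\<close>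

lemma U_degree: "u \<in> U \<Longrightarrow> u \<in> spn (G (n * (d - 1) + 1 - l))"
proof (induction l arbitrary: u)
  case 0
  have "(m, s, w) \<in> G (n * (d - 1) + 1)" if "(m, s, w) \<in> Trn" for m s w
  proof -
    have "m i \<le> d - 1" for i using Trn_lt[OF that, of i] by linarith
    then have "deg m \<le> n * (d - 1)" unfolding deg_def
      using sum_bounded_above[of "{1..n}" m "d - 1"] by simp
    then show ?thesis using that by (simp add: G_def)
  qed
  then have "Trn \<subseteq> G (n * (d - 1) + 1)" by auto
  moreover have "u \<in> spn Trn" using 0 U_Trn by blast
  ultimately show ?case by (simp add: spn_mono)
next
  case (Suc l)
  show ?case unfolding spn_lookup
  proof (intro allI impI)
    fix i assume i: "i \<notin> G (n * (d - 1) + 1 - Suc l)"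
    obtain m s w where [simp]: "i = (m, s, w)" by (cases i)
    show "lookup u i = 0"
    proof (cases "i \<in> G (n * (d - 1) + 1 - l)")
      case False
      then show ?thesis using Suc.IH[OF Suc.prems] by (simp add: spn_lookup)
    next
      case True
      then have m: "(m, s, w) \<in> Trn" "deg m < n * (d - 1) + 1 - l" by (auto simp: G_def)
      with i have dm: "deg m + l = n * (d - 1)" by (auto simp: G_def)
      show ?thesis
      proof (cases "m = top")
        case True
        then show ?thesis using U_top[of s w u] m Suc.prems by (simp add: Trn_eq)
      next
        case False
        then obtain k where "m k \<noteq> top k" by auto
        then have "k \<in> {1..n} \<and> m k \<noteq> d - 1"
          using m(1) by (auto simp: top_def rst_def Trn_eq Aff_def split: if_splits)
        then have k: "k \<in> {1..n}" "m k + 1 < d"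
          using Trn_lt[OF m(1), of k] by auto
        let ?i = "(m(k := Suc (m k)), s, w)"
        have dg: "deg (m(k := Suc (m k))) = Suc (deg m)"
          using deg_upd[OF k(1), of m "Suc (m k)"] by simp
        have e: "n * (d - 1) + 1 - l = Suc (deg m)" using dm by simp
        have "app (opX k) u \<in> spn (G (Suc (deg m)))"
          using Suc.IH[OF U_X[OF Suc.prems k(1)]] by (simp only: e)
        moreover have "app (opX k - opH k) u \<in> spn (G (Suc (deg m)))"
          using presD[OF pres_G_X_H[OF k(1)]] Suc.IH[OF Suc.prems] by (simp only: e)
        ultimately have "lookup (app (opX k) u) ?i = 0"
          "lookup (app (opX k - opH k) u) ?i = 0"
          by (simp_all add: spn_lookup G_def dg)
        then have "lookup (app (opH k) u) ?i = 0"
          by (simp add: app_minus_left lookup_minus)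
        then show ?thesis using k(2) by (simp only: lookup_opH) simp
      qed
    qed
  qed
qed

lemma U_zero: "u \<in> U \<Longrightarrow> u = 0"
proof -
  assume "u \<in> U"
  from U_degree[OF this, of "n * (d - 1) + 1"] have "keys u \<subseteq> {(m, s, w). False}"
    by (simp add: spn_def G_def)
  then have "keys u = {}" by fast
  then show ?thesis by simp
qed

end

end

section \<open>Spanning\<close>

lemma perm_upt_apply:
  "k \<le> l \<Longrightarrow> perm [k..<l] x = (if k \<le> x \<and> x < l then Suc x else if x = l then k else x)"
proof (induction k rule: inc_induct)
  case (step k)
  then have "perm [k..<l] x = adj k (perm [Suc k..<l] x)" by (simp add: upt_conv_Cons)
  then show ?case using step by (auto simp: transpose_def)
qed auto

lemma perm_rev_comm:
  assumes "adj i \<circ> perm ks = perm ks \<circ> adj j"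
  shows "perm (rev ks) \<circ> (adj i \<circ> w) = adj j \<circ> (perm (rev ks) \<circ> w)"
proof -
  have "perm (rev ks) \<circ> (adj i \<circ> w) = perm (rev ks) \<circ> adj i \<circ> (perm ks \<circ> perm (rev ks)) \<circ> w"
    by (simp only: perm_rev comp_id comp_assoc)
  also have "\<dots> = perm (rev ks) \<circ> (adj i \<circ> perm ks) \<circ> perm (rev ks) \<circ> w"
    by (simp only: comp_assoc)
  also have "\<dots> = (perm (rev ks) \<circ> perm ks) \<circ> (adj j \<circ> (perm (rev ks) \<circ> w))"
    unfolding assms by (simp only: comp_assoc)
  finally show ?thesis by (simp only: perm_rev id_comp)
qed

lemma canon_word_id: "canon_word l id = []"
  by (induction l)
    (simp_all only: canon_word.simps id_apply order_refl upt_conv_Nil rev.simps perm_simps id_comp append_Nil)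

lemma free_fhom_gen: "free.fhom gen p = p"
proof (rule span_bv_induct[of p UNIV])
  fix w :: "'a free_monoid" and c :: 'b
  have "prod_list (map gen l) = (Poly_Mapping.single (Word l) 1 :: 'a free_monoid \<Rightarrow>\<^sub>0 'b)" for l
  proof (induction l)
    case Nil
    show ?case using single_one by (simp add: zero_free_monoid_def[symmetric])
  next
    case (Cons g l)
    then show ?case by (simp add: gen_def mult_single plus_free_monoid_def)
  qed
  then have "prod_list (map gen (letters w)) = (bv w :: 'a free_monoid \<Rightarrow>\<^sub>0 'b)"
    by (simp add: bv_def)
  then have "free.fhom gen (bv w :: 'a free_monoid \<Rightarrow>\<^sub>0 'b) = bv w"
    unfolding free.fhom_def by (simp only: free.lext_bv)
  moreover have "free.fhom gen (vscale c (bv w)) = const c * free.fhom gen (bv w)"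
    unfolding free.fhom_def by (rule free.lext_vscale)
  ultimately show "free.fhom gen (vscale c (bv w)) = vscale c (bv w)"
    by (simp only: vscale_eq_const_mult)
qed (simp_all add: free.fhom_add)

context yokonuma
begin

text \<open>f_w has no meaning in the free algebra, so one word is fixed for each w.\<close>

definition mon :: "(idx \<Rightarrow>\<^sub>0 'k) \<Rightarrow> 'k yh_free" where
  "mon = lext (\<lambda>c p. const c * p) (\<lambda>(m, s, w). yh_monomial n s m (canon_word n w))"

lemma mon_bv: "mon (bv (m, s, w)) = yh_monomial n s m (canon_word n w)"
  by (simp add: mon_def)

lemma mon_linear: "mon 0 = 0" "mon (u + u') = mon u + mon u'" "mon (u - u') = mon u - mon u'"
  "mon (vscale c u) = const c * mon u" "mon (sum f I) = (\<Sum>x\<in>I. mon (f x))"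
  by (simp_all add: mon_def free.lext_add free.lext_minus free.lext_vscale free.lext_sum)

section \<open>Calculation modulo an ideal that contains all relations\<close>

context
  fixes J :: "'k yh_free set"
  assumes J_zero: "0 \<in> J" and J_add: "\<And>p q. p \<in> J \<Longrightarrow> q \<in> J \<Longrightarrow> p + q \<in> J"
    and J_left: "\<And>a p. p \<in> J \<Longrightarrow> a * p \<in> J" and J_right: "\<And>a p. p \<in> J \<Longrightarrow> p * a \<in> J"
    and J_rel: "yh_relations r n \<subseteq> J" and J_cyc: "cyc \<in> J"
begin

definition cong :: "'k yh_free \<Rightarrow> 'k yh_free \<Rightarrow> bool" (infix "\<asymp>" 50) where
  "p \<asymp> q \<longleftrightarrow> p - q \<in> J"

lemma cong_refl [simp]: "p \<asymp> p"
  by (simp add: cong_def J_zero)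

lemma J_uminus: "p \<in> J \<Longrightarrow> - p \<in> J"
  using J_left[of p "-1"] by simp

lemma cong_sym: "p \<asymp> q \<Longrightarrow> q \<asymp> p"
  using J_uminus[of "p - q"] by (simp add: cong_def)

lemma cong_trans [trans]: "p \<asymp> q \<Longrightarrow> q \<asymp> s \<Longrightarrow> p \<asymp> s"
  using J_add[of "p - q" "q - s"] by (simp add: cong_def)

lemma cong_eq_trans [trans]: "p \<asymp> q \<Longrightarrow> q = s \<Longrightarrow> p \<asymp> s" "p = q \<Longrightarrow> q \<asymp> s \<Longrightarrow> p \<asymp> s"
  by simp_all

lemma cong_add: "p \<asymp> p' \<Longrightarrow> q \<asymp> q' \<Longrightarrow> p + q \<asymp> p' + q'"
  using J_add[of "p - p'" "q - q'"] by (simp add: cong_def algebra_simps)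

lemma cong_minus: "p \<asymp> p' \<Longrightarrow> q \<asymp> q' \<Longrightarrow> p - q \<asymp> p' - q'"
  using J_add[of "p - p'" "- (q - q')"] J_uminus[of "q - q'"] by (simp add: cong_def algebra_simps)

lemma cong_mult: "p \<asymp> p' \<Longrightarrow> q \<asymp> q' \<Longrightarrow> p * q \<asymp> p' * q'"
  using J_add[OF J_right[of "p - p'" q] J_left[of "q - q'" p']] by (simp add: cong_def algebra_simps)

lemma cong_left: "q \<asymp> q' \<Longrightarrow> p * q \<asymp> p * q'"
  by (rule cong_mult) simp_all

lemma cong_right: "p \<asymp> p' \<Longrightarrow> p * q \<asymp> p' * q"
  by (rule cong_mult) simp_all

lemma cong_zero: "p \<in> J \<longleftrightarrow> p \<asymp> 0"
  by (simp add: cong_def)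

lemma cong_prod_list:
  "(\<And>i. i \<in> set l \<Longrightarrow> y i \<asymp> z i) \<Longrightarrow> prod_list (map y l) \<asymp> prod_list (map z l)"
  by (induction l) (auto intro!: cong_mult)

lemma cong_intertwine_mult:
  assumes "a * p \<asymp> p' * b" and "b * q \<asymp> q' * c"
  shows "a * (p * q) \<asymp> p' * q' * c"
proof -
  have "a * (p * q) \<asymp> p' * b * q" using cong_right[OF assms(1)] by (simp add: mult.assoc)
  also have "\<dots> = p' * (b * q)" by (simp add: mult.assoc)
  also have "\<dots> \<asymp> p' * (q' * c)" by (rule cong_left) fact
  finally show ?thesis by (simp add: mult.assoc)
qed

lemma cong_pass:
  "(\<And>i. i \<in> set l \<Longrightarrow> a * y i \<asymp> y i * a) \<Longrightarrow> a * prod_list (map y l) \<asymp> prod_list (map y l) * a"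
proof (induction l)
  case (Cons i l)
  show ?case unfolding list.map prod_list.Cons
    by (rule cong_intertwine_mult[OF Cons.prems Cons.IH]) (simp_all add: Cons.prems)
qed simp

lemma cong_pass_power: "a * y \<asymp> y * a \<Longrightarrow> a * y ^ k \<asymp> y ^ k * a"
proof (induction k)
  case (Suc k)
  then show ?case unfolding power_Suc by (blast intro: cong_intertwine_mult)
qed simp

lemma cong_insert:
  assumes "\<And>i. i \<in> set l \<Longrightarrow> y j * y i \<asymp> y i * y j" and "distinct l" and "j \<in> set l"
  shows "y j * prod_list (map (\<lambda>i. y i ^ s i) l) \<asymp>
    prod_list (map (\<lambda>i. y i ^ (s(j := Suc (s j))) i) l)"
  using assms
proof (induction l)
  case (Cons i l)
  show ?case
  proof (cases "i = j")
    case True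
    then have "prod_list (map (\<lambda>i. y i ^ (s(j := Suc (s j))) i) l) = prod_list (map (\<lambda>i. y i ^ s i) l)"
      using Cons.prems by (intro arg_cong[of _ _ prod_list] map_cong) auto
    then show ?thesis
      by (simp only: list.map prod_list.Cons True fun_upd_same power_Suc mult.assoc cong_refl)
  next
    case False
    have "y j * y i ^ s i \<asymp> y i ^ s i * y j" using Cons.prems by (intro cong_pass_power) simp
    then have "y j * (y i ^ s i * prod_list (map (\<lambda>i. y i ^ s i) l)) \<asymp>
        y i ^ s i * y j * prod_list (map (\<lambda>i. y i ^ s i) l)"
      unfolding mult.assoc[symmetric] by (rule cong_right)
    also have "\<dots> \<asymp> y i ^ s i * prod_list (map (\<lambda>i. y i ^ (s(j := Suc (s j))) i) l)"
      unfolding mult.assoc using Cons False by (intro cong_left) auto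
    finally show ?thesis using False by simp
  qed
qed simp

lemma rel_ff: "i \<in> {1..<n} \<Longrightarrow> j \<in> {1..<n} \<Longrightarrow> i + 2 \<le> j \<or> j + 2 \<le> i \<Longrightarrow> yf i * yf j \<asymp> yf j * yf i"
  unfolding cong_def by (rule subsetD[OF J_rel]) (unfold yh_relations_def, blast)

lemma rel_braid: "1 \<le> i \<Longrightarrow> i + 1 < n \<Longrightarrow>
    yf i * yf (i + 1) * yf i \<asymp> yf (i + 1) * yf i * yf (i + 1)"
  unfolding cong_def by (rule subsetD[OF J_rel]) (unfold yh_relations_def, blast)

lemma rel_tt: "i \<in> {1..n} \<Longrightarrow> j \<in> {1..n} \<Longrightarrow> yt i * yt j \<asymp> yt j * yt i"
  unfolding cong_def by (rule subsetD[OF J_rel]) (unfold yh_relations_def, blast)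

lemma rel_ft: "i \<in> {1..<n} \<Longrightarrow> j \<in> {1..n} \<Longrightarrow> yf i * yt j \<asymp> yt (transpose i (i + 1) j) * yf i"
  unfolding cong_def by (rule subsetD[OF J_rel]) (unfold yh_relations_def, blast)

lemma rel_t: "i \<in> {1..n} \<Longrightarrow> yt i ^ r \<asymp> 1"
  unfolding cong_def by (rule subsetD[OF J_rel]) (unfold yh_relations_def, blast)

lemma rel_f: "i \<in> {1..<n} \<Longrightarrow> yf i ^ 2 \<asymp> 1"
  unfolding cong_def by (rule subsetD[OF J_rel]) (unfold yh_relations_def, blast)

lemma rel_xx: "i \<in> {1..n} \<Longrightarrow> j \<in> {1..n} \<Longrightarrow> yx i * yx j \<asymp> yx j * yx i"
  unfolding cong_def by (rule subsetD[OF J_rel]) (unfold yh_relations_def, blast)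

lemma rel_fx: "i \<in> {1..<n} \<Longrightarrow> yf i * yx (i + 1) \<asymp> yx i * yf i + ye r i"
  unfolding cong_def by (rule subsetD[OF J_rel]) (unfold yh_relations_def, blast)

lemma rel_fx': "i \<in> {1..<n} \<Longrightarrow> j \<in> {1..n} \<Longrightarrow> j \<noteq> i \<Longrightarrow> j \<noteq> i + 1 \<Longrightarrow> yf i * yx j \<asymp> yx j * yf i"
  unfolding cong_def by (rule subsetD[OF J_rel]) (unfold yh_relations_def, blast)

lemma rel_tx: "i \<in> {1..n} \<Longrightarrow> j \<in> {1..n} \<Longrightarrow> yt j * yx i \<asymp> yx i * yt j"
  unfolding cong_def by (rule subsetD[OF J_rel]) (unfold yh_relations_def, blast)

lemma f_f_left: "i \<in> {1..<n} \<Longrightarrow> yf i * (yf i * p) \<asymp> p"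
  using cong_right[OF rel_f, of i p] by (simp add: power2_eq_square mult.assoc)

abbreviation FF :: "nat list \<Rightarrow> 'k yh_free" where "FF ks \<equiv> prod_list (map yf ks)"

text \<open>The letters k, ..., j - 1 commute with f_{j+1}; across f_j f_{j+1} the braid relation
  turns it into f_j, which commutes with the remaining letters.\<close>

lemma f_braid_word:
  assumes "1 \<le> k" and "k \<le> j" and "Suc j < l" and "l \<le> n"
  shows "yf (Suc j) * FF [k..<l] \<asymp> FF [k..<l] * yf j"
proof -
  have "[k..<l] = [k..<j] @ [j..<l]" using upt_add_eq_append[of k j "l - j"] assms by simp
  also have "[j..<l] = j # Suc j # [Suc (Suc j)..<l]" using assms by (simp add: upt_conv_Cons)
  finally have u: "FF [k..<l] = FF [k..<j] * (yf j * yf (Suc j) * FF [Suc (Suc j)..<l])"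
    by (simp add: mult.assoc)
  have "yf (Suc j) * (FF [k..<j] * ((yf j * yf (Suc j)) * FF [Suc (Suc j)..<l])) \<asymp>
      FF [k..<j] * ((yf j * yf (Suc j)) * FF [Suc (Suc j)..<l]) * yf j"
  proof (rule cong_intertwine_mult[OF _ cong_intertwine_mult])
    show "yf (Suc j) * FF [k..<j] \<asymp> FF [k..<j] * yf (Suc j)"
      using assms by (intro cong_pass rel_ff) auto
    show "yf (Suc j) * (yf j * yf (Suc j)) \<asymp> yf j * yf (Suc j) * yf j"
      using cong_sym[OF rel_braid[of j]] assms by (simp add: mult.assoc add_1_eq_Suc)
    show "yf j * FF [Suc (Suc j)..<l] \<asymp> FF [Suc (Suc j)..<l] * yf j"
      using assms by (intro cong_pass rel_ff) auto
  qed
  then show ?thesis unfolding u .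
qed

text \<open>Let k = w (Suc l) be the start of the leading cycle. If k = i, two equal letters cancel;
  if k = i + 1, the longer word is already canonical; if k > i + 1, f_i commutes with the cycle; if
  k < i, it emerges behind the cycle as f_{i-1}. In the last two cases the induction hypothesis
  absorbs the letter.\<close>

lemma f_canonical_word:
  "w permutes {1..l} \<Longrightarrow> l \<le> n \<Longrightarrow> i \<in> {1..<l} \<Longrightarrow> yf i * FF (canon_word l w) \<asymp> FF (canon_word l (adj i \<circ> w))"
proof (induction l arbitrary: w i)
  case (Suc l)
  define k where "k = w (Suc l)"
  define w' where "w' = perm (rev [k..<Suc l]) \<circ> w"
  have w': "w' permutes {1..l}" and k: "k \<in> {1..Suc l}"
    using canon_word_rest[OF Suc.prems(1)] by (simp_all only: w'_def k_def)
  have FF: "FF (canon_word (Suc l) w) = FF [k..<Suc l] * FF (canon_word l w')"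
    by (simp only: canon_word.simps k_def[symmetric] w'_def[symmetric] map_append prod_list.append)
  have k': "(adj i \<circ> w) (Suc l) = adj i k" by (simp add: k_def)
  have FF': "FF (canon_word (Suc l) (adj i \<circ> w)) =
      FF [adj i k..<Suc l] * FF (canon_word l (perm (rev [adj i k..<Suc l]) \<circ> (adj i \<circ> w)))"
    by (simp only: canon_word.simps k' map_append prod_list.append)
  have i: "i \<in> {1..<n}" "i < Suc l" using Suc.prems by auto
  have upt: "[i..<Suc l] = i # [Suc i..<Suc l]" using i by (intro upt_conv_Cons) simp
  consider "k = i" | "k = Suc i" | "Suc i < k" | "k < i" by linarith
  then show ?case
  proof cases
    case 1
    then have "adj i k = Suc i" by simp
    moreover have "perm (rev [Suc i..<Suc l]) \<circ> (adj i \<circ> w) = w'"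
      unfolding w'_def 1 upt by (simp only: rev.simps perm_append perm_simps comp_id comp_assoc)
    ultimately have "FF (canon_word (Suc l) (adj i \<circ> w)) = FF [Suc i..<Suc l] * FF (canon_word l w')"
      by (simp only: FF')
    then show ?thesis
      unfolding FF 1 upt using f_f_left[OF i(1)] by (simp only: list.map prod_list.Cons mult.assoc)
  next
    case 2
    then have 3: "adj i k = i" by simp
    have "adj i \<circ> (adj i \<circ> w) = w" by (simp add: o_assoc)
    then have "perm (rev [i..<Suc l]) \<circ> (adj i \<circ> w) = w'"
      unfolding w'_def 2 upt by (simp only: rev.simps perm_append perm_simps comp_id comp_assoc)
    then have "FF (canon_word (Suc l) (adj i \<circ> w)) = FF [i..<Suc l] * FF (canon_word l w')"
      by (simp only: FF' 3)
    then show ?thesis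
      unfolding FF 2 upt by (simp only: list.map prod_list.Cons mult.assoc cong_refl)
  next
    case 3
    then have 4: "adj i k = k" by simp
    have "adj i \<circ> perm [k..<Suc l] = perm [k..<Suc l] \<circ> adj i"
      using 3 k by (auto simp: fun_eq_iff perm_upt_apply transpose_def simp del: upt_Suc)
    then have "perm (rev [k..<Suc l]) \<circ> (adj i \<circ> w) = adj i \<circ> w'"
      unfolding w'_def by (rule perm_rev_comm)
    then have t: "FF (canon_word (Suc l) (adj i \<circ> w)) = FF [k..<Suc l] * FF (canon_word l (adj i \<circ> w'))"
      by (simp only: FF' 4)
    have "yf i * FF [k..<Suc l] \<asymp> FF [k..<Suc l] * yf i"
      using 3 k i Suc.prems by (intro cong_pass rel_ff) auto
    then have "yf i * FF (canon_word (Suc l) w) \<asymp> FF [k..<Suc l] * yf i * FF (canon_word l w')"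
      unfolding FF mult.assoc[symmetric] by (rule cong_right)
    also have "\<dots> = FF [k..<Suc l] * (yf i * FF (canon_word l w'))" by (simp only: mult.assoc)
    also have "\<dots> \<asymp> FF [k..<Suc l] * FF (canon_word l (adj i \<circ> w'))"
      by (rule cong_left, rule Suc.IH[OF w']) (use 3 k Suc.prems in auto)
    finally show ?thesis unfolding t .
  next
    case 4
    then obtain j where j: "i = Suc j" "k \<le> j" by (cases i) auto
    have 5: "adj i k = k" using 4 by simp
    have "adj i \<circ> perm [k..<Suc l] = perm [k..<Suc l] \<circ> adj j"
      using j k i by (auto simp: fun_eq_iff perm_upt_apply transpose_def simp del: upt_Suc)
    then have "perm (rev [k..<Suc l]) \<circ> (adj i \<circ> w) = adj j \<circ> w'"
      unfolding w'_def by (rule perm_rev_comm)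
    then have t: "FF (canon_word (Suc l) (adj i \<circ> w)) = FF [k..<Suc l] * FF (canon_word l (adj j \<circ> w'))"
      by (simp only: FF' 5)
    have "yf i * FF [k..<Suc l] \<asymp> FF [k..<Suc l] * yf j"
      unfolding j(1) using j k i Suc.prems by (intro f_braid_word) auto
    then have "yf i * FF (canon_word (Suc l) w) \<asymp> FF [k..<Suc l] * yf j * FF (canon_word l w')"
      unfolding FF mult.assoc[symmetric] by (rule cong_right)
    also have "\<dots> = FF [k..<Suc l] * (yf j * FF (canon_word l w'))" by (simp only: mult.assoc)
    also have "\<dots> \<asymp> FF [k..<Suc l] * FF (canon_word l (adj j \<circ> w'))"
      by (rule cong_left, rule Suc.IH[OF w']) (use j k i Suc.prems in auto)
    finally show ?thesis unfolding t .
  qed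
qed simp

text \<open>Modulo \<open>J\<close>, the map \<open>mon\<close> carries the operator \<open>A\<close> to left multiplication by \<open>a\<close>.\<close>

definition compat :: "(idx, 'k) endo \<Rightarrow> 'k yh_free \<Rightarrow> idx set \<Rightarrow> bool" where
  "compat A a I \<longleftrightarrow> (\<forall>u\<in>spn I. a * mon u \<asymp> mon (app A u))"

lemma compatD: "compat A a I \<Longrightarrow> u \<in> spn I \<Longrightarrow> a * mon u \<asymp> mon (app A u)"
  by (simp add: compat_def)

lemma compatI: "(\<And>i. i \<in> I \<Longrightarrow> a * mon (bv i) \<asymp> mon (app A (bv i))) \<Longrightarrow> compat A a I"
  unfolding compat_def
proof
  fix u :: "idx \<Rightarrow>\<^sub>0 'k" assume a: "\<And>i. i \<in> I \<Longrightarrow> a * mon (bv i) \<asymp> mon (app A (bv i))" and "u \<in> spn I"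
  from this(2) show "a * mon u \<asymp> mon (app A u)"
  proof (induction rule: spn_induct)
    case (basis i c)
    have "a * (const c * mon (bv i)) = const c * (a * mon (bv i))"
      by (simp only: mult.assoc[symmetric] const_comm[of c a])
    then show ?case
      using cong_left[OF a[OF basis], of "const c"] by (simp add: mon_linear app_vscale_right)
  qed (simp_all add: mon_linear app_add_right distrib_left cong_add)
qed

lemma compat_mono: "compat A a I \<Longrightarrow> I' \<subseteq> I \<Longrightarrow> compat A a I'"
  using spn_mono[of _ I' I] by (auto simp: compat_def)

lemma compat_mult:
  assumes "compat A a I'" and "compat B b I" and "pres B I I'"
  shows "compat (A * B) (a * b) I"
  unfolding compat_def
proof
  fix u :: "idx \<Rightarrow>\<^sub>0 'k" assume u: "u \<in> spn I"
  have "a * b * mon u \<asymp> a * mon (app B u)"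
    unfolding mult.assoc using compatD[OF assms(2) u] by (rule cong_left)
  also have "\<dots> \<asymp> mon (app A (app B u))"
    by (rule compatD[OF assms(1) presD[OF assms(3) u]])
  finally show "a * b * mon u \<asymp> mon (app (A * B) u)" by (simp add: app_mult)
qed

lemma compat_add: "compat A a I \<Longrightarrow> compat B b I \<Longrightarrow> compat (A + B) (a + b) I"
  by (simp add: compat_def distrib_right app_add_left mon_linear cong_add)

lemma compat_minus: "compat A a I \<Longrightarrow> compat B b I \<Longrightarrow> compat (A - B) (a - b) I"
  by (simp add: compat_def left_diff_distrib app_minus_left mon_linear cong_minus)

lemma compat_one [simp]: "compat 1 1 I"
  by (simp add: compat_def)

lemma compat_zero [simp]: "compat 0 0 I"
  by (simp add: compat_def mon_linear)

lemma compat_sc [simp]: "compat (sc c) (const c) I"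
  by (simp add: compat_def app_sc mon_linear)

lemma compat_sum: "(\<And>x. x \<in> B \<Longrightarrow> compat (A x) (a x) I) \<Longrightarrow> compat (\<Sum>x\<in>B. A x) (\<Sum>x\<in>B. a x) I"
  by (induction B rule: infinite_finite_induct) (auto intro: compat_add)

lemma compat_prod_list:
  "(\<And>x. x \<in> set l \<Longrightarrow> compat (A x) (a x) I \<and> pres (A x) I I) \<Longrightarrow>
    compat (prod_list (map A l)) (prod_list (map a l)) I \<and> pres (prod_list (map A l)) I I"
proof (induction l)
  case (Cons x l)
  then show ?case using compat_mult[of "A x" "a x" I "prod_list (map A l)" "prod_list (map a l)" I]
    pres_mult[of "A x" I I] by simp
qed simp

lemma compat_power: "compat A a I \<Longrightarrow> pres A I I \<Longrightarrow> compat (A ^ k) (a ^ k) I"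
proof (induction k)
  case (Suc k)
  then show ?case unfolding power_Suc by (intro compat_mult[of _ _ I]) (simp_all add: pres_power)
qed simp

lemma compat_T:
  assumes j: "j \<in> {1..n}"
  shows "compat (T j) (yt j) Aff"
proof (rule compatI)
  fix i assume "i \<in> Aff"
  obtain m s w where i: "i = (m, s, w)" by (cases i)
  let ?t = "\<lambda>s. prod_list (map (\<lambda>i. yt i ^ s i) [1..<n + 1]) :: 'k yh_free"
  have "yt j * ?t s \<asymp> ?t (s(j := Suc (s j)))"
    by (rule cong_insert) (use j in \<open>auto intro!: rel_tt simp: less_Suc_eq_le add_1_eq_Suc\<close>)
  also have "\<dots> \<asymp> ?t (s(j := rot r (s j)))"
  proof (rule cong_prod_list)
    fix l
    have "s j < r" using j \<open>i \<in> Aff\<close> by (simp add: i Aff_def)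
    \<comment> \<open>The rotation either raises the exponent or wraps r to 0, which t_j^r = 1
      allows.\<close>
    then have "rot r (s j) = Suc (s j) \<or> Suc (s j) = r \<and> rot r (s j) = 0"
      by (cases "Suc (s j) = r") (auto simp: rot_def)
    then show "yt l ^ (s(j := Suc (s j))) l \<asymp> yt l ^ (s(j := rot r (s j))) l"
      using rel_t[OF j] by auto
  qed
  finally show "yt j * mon (bv i) \<asymp> mon (app (T j) (bv i))"
    unfolding i opT_bv mon_bv yh_monomial_def mult.assoc[symmetric] by (intro cong_right)
qed

lemma compat_S:
  assumes k: "k \<in> {1..n}"
  shows "compat (S k) (yx k) Aff"
proof (rule compatI)
  fix i assume "i \<in> Aff"
  obtain m s w where i: "i = (m, s, w)" by (cases i)
  let ?t = "prod_list (map (\<lambda>i. yt i ^ s i) [1..<n + 1]) :: 'k yh_free"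
  let ?x = "\<lambda>m. prod_list (map (\<lambda>i. yx i ^ m i) [1..<n + 1]) :: 'k yh_free"
  have "yx k * ?t \<asymp> ?t * yx k"
    using k by (intro cong_pass cong_pass_power cong_sym[OF rel_tx]) auto
  then have "yx k * ?t * ?x m \<asymp> ?t * (yx k * ?x m)"
    unfolding mult.assoc[symmetric] by (rule cong_right)
  also have "\<dots> \<asymp> ?t * ?x (m(k := Suc (m k)))"
    by (rule cong_left, rule cong_insert) (use k in \<open>auto intro!: rel_xx simp: less_Suc_eq_le add_1_eq_Suc\<close>)
  finally show "yx k * mon (bv i) \<asymp> mon (app (S k) (bv i))"
    unfolding i opS_bv mon_bv yh_monomial_def mult.assoc[symmetric] by (intro cong_right)
qed

lemma compat_E: "i \<in> {1..<n} \<Longrightarrow> compat (E i (Suc i)) (ye r i) Aff"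
  unfolding opE_def ye_def add_1_eq_Suc
  by (intro compat_mult[of _ _ Aff] compat_sum compat_power compat_sc compat_T pres_T_Aff pres_sum
      pres_mult[of _ Aff] pres_power) auto

text \<open>The same commutation rule holds for the operators and modulo \<open>J\<close>, so
  agreement at u passes to \<open>app A u\<close>. It serves for t_j, for x_{i+1} and for the x_k
  away from i and i + 1.\<close>

lemma compat_F_step:
  assumes A: "compat A a Aff" and A': "compat A' a' Aff" and B: "compat B b Aff"
    and i: "i \<in> {1..<n}" and op: "F i * A = A' * F i + B" and rel: "yf i * a \<asymp> a' * yf i + b"
    and u: "u \<in> spn Aff" and P: "yf i * mon u \<asymp> mon (app (F i) u)"
  shows "yf i * mon (app A u) \<asymp> mon (app (F i) (app A u))"
proof -
  have "yf i * mon (app A u) \<asymp> yf i * (a * mon u)"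
    by (rule cong_left[OF cong_sym[OF compatD[OF A u]]])
  also have "\<dots> \<asymp> (a' * yf i + b) * mon u"
    unfolding mult.assoc[symmetric] by (rule cong_right[OF rel])
  also have "\<dots> = a' * (yf i * mon u) + b * mon u" by (simp add: distrib_right mult.assoc)
  also have "\<dots> \<asymp> a' * mon (app (F i) u) + mon (app B u)"
    by (intro cong_add cong_left P compatD[OF B u])
  also have "\<dots> \<asymp> mon (app A' (app (F i) u)) + mon (app B u)"
    using u i by (intro cong_add cong_refl compatD[OF A'] presD[OF pres_F_Aff])
  also have "\<dots> = mon (app (F i) (app A u))"
    using app_mult_eq[OF op, of u] by (simp add: app_add_left app_mult mon_linear)
  finally show ?thesis .
qed

definition Lev :: "(nat \<Rightarrow> nat) \<Rightarrow> idx set" where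
  "Lev m = {(m', s, w) \<in> Aff. m' = m}"

text \<open>The t_j are stripped off one by one; what remains is
  \<open>f_canonical_word\<close>.\<close>

lemma compat_F_zero:
  assumes i: "i \<in> {1..<n}"
  shows "compat (F i) (yf i) (Lev (\<lambda>_. 0))"
proof (rule compatI)
  fix x assume "x \<in> Lev (\<lambda>_. 0)"
  then obtain s w where x: "x = (\<lambda>_. 0, s, w)" "(\<lambda>_. 0, s, w) \<in> Aff" by (auto simp: Lev_def)
  from x(2) have "yf i * mon (bv (\<lambda>_. 0, s, w)) \<asymp> mon (app (F i) (bv (\<lambda>_. 0, s, w)))"
  proof (induction "\<Sum>j = 1..n. s j" arbitrary: s rule: less_induct)
    case less
    have w: "w permutes {1..n}" using less.prems by (simp add: Aff_def)
    show ?case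
    proof (cases "\<exists>j\<in>{1..n}. s j > 0")
      case False
      then have s: "s = (\<lambda>_. 0)" using less.prems by (auto simp: Aff_def fun_eq_iff)
      have one: "prod_list (map (\<lambda>i. 1) l) = (1 :: 'k yh_free)" for l :: "nat list"
        by (induction l) simp_all
      have "mon (bw u) = FF (canon_word n u)" for u
        by (simp add: mon_bv yh_monomial_def one)
      then show ?thesis
        using f_canonical_word[OF w order_refl i] unfolding s opF_bw by simp
    next
      case True
      then obtain j where j: "j \<in> {1..n}" "s j > 0" by auto
      let ?s = "s(j := s j - 1)"
      have "sum ?s {1..n} < sum s {1..n}"
        using j by (intro sum_strict_mono_ex1) auto
      moreover have s': "(\<lambda>_. 0, ?s, w) \<in> Aff"
        using less.prems j by (auto simp: Aff_def intro: less_imp_diff_less)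
      ultimately have P: "yf i * mon (bv (\<lambda>_. 0, ?s, w)) \<asymp> mon (app (F i) (bv (\<lambda>_. 0, ?s, w)))"
        by (rule less.hyps)
      have adj: "adj i j \<in> {1..n}" using adj_mem[OF i] j by simp
      have "s j < r" using less.prems j by (auto simp: Aff_def)
      then have "rot r (s j - 1) = s j" using j by (simp add: rot_def)
      then have Tb: "app (T j) (bv (\<lambda>_. 0, ?s, w)) = bv (\<lambda>_. 0, s, w)" by simp
      have "yf i * mon (app (T j) (bv (\<lambda>_. 0, ?s, w))) \<asymp> mon (app (F i) (app (T j) (bv (\<lambda>_. 0, ?s, w))))"
      proof (rule compat_F_step[OF compat_T[OF j(1)] compat_T[OF adj] compat_zero i _ _ _ P])
        show "yf i * yt j \<asymp> yt (adj i j) * yf i + 0" using rel_ft[OF i j(1)] by (simp add: add_1_eq_Suc)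
      qed (use s' in \<open>simp_all add: opF_T\<close>)
      then show ?thesis unfolding Tb .
    qed
  qed
  then show "yf i * mon (bv x) \<asymp> mon (app (F i) (bv x))" unfolding x(1) .
qed

text \<open>The relations rewrite f_i x_{i+1} only, so f_i x_i is reached by inserting f_i^2 = 1.
  That e_i commutes with f_i is taken from the operators and carried over by \<open>P\<close>; hence
  \<open>P\<close> is assumed on the whole level m, which e_i preserves.\<close>

lemma compat_F_S_self:
  assumes i: "i \<in> {1..<n}" and P: "compat (F i) (yf i) (Lev m)" and u: "u \<in> spn (Lev m)"
  shows "yf i * mon (app (S i) u) \<asymp> mon (app (F i) (app (S i) u))"
proof -
  have iS: "i \<in> {1..n}" "Suc i \<in> {1..n}" using i by auto
  have uA: "u \<in> spn Aff" using u by (rule spn_mono) (auto simp: Lev_def)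
  have FA: "app (F i) u \<in> spn Aff" by (rule presD[OF pres_F_Aff[OF i] uA])
  have "pres (E i (Suc i)) (Lev m) (Lev m)"
    using iS by (intro pres_opE presI) (auto simp: Lev_def Aff_T)
  then have Eu: "app (E i (Suc i)) u \<in> spn (Lev m)" using u by (rule presD)
  note ff = f_f_left[OF i]
  have 1: "mon (app (F i) (app (E i (Suc i)) u)) \<asymp> yf i * mon (app (E i (Suc i)) u)"
    by (rule cong_sym[OF compatD[OF P Eu]])
  have 2: "ye r i * mon (app (F i) u) \<asymp> yf i * mon (app (E i (Suc i)) u)"
  proof -
    have "ye r i * mon (app (F i) u) \<asymp> mon (app (E i (Suc i)) (app (F i) u))"
      by (rule compatD[OF compat_E[OF i] FA])
    also have "app (E i (Suc i)) (app (F i) u) = app (F i) (app (E i (Suc i)) u)"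
      by (rule app_app_eq) (simp add: opF_E_self)
    finally show ?thesis using 1 by (rule cong_trans)
  qed
  have "yx i * (yf i * mon (app (F i) u)) \<asymp>
      yf i * (yx (i + 1) * mon (app (F i) u)) - yf i * mon (app (E i (Suc i)) u)"
  proof -
    have "yx i * yf i \<asymp> yf i * yx (i + 1) - ye r i"
      using cong_sym[OF cong_minus[OF rel_fx[OF i] cong_refl[of "ye r i"]]] by simp
    then have "yx i * yf i * mon (app (F i) u) \<asymp> (yf i * yx (i + 1) - ye r i) * mon (app (F i) u)"
      by (rule cong_right)
    also have "\<dots> = yf i * (yx (i + 1) * mon (app (F i) u)) - ye r i * mon (app (F i) u)"
      by (simp add: left_diff_distrib mult.assoc)
    also have "\<dots> \<asymp> yf i * (yx (i + 1) * mon (app (F i) u)) - yf i * mon (app (E i (Suc i)) u)"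
      using 2 by (intro cong_minus cong_refl)
    finally show ?thesis by (simp add: mult.assoc)
  qed
  note 3 = this
  have "yf i * mon (app (S i) u) \<asymp> yf i * (yx i * mon u)"
    by (rule cong_left[OF cong_sym[OF compatD[OF compat_S[OF iS(1)] uA]]])
  also have "\<dots> \<asymp> yf i * (yx i * (yf i * mon (app (F i) u)))"
  proof (intro cong_left)
    have "mon u \<asymp> yf i * (yf i * mon u)" by (rule cong_sym[OF ff])
    also have "\<dots> \<asymp> yf i * mon (app (F i) u)" by (rule cong_left[OF compatD[OF P u]])
    finally show "mon u \<asymp> yf i * mon (app (F i) u)" .
  qed
  also have "\<dots> \<asymp> yf i * (yf i * (yx (i + 1) * mon (app (F i) u)) - yf i * mon (app (E i (Suc i)) u))"
    by (rule cong_left[OF 3])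
  also have "\<dots> \<asymp> yx (i + 1) * mon (app (F i) u) - mon (app (E i (Suc i)) u)"
    unfolding right_diff_distrib by (intro cong_minus ff)
  also have "\<dots> \<asymp> mon (app (S (Suc i)) (app (F i) u)) - mon (app (E i (Suc i)) u)"
    unfolding add_1_eq_Suc by (intro cong_minus cong_refl compatD[OF compat_S[OF iS(2)] FA])
  also have "\<dots> = mon (app (F i) (app (S i) u))"
    using app_mult_eq[OF opF_S[of r i], of u] by (simp add: app_minus_left app_mult mon_linear)
  finally show ?thesis .
qed

lemma compat_F_Lev:
  assumes i: "i \<in> {1..<n}" and "\<And>j. j \<notin> {1..n} \<Longrightarrow> m j = 0"
  shows "compat (F i) (yf i) (Lev m)"
  using assms(2)
proof (induction "deg m" arbitrary: m rule: less_induct)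
  case less
  show ?case
  proof (cases "\<exists>k\<in>{1..n}. m k > 0")
    case False
    then have "m = (\<lambda>_. 0)" using less.prems by (auto simp: fun_eq_iff)
    then show ?thesis using compat_F_zero[OF i] by simp
  next
    case True
    then obtain k where k: "k \<in> {1..n}" "m k > 0" by auto
    let ?m = "m(k := m k - 1)"
    have "deg ?m < deg m" using deg_upd[OF k(1), of m "m k - 1"] k(2) by simp
    then have P: "compat (F i) (yf i) (Lev ?m)"
      using less.prems by (intro less.hyps) auto
    have iS: "i \<in> {1..n}" "Suc i \<in> {1..n}" using i by auto
    show ?thesis
    proof (rule compatI)
      fix x assume "x \<in> Lev m"
      then obtain s w where x: "x = (m, s, w)" "(m, s, w) \<in> Aff" by (auto simp: Lev_def)
      let ?b = "bv (?m, s, w) :: idx \<Rightarrow>\<^sub>0 'k"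
      have b: "?b \<in> spn (Lev ?m)" "?b \<in> spn Aff"
        using Aff_upd[OF x(2) k(1)] by (simp_all add: Lev_def)
      have Sb: "app (S k) ?b = bv x" using k by (simp add: x)
      note Pb = compatD[OF P b(1)]
      have "yf i * mon (app (S k) ?b) \<asymp> mon (app (F i) (app (S k) ?b))"
      proof -
        consider "k = i" | "k = Suc i" | "k \<noteq> i" "k \<noteq> Suc i" by auto
        then show ?thesis
        proof cases
          case 1
          then show ?thesis using compat_F_S_self[OF i P b(1)] by simp
        next
          case 2
          show ?thesis unfolding 2
          proof (rule compat_F_step[OF compat_S[OF iS(2)] compat_S[OF iS(1)] compat_E[OF i] i opF_S_Suc])
            show "yf i * yx (Suc i) \<asymp> yx i * yf i + ye r i"
              using rel_fx[OF i] by (simp only: add_1_eq_Suc)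
          qed (use b Pb 2 in simp_all)
        next
          case 3
          show ?thesis
          proof (rule compat_F_step[OF compat_S[OF k(1)] compat_S[OF k(1)] compat_zero i])
            show "yf i * yx k \<asymp> yx k * yf i + 0"
              using rel_fx'[OF i k(1)] 3 by (simp add: add_1_eq_Suc)
          qed (use b Pb 3 in \<open>simp_all add: opF_S_other\<close>)
        qed
      qed
      then show "yf i * mon (bv x) \<asymp> mon (app (F i) (bv x))" unfolding Sb .
    qed
  qed
qed

lemma compat_F:
  assumes i: "i \<in> {1..<n}"
  shows "compat (F i) (yf i) Aff"
proof (rule compatI)
  fix x assume "x \<in> Aff"
  obtain m s w where x: "x = (m, s, w)" by (cases x)
  have "compat (F i) (yf i) (Lev m)"
    using \<open>x \<in> Aff\<close> by (intro compat_F_Lev[OF i]) (auto simp: x Aff_def)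
  then show "yf i * mon (bv x) \<asymp> mon (app (F i) (bv x))"
    by (rule compatD) (use \<open>x \<in> Aff\<close> in \<open>simp add: x Lev_def\<close>)
qed

text \<open>\<open>S 1\<close> and \<open>opX 1\<close> differ by a multiple of the cyclotomic
  polynomial, which lies in \<open>J\<close>. For x_{k+1}, f_k^2 = 1 is inserted and f_k x_{k+1} is
  replaced by the relation.\<close>

lemma compat_X: "k \<in> {1..n} \<Longrightarrow> compat (opX k) (yx k) Trn"
proof (induction k rule: opX_induct)
  case one
  have 1: "1 \<in> {1..n}" using n_pos by simp
  have "compat (prod_list (map (\<lambda>k. S 1 - sc (v k)) [1..<d + 1]))
      (prod_list (map (\<lambda>k. yx 1 - const (v k)) [1..<d + 1])) Aff \<and>
    pres (prod_list (map (\<lambda>k. S 1 - sc (v k)) [1..<d + 1])) Aff Aff"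
    by (rule compat_prod_list)
      (intro conjI compat_minus compat_S[OF 1] compat_sc pres_minus pres_S_Aff[OF 1] pres_sc)
  then have P: "compat (pl vs (S 1)) cyc Aff"
    by (simp add: pl_def vs_def cyc_def o_def)
  show ?case unfolding compat_def
  proof
    fix u :: "idx \<Rightarrow>\<^sub>0 'k" assume "u \<in> spn Trn"
    then have u: "u \<in> spn Aff" by (rule spn_mono[OF _ Trn_Aff])
    let ?z = "app (opK (d - 1)) u"
    have "yx 1 * mon u \<asymp> mon (app (S 1) u)"
      by (rule compatD[OF compat_S[OF 1] u])
    also have "\<dots> = mon (app (opX 1) u) + mon (app (pl vs (S 1)) ?z)"
      by (simp add: opX_1 app_minus_left app_mult mon_linear)
    also have "\<dots> \<asymp> mon (app (opX 1) u) + cyc * mon ?z"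
      by (intro cong_add cong_refl cong_sym[OF compatD[OF P presD[OF pres_K_Aff u]]])
    also have "\<dots> \<asymp> mon (app (opX 1) u) + 0"
      using J_cyc J_right by (intro cong_add cong_refl) (simp add: cong_zero[symmetric])
    finally show "yx 1 * mon u \<asymp> mon (app (opX 1) u)" by simp
  qed
next
  case (Suc k)
  then have k: "k \<in> {1..<n}" "k \<in> {1..n}" by auto
  have FT: "compat (F k) (yf k) Trn" "compat (E k (Suc k)) (ye r k) Trn"
    using compat_F compat_E k Trn_Aff by (blast intro: compat_mono)+
  have "compat (F k * (opX k * F k + E k (Suc k))) (yf k * (yx k * yf k + ye r k)) Trn"
    using k by (intro compat_mult[of _ _ Trn] compat_add FT Suc.IH pres_add pres_mult[of _ Trn]
        pres_F_Trn pres_X_Trn pres_E_Trn) auto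
  moreover have "F k * (opX k * F k + E k (Suc k)) = opX (Suc k)"
    using Suc.hyps by (simp add: opX_Suc distrib_left mult.assoc opF_E_self)
  ultimately have *: "compat (opX (Suc k)) (yf k * (yx k * yf k + ye r k)) Trn" by simp
  show ?case unfolding compat_def
  proof
    fix u :: "idx \<Rightarrow>\<^sub>0 'k" assume u: "u \<in> spn Trn"
    have "yx (Suc k) \<asymp> yf k * (yf k * yx (Suc k))" by (rule cong_sym[OF f_f_left[OF k(1)]])
    also have "\<dots> \<asymp> yf k * (yx k * yf k + ye r k)"
      using rel_fx[OF k(1)] unfolding add_1_eq_Suc by (rule cong_left)
    finally have "yx (Suc k) * mon u \<asymp> yf k * (yx k * yf k + ye r k) * mon u" by (rule cong_right)
    also have "\<dots> \<asymp> mon (app (opX (Suc k)) u)" by (rule compatD[OF * u])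
    finally show "yx (Suc k) * mon u \<asymp> mon (app (opX (Suc k)) u)" .
  qed
qed simp

lemma compat_Phi:
  assumes "p \<in> car"
  shows "compat (Phi p) p Trn"
proof -
  have "compat (phi g) (gen g) Trn" if "g \<in> yh_gens n" for g
    using that by (auto simp: yh_gens_def
      intro!: compat_X compat_mono[OF compat_T Trn_Aff] compat_mono[OF compat_F Trn_Aff])
  then have "compat (prod_list (map phi l)) (prod_list (map gen l)) Trn \<and>
      pres (prod_list (map phi l)) Trn Trn" if "set l \<subseteq> yh_gens n" for l
    using that by (intro compat_prod_list) (auto simp: pres_phi)
  then have "compat (Phi p) (free.fhom gen p) Trn"
    unfolding Phi_def opr.fhom_def free.fhom_def lext_def
    using assms by (intro compat_sum compat_mult[of _ _ Trn]) (auto simp: car_def)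
  then show ?thesis by (simp only: free_fhom_gen)
qed

text \<open>As \<open>mon (bw id) = 1\<close>, comparison on the vector of 1 writes p modulo
  \<open>J\<close> as a combination of truncated monomials: they span.\<close>

lemma cong_mon_Phi:
  assumes "p \<in> car"
  shows "p - mon (app (Phi p) (bw id)) \<in> J"
proof -
  have "mon (bw id) = 1"
  proof -
    have "prod_list (map (\<lambda>i. 1) l) = (1 :: 'k yh_free)" for l :: "nat list"
      by (induction l) simp_all
    then show ?thesis by (simp add: mon_bv yh_monomial_def canon_word_id del: upt_Suc)
  qed
  then show ?thesis
    using compatD[OF compat_Phi[OF assms] bw_Trn[OF permutes_id]] by (simp add: cong_def)
qed

end

end

section \<open>Quotients of associative algebras\<close>

lemma assoc_algebraI:
  fixes A :: "('k :: field, 'a) module" (structure)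
  assumes "ring A"
    and "\<And>c x. x \<in> carrier A \<Longrightarrow> c \<odot> x \<in> carrier A"
    and "\<And>b c x. x \<in> carrier A \<Longrightarrow> (b + c) \<odot> x = b \<odot> x \<oplus> c \<odot> x"
    and "\<And>c x y. x \<in> carrier A \<Longrightarrow> y \<in> carrier A \<Longrightarrow> c \<odot> (x \<oplus> y) = c \<odot> x \<oplus> c \<odot> y"
    and "\<And>b c x. x \<in> carrier A \<Longrightarrow> (b * c) \<odot> x = b \<odot> (c \<odot> x)"
    and "\<And>x. x \<in> carrier A \<Longrightarrow> 1 \<odot> x = x"
    and "\<And>c x y. x \<in> carrier A \<Longrightarrow> y \<in> carrier A \<Longrightarrow> (c \<odot> x) \<otimes> y = c \<odot> (x \<otimes> y)"
    and "\<And>c x y. x \<in> carrier A \<Longrightarrow> y \<in> carrier A \<Longrightarrow> x \<otimes> (c \<odot> y) = c \<odot> (x \<otimes> y)"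
  shows "assoc_algebra A"
proof -
  interpret ring A by fact
  have "module (ring_of_type_algebra :: 'k ring) A"
    by (rule moduleI)
      (use assms abelian_group_axioms cring_from_type_algebra in \<open>auto simp: ring_of_type_algebra_def\<close>)
  then show ?thesis
    by (intro assoc_algebra.intro assoc_algebra_axioms.intro assms)
qed

lemma carrier_free_algebra:
  "carrier (free_algebra V) = {p. \<forall>w\<in>keys p. set (letters w) \<subseteq> V}"
  by (simp add: free_algebra_def)

lemma free_algebra_sel:
  "x \<otimes>\<^bsub>free_algebra V\<^esub> y = x * y" "\<one>\<^bsub>free_algebra V\<^esub> = 1" "\<zero>\<^bsub>free_algebra V\<^esub> = 0"
  "x \<oplus>\<^bsub>free_algebra V\<^esub> y = x + y" "c \<odot>\<^bsub>free_algebra V\<^esub> x = const c * x"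
  by (simp_all add: free_algebra_def)

lemma free_closed:
  fixes p q :: "'g free_monoid \<Rightarrow>\<^sub>0 'k :: field"
  shows "0 \<in> carrier (free_algebra V)" "1 \<in> carrier (free_algebra V)"
    "const c \<in> carrier (free_algebra V)" "g \<in> V \<Longrightarrow> gen g \<in> carrier (free_algebra V)"
    "p \<in> carrier (free_algebra V) \<Longrightarrow> q \<in> carrier (free_algebra V) \<Longrightarrow> p + q \<in> carrier (free_algebra V)"
    "p \<in> carrier (free_algebra V) \<Longrightarrow> q \<in> carrier (free_algebra V) \<Longrightarrow> p - q \<in> carrier (free_algebra V)"
    "p \<in> carrier (free_algebra V) \<Longrightarrow> q \<in> carrier (free_algebra V) \<Longrightarrow> p * q \<in> carrier (free_algebra V)"
proof -
  show "0 \<in> carrier (free_algebra V)" "1 \<in> carrier (free_algebra V)"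
    "const c \<in> carrier (free_algebra V)" "g \<in> V \<Longrightarrow> gen g \<in> carrier (free_algebra V)"
    by (auto simp: carrier_free_algebra const_def gen_def zero_free_monoid_def split: if_splits)
  show "p + q \<in> carrier (free_algebra V)" "p - q \<in> carrier (free_algebra V)" "p * q \<in> carrier (free_algebra V)"
    if "p \<in> carrier (free_algebra V)" "q \<in> carrier (free_algebra V)"
  proof -
    show "p + q \<in> carrier (free_algebra V)"
      using that Poly_Mapping.keys_add[of p q] by (auto simp: carrier_free_algebra)
    have "keys (p - q) \<subseteq> keys p \<union> keys q"
      by (auto simp: in_keys_iff lookup_minus)
    then show "p - q \<in> carrier (free_algebra V)"
      using that by (auto simp: carrier_free_algebra)
    show "p * q \<in> carrier (free_algebra V)"
      using that Poly_Mapping.keys_mult[of p q]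
      by (fastforce simp: carrier_free_algebra plus_free_monoid_def)
  qed
qed

lemma free_closed_prod_list:
  "(\<And>p. p \<in> set ps \<Longrightarrow> p \<in> carrier (free_algebra V)) \<Longrightarrow> prod_list ps \<in> carrier (free_algebra V)"
  by (induction ps) (auto intro: free_closed)

lemma free_closed_sum:
  "(\<And>x. x \<in> I \<Longrightarrow> p x \<in> carrier (free_algebra V)) \<Longrightarrow> (\<Sum>x\<in>I. p x) \<in> carrier (free_algebra V)"
  by (induction I rule: infinite_finite_induct) (auto intro: free_closed)

lemma free_closed_power: "p \<in> carrier (free_algebra V) \<Longrightarrow> p ^ k \<in> carrier (free_algebra V)"
  by (induction k) (auto intro: free_closed)

lemma assoc_algebra_free: "assoc_algebra (free_algebra V :: ('k :: field, _) module)"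
proof (rule assoc_algebraI)
  have "abelian_group (free_algebra V :: ('k, _) module)"
  proof (rule abelian_groupI)
    fix x :: "'a free_monoid \<Rightarrow>\<^sub>0 'k" assume "x \<in> carrier (free_algebra V)"
    then show "\<exists>y\<in>carrier (free_algebra V). y \<oplus>\<^bsub>free_algebra V\<^esub> x = \<zero>\<^bsub>free_algebra V\<^esub>"
      using free_closed(6)[OF free_closed(1)] by (intro bexI[of _ "0 - x"]) (simp_all add: free_algebra_sel)
  qed (simp_all add: free_algebra_sel free_closed ac_simps)
  moreover have "monoid (free_algebra V :: ('k, _) module)"
    by (rule monoidI) (simp_all add: free_algebra_sel free_closed ac_simps)
  ultimately show "ring (free_algebra V :: ('k, _) module)"
    by (rule ringI) (simp_all add: free_algebra_sel algebra_simps)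
  fix c :: 'k and x y :: "'a free_monoid \<Rightarrow>\<^sub>0 'k"
  show "x \<otimes>\<^bsub>free_algebra V\<^esub> (c \<odot>\<^bsub>free_algebra V\<^esub> y) =
      c \<odot>\<^bsub>free_algebra V\<^esub> (x \<otimes>\<^bsub>free_algebra V\<^esub> y)"
    by (simp only: free_algebra_sel mult.assoc[symmetric] const_comm[of c x])
qed (simp_all only: free_algebra_sel free_closed free.\<kappa>_add free.\<kappa>_mult free.\<kappa>_one
    distrib_left distrib_right mult.assoc mult_1_left)

lemma assoc_algebra_image:
  fixes A :: "('k :: field, 'a) module" and B :: "('k, 'b) module"
  assumes A: "assoc_algebra A" and surj: "h ` carrier A = carrier B"
    and mult: "\<And>x y. x \<in> carrier A \<Longrightarrow> y \<in> carrier A \<Longrightarrow> h (x \<otimes>\<^bsub>A\<^esub> y) = h x \<otimes>\<^bsub>B\<^esub> h y"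
    and add: "\<And>x y. x \<in> carrier A \<Longrightarrow> y \<in> carrier A \<Longrightarrow> h (x \<oplus>\<^bsub>A\<^esub> y) = h x \<oplus>\<^bsub>B\<^esub> h y"
    and one: "h \<one>\<^bsub>A\<^esub> = \<one>\<^bsub>B\<^esub>" and zero: "h \<zero>\<^bsub>A\<^esub> = \<zero>\<^bsub>B\<^esub>"
    and smult: "\<And>c x. x \<in> carrier A \<Longrightarrow> h (c \<odot>\<^bsub>A\<^esub> x) = c \<odot>\<^bsub>B\<^esub> h x"
  shows "assoc_algebra B"
proof (rule assoc_algebraI)
  interpret A: assoc_algebra A by fact
  have K: "c \<in> carrier (ring_of_type_algebra :: 'k ring)" for c
    by (simp add: ring_of_type_algebra_def)
  have K_sel: "b \<oplus>\<^bsub>ring_of_type_algebra\<^esub> c = b + c" "b \<otimes>\<^bsub>ring_of_type_algebra\<^esub> c = b * c"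
    "\<one>\<^bsub>ring_of_type_algebra\<^esub> = (1 :: 'k)" for b c :: 'k
    by (simp_all add: ring_of_type_algebra_def)
  have rep: "\<exists>x\<in>carrier A. y = h x" if "y \<in> carrier B" for y
    using that surj by auto
  have cl: "h x \<in> carrier B" if "x \<in> carrier A" for x
    using that surj by auto
  note cl' = A.m_closed A.a_closed A.one_closed A.zero_closed A.smult_closed[OF K]
  note hom = mult[symmetric] add[symmetric] smult[symmetric] one[symmetric] zero[symmetric]
  have "abelian_group B"
  proof (rule abelian_groupI)
    fix y assume "y \<in> carrier B"
    then obtain x where x: "x \<in> carrier A" "y = h x" using rep by blast
    show "\<exists>z\<in>carrier B. z \<oplus>\<^bsub>B\<^esub> y = \<zero>\<^bsub>B\<^esub>"
      by (rule bexI[of _ "h (\<ominus>\<^bsub>A\<^esub> x)"]) (use x in \<open>simp_all add: hom cl A.l_neg\<close>)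
  qed (auto dest!: rep simp: hom cl cl' A.a_ac)
  moreover have "monoid B"
    by (rule monoidI) (auto dest!: rep simp: hom cl cl' A.m_assoc)
  ultimately show "ring B"
    by (rule ringI) (auto dest!: rep simp: hom cl cl' A.l_distr A.r_distr)
  fix x y assume "x \<in> carrier B" and "y \<in> carrier B"
  then obtain x' y' where x: "x' \<in> carrier A" "x = h x'" and y: "y' \<in> carrier A" "y = h y'"
    using rep by blast
  note [simp] = x(1) y(1) cl'
  show "c \<odot>\<^bsub>B\<^esub> x \<in> carrier B" for c by (simp add: x(2) hom cl)
  show "(b + c) \<odot>\<^bsub>B\<^esub> x = b \<odot>\<^bsub>B\<^esub> x \<oplus>\<^bsub>B\<^esub> c \<odot>\<^bsub>B\<^esub> x" for b c
    using A.smult_l_distr[OF K K, of x' b c] by (simp add: x(2) hom K_sel)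
  show "c \<odot>\<^bsub>B\<^esub> (x \<oplus>\<^bsub>B\<^esub> y) = c \<odot>\<^bsub>B\<^esub> x \<oplus>\<^bsub>B\<^esub> c \<odot>\<^bsub>B\<^esub> y" for c
    using A.smult_r_distr[OF K, of x' y' c] by (simp add: x(2) y(2) hom)
  show "(b * c) \<odot>\<^bsub>B\<^esub> x = b \<odot>\<^bsub>B\<^esub> (c \<odot>\<^bsub>B\<^esub> x)" for b c
    using A.smult_assoc1[OF K K, of x' b c] by (simp add: x(2) hom K_sel)
  show "1 \<odot>\<^bsub>B\<^esub> x = x"
    using A.smult_one[of x'] by (simp add: x(2) hom K_sel)
  show "c \<odot>\<^bsub>B\<^esub> x \<otimes>\<^bsub>B\<^esub> y = c \<odot>\<^bsub>B\<^esub> (x \<otimes>\<^bsub>B\<^esub> y)" for c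
    using A.smult_mult_left[of x' y' c] by (simp add: x(2) y(2) hom)
  show "x \<otimes>\<^bsub>B\<^esub> (c \<odot>\<^bsub>B\<^esub> y) = c \<odot>\<^bsub>B\<^esub> (x \<otimes>\<^bsub>B\<^esub> y)" for c
    using A.smult_mult_right[of x' y' c] by (simp add: x(2) y(2) hom)
qed

locale algebra_quotient = assoc_algebra A for A :: "('k :: field, 'a) module" (structure) +
  fixes R :: "'a set"
  assumes R_carrier: "R \<subseteq> carrier A"
begin

abbreviation "Q \<equiv> quot_algebra A R"
abbreviation "\<pi> \<equiv> quot_proj A R"

sublocale I: ideal "Idl R" A
  by (rule genideal_ideal) (rule R_carrier)

lemma K_carrier [simp]: "c \<in> carrier (ring_of_type_algebra :: 'k ring)"
  by (simp add: ring_of_type_algebra_def)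

lemma proj_surj: "\<pi> ` carrier A = carrier Q"
  by (auto simp: quot_algebra_def Let_def FactRing_simps quot_proj_def)

lemma proj_closed [simp]: "x \<in> carrier A \<Longrightarrow> \<pi> x \<in> carrier Q"
  using proj_surj by auto

lemma proj_mult: "x \<in> carrier A \<Longrightarrow> y \<in> carrier A \<Longrightarrow> \<pi> (x \<otimes> y) = \<pi> x \<otimes>\<^bsub>Q\<^esub> \<pi> y"
  by (simp add: quot_algebra_def Let_def FactRing_def quot_proj_def I.rcoset_mult_add)

lemma proj_add: "x \<in> carrier A \<Longrightarrow> y \<in> carrier A \<Longrightarrow> \<pi> (x \<oplus> y) = \<pi> x \<oplus>\<^bsub>Q\<^esub> \<pi> y"
  by (simp add: quot_algebra_def Let_def FactRing_def quot_proj_def I.a_rcos_sum)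

lemma proj_one: "\<pi> \<one> = \<one>\<^bsub>Q\<^esub>"
  by (simp add: quot_algebra_def Let_def FactRing_def quot_proj_def)

lemma proj_zero: "\<pi> \<zero> = \<zero>\<^bsub>Q\<^esub>"
  by (simp add: quot_algebra_def Let_def FactRing_def quot_proj_def I.a_rcos_const)

lemma proj_eq_zero: "x \<in> carrier A \<Longrightarrow> \<pi> x = \<zero>\<^bsub>Q\<^esub> \<longleftrightarrow> x \<in> Idl R"
  using I.rcos_const_imp_mem[of x] I.a_rcos_const[of x]
  by (auto simp: quot_algebra_def Let_def FactRing_def quot_proj_def)

text \<open>The scalar action on cosets is a union over representatives. All its members coincide,
  because c i = (c 1) i stays in the ideal for i in it.\<close>

lemma proj_smult:
  assumes x: "x \<in> carrier A"
  shows "\<pi> (c \<odot> x) = c \<odot>\<^bsub>Q\<^esub> \<pi> x"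
proof -
  have "Idl R +> (c \<odot> y) = Idl R +> (c \<odot> x)" if y: "y \<in> Idl R +> x" for y
  proof -
    obtain i where i: "i \<in> Idl R" "y = i \<oplus> x" using y by (auto simp: a_r_coset_def r_coset_def)
    have iA: "i \<in> carrier A" using i(1) by (rule I.a_Hcarr)
    have "c \<odot> i = (c \<odot> \<one>) \<otimes> i" using iA by (simp add: smult_mult_left)
    then have "c \<odot> i \<in> Idl R" using i(1) I.I_l_closed by simp
    moreover have "c \<odot> y = c \<odot> i \<oplus> c \<odot> x" using iA x by (simp add: i(2) smult_r_distr)
    ultimately have "c \<odot> y \<in> Idl R +> (c \<odot> x)"
      using x by (auto intro!: a_rcosI I.a_subset)
    then show ?thesis
      using x by (intro a_repr_independence[symmetric]) (auto intro: I.a_subgroup)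
  qed
  moreover have "x \<in> Idl R +> x" by (rule I.a_rcos_self) fact
  ultimately have "(\<Union>y\<in>Idl R +> x. Idl R +> (c \<odot> y)) = Idl R +> (c \<odot> x)" by blast
  then show ?thesis by (simp add: quot_algebra_def Let_def quot_proj_def)
qed

lemma assoc_algebra_Q: "assoc_algebra Q"
  by (rule assoc_algebra_image[OF assoc_algebra_axioms proj_surj])
    (simp_all add: proj_mult proj_add proj_one proj_zero proj_smult)

end

text \<open>An ideal of the quotient pulls back to an ideal, so the kernel of an iterated quotient map is the
  least ideal that contains both sets of relations.\<close>

lemma iterated_quotient_kernel:
  fixes A :: "('k :: field, 'a) module" (structure)
  assumes "algebra_quotient A R" and c: "c \<in> carrier A"
    and J: "ideal J A" and "R \<subseteq> J" and "c \<in> J" and x: "x \<in> carrier A"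
    and "quot_proj (quot_algebra A R) {quot_proj A R c} (quot_proj A R x) =
      \<zero>\<^bsub>quot_algebra (quot_algebra A R) {quot_proj A R c}\<^esub>"
  shows "x \<in> J"
proof -
  interpret q: algebra_quotient A R by fact
  interpret Q: algebra_quotient q.Q "{q.\<pi> c}"
    using q.assoc_algebra_Q c by (intro algebra_quotient.intro algebra_quotient_axioms.intro) simp_all
  interpret J: ideal J A by fact
  have JA: "y \<in> carrier A" if "y \<in> J" for y using that by (rule J.a_Hcarr)
  have "ideal (q.\<pi> ` J) q.Q"
  proof (rule idealI)
    show "ring q.Q" by (rule Q.ring_axioms)
    show "subgroup (q.\<pi> ` J) (add_monoid q.Q)"
    proof (rule group.subgroupI[OF Q.a_group])
      show "q.\<pi> ` J \<noteq> {}" using additive_subgroup.zero_closed[OF J.additive_subgroup_axioms] by blast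
      fix y assume "y \<in> q.\<pi> ` J"
      then obtain y' where y': "y' \<in> J" "y = q.\<pi> y'" by auto
      have "q.\<pi> (\<ominus> y') \<oplus>\<^bsub>q.Q\<^esub> y = \<zero>\<^bsub>q.Q\<^esub>"
        using JA[OF y'(1)] by (simp add: y'(2) q.proj_add[symmetric] q.l_neg q.proj_zero)
      then have "\<ominus>\<^bsub>q.Q\<^esub> y = q.\<pi> (\<ominus> y')"
        using JA[OF y'(1)] by (intro Q.minus_equality) (auto simp: y'(2))
      then show "inv\<^bsub>add_monoid q.Q\<^esub> y \<in> q.\<pi> ` J"
        using y'(1) by (simp add: a_inv_def[symmetric])
    qed (use JA in \<open>auto simp: q.proj_add[symmetric]\<close>)
    show "a \<otimes>\<^bsub>q.Q\<^esub> y \<in> q.\<pi> ` J" "y \<otimes>\<^bsub>q.Q\<^esub> a \<in> q.\<pi> ` J"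
      if "y \<in> q.\<pi> ` J" "a \<in> carrier q.Q" for a y
    proof -
      have "a \<in> q.\<pi> ` carrier A" using \<open>a \<in> carrier q.Q\<close> by (simp only: q.proj_surj)
      then obtain a' where "a' \<in> carrier A" "a = q.\<pi> a'" by blast
      moreover obtain y' where "y' \<in> J" "y = q.\<pi> y'" using \<open>y \<in> q.\<pi> ` J\<close> by blast
      ultimately show "a \<otimes>\<^bsub>q.Q\<^esub> y \<in> q.\<pi> ` J" "y \<otimes>\<^bsub>q.Q\<^esub> a \<in> q.\<pi> ` J"
        using JA by (auto simp: q.proj_mult[symmetric] J.I_l_closed J.I_r_closed)
    qed
  qed
  then have "Idl\<^bsub>q.Q\<^esub> {q.\<pi> c} \<subseteq> q.\<pi> ` J"
    using \<open>c \<in> J\<close> by (intro Q.genideal_minimal) auto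
  moreover have "q.\<pi> x \<in> Idl\<^bsub>q.Q\<^esub> {q.\<pi> c}"
    using assms(7) x by (subst Q.proj_eq_zero[symmetric]) simp_all
  ultimately obtain y where y: "y \<in> J" "q.\<pi> x = q.\<pi> y" by auto
  have yA: "y \<in> carrier A" by (rule JA) fact
  have "q.\<pi> (x \<oplus> \<ominus> y) = q.\<pi> (y \<oplus> \<ominus> y)"
    using x yA y(2) by (simp add: q.proj_add)
  then have "q.\<pi> (x \<oplus> \<ominus> y) = \<zero>\<^bsub>q.Q\<^esub>"
    using yA by (simp add: q.r_neg q.proj_zero)
  then have "x \<oplus> \<ominus> y \<in> Idl R" using x yA by (subst q.proj_eq_zero[symmetric]) simp_all
  moreover have "Idl R \<subseteq> J" using J \<open>R \<subseteq> J\<close> by (rule q.genideal_minimal)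
  ultimately have "(x \<oplus> \<ominus> y) \<oplus> y \<in> J"
    using y(1) additive_subgroup.a_closed[OF J.additive_subgroup_axioms] by blast
  then show ?thesis using x yA by (simp add: q.a_assoc q.l_neg)
qed

section \<open>The cyclotomic quotient\<close>

text \<open>Killing the generators outside \<open>V\<close> is a retraction onto the free algebra on \<open>V\<close>. Along it, ideals of that
  algebra pull back to ideals of the whole type, where congruences need no carrier conditions.\<close>

definition restrict_gens :: "'g set \<Rightarrow> ('g free_monoid \<Rightarrow>\<^sub>0 'k :: field) \<Rightarrow> 'g free_monoid \<Rightarrow>\<^sub>0 'k" where
  "restrict_gens V = free.fhom (\<lambda>g. if g \<in> V then gen g else 0)"

lemma restrict_gens_closed: "restrict_gens V p \<in> carrier (free_algebra V)"
  unfolding restrict_gens_def free.fhom_def lext_def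
  by (intro free_closed_sum free_closed(7) free_closed_prod_list) (auto intro: free_closed)

lemma restrict_gens_id:
  assumes "p \<in> carrier (free_algebra V)"
  shows "restrict_gens V p = p"
proof -
  have "map (\<lambda>g. if g \<in> V then gen g else 0) (letters w) = (map gen (letters w) :: ('a free_monoid \<Rightarrow>\<^sub>0 'b) list)"
    if "w \<in> keys p" for w
    using assms that by (auto simp: carrier_free_algebra)
  then have "restrict_gens V p = free.fhom gen p"
    unfolding restrict_gens_def free.fhom_def lext_def by (intro sum.cong) (simp_all only:)
  then show ?thesis by (simp only: free_fhom_gen)
qed

lemma ye_closed: "i \<in> {1..<n} \<Longrightarrow> ye r i \<in> carrier (free_algebra (yh_gens n))"
  unfolding ye_def
  by (intro free_closed(7) free_closed(3) free_closed_sum free_closed_power free_closed(4))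
    (auto simp: yh_gens_def)

lemma relations_closed: "yh_relations r n \<subseteq> carrier (free_algebra (yh_gens n))"
proof -
  have t: "yt i \<in> carrier (free_algebra (yh_gens n))" if "i \<in> {1..n}" for i
    using that by (intro free_closed(4)) (auto simp: yh_gens_def)
  have x: "yx i \<in> carrier (free_algebra (yh_gens n))" if "i \<in> {1..n}" for i
    using that by (intro free_closed(4)) (auto simp: yh_gens_def)
  have f: "yf i \<in> carrier (free_algebra (yh_gens n))" if "i \<in> {1..<n}" for i
    using that by (intro free_closed(4)) (auto simp: yh_gens_def)
  have a: "transpose i (i + 1) j \<in> {1..n}" if "i \<in> {1..<n}" "j \<in> {1..n}" for i j
    using that by (auto simp: transpose_def)
  note cl = free_closed(2,5-7) free_closed_power ye_closed t x f a
  show ?thesis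
    unfolding yh_relations_def by (intro Un_least; clarify; intro cl; simp)
qed

context yokonuma
begin

abbreviation "A0 \<equiv> free_algebra (yh_gens n) :: ('k, yh_gen free_monoid \<Rightarrow>\<^sub>0 'k) module"
abbreviation "Y \<equiv> cyclotomic_yh r n d v"
abbreviation "P \<equiv> cyclotomic_proj r n d v"

lemma car_eq: "car = carrier A0"
  by (simp add: car_def carrier_free_algebra)

lemma car_closed:
  "0 \<in> car" "1 \<in> car" "const c \<in> car" "g \<in> yh_gens n \<Longrightarrow> gen g \<in> car"
  "p \<in> car \<Longrightarrow> q \<in> car \<Longrightarrow> p + q \<in> car" "p \<in> car \<Longrightarrow> q \<in> car \<Longrightarrow> p - q \<in> car"
  "p \<in> car \<Longrightarrow> q \<in> car \<Longrightarrow> p * q \<in> car"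
  by (simp_all only: car_eq free_closed)

lemma car_closed_prod_list: "(\<And>p. p \<in> set ps \<Longrightarrow> p \<in> car) \<Longrightarrow> prod_list ps \<in> car"
  unfolding car_eq by (rule free_closed_prod_list)

lemma car_closed_sum: "(\<And>x. x \<in> I \<Longrightarrow> f x \<in> car) \<Longrightarrow> (\<Sum>x\<in>I. f x) \<in> car"
  unfolding car_eq by (rule free_closed_sum)

lemma car_closed_power: "p \<in> car \<Longrightarrow> p ^ k \<in> car"
  unfolding car_eq by (rule free_closed_power)

lemma gen_car:
  "i \<in> {1..n} \<Longrightarrow> yt i \<in> car" "i \<in> {1..n} \<Longrightarrow> yx i \<in> car" "i \<in> {1..<n} \<Longrightarrow> yf i \<in> car"
  by (rule car_closed(4); force simp: yh_gens_def)+

lemma cyc_car: "cyc \<in> car"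
  unfolding cyc_def using n_pos by (intro car_closed_prod_list) (auto intro!: car_closed gen_car)

lemma monomial_car: "set ks \<subseteq> {1..<n} \<Longrightarrow> yh_monomial n s m ks \<in> car"
  unfolding yh_monomial_def
  by (intro car_closed(7) car_closed_prod_list) (auto intro!: car_closed_power gen_car)

section \<open>The two quotients as one surjection from the free algebra\<close>

sublocale q1: algebra_quotient A0 "yh_relations r n"
  by (intro algebra_quotient.intro algebra_quotient_axioms.intro assoc_algebra_free relations_closed)

lemma q1_Q: "q1.Q = affine_yh r n" and q1_pi: "q1.\<pi> = affine_proj r n"
  by (simp_all add: affine_yh_def affine_proj_def fun_eq_iff)

lemma cyc_rel_eq: "cyc_rel r n d v = affine_proj r n cyc"
  by (simp add: cyc_rel_def cyc_def)

sublocale q2: algebra_quotient "affine_yh r n" "{cyc_rel r n d v}"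
  using q1.assoc_algebra_Q q1.proj_closed[of cyc] cyc_car
  by (intro algebra_quotient.intro algebra_quotient_axioms.intro)
    (simp_all add: q1_Q q1_pi car_eq cyc_rel_eq)

lemma Y_eq: "q2.Q = Y" and P_eq: "P p = q2.\<pi> (q1.\<pi> p)"
  by (simp_all add: cyclotomic_yh_def cyclotomic_proj_def q1_pi)

lemma pi1_closed [simp]: "p \<in> car \<Longrightarrow> q1.\<pi> p \<in> carrier (affine_yh r n)"
  using q1.proj_closed[of p] by (simp add: car_eq q1_Q)

lemma P_closed [simp]: "p \<in> car \<Longrightarrow> P p \<in> carrier Y"
  using q2.proj_closed[of "q1.\<pi> p"] by (simp add: P_eq Y_eq)

lemma P_surj:
  assumes "y \<in> carrier Y"
  shows "\<exists>p\<in>car. y = P p"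
proof -
  have "y \<in> q2.\<pi> ` carrier (affine_yh r n)" using assms by (simp only: q2.proj_surj Y_eq)
  then obtain x where x: "x \<in> carrier (affine_yh r n)" "y = q2.\<pi> x" by blast
  have "x \<in> q1.\<pi> ` carrier A0" using x(1) by (simp only: q1.proj_surj q1_Q)
  then obtain p where "p \<in> carrier A0" "x = q1.\<pi> p" by blast
  then show ?thesis using x(2) by (intro bexI[of _ p]) (simp_all only: P_eq car_eq)
qed

lemma P_add: "p \<in> car \<Longrightarrow> q \<in> car \<Longrightarrow> P (p + q) = P p \<oplus>\<^bsub>Y\<^esub> P q"
  using q1.proj_add[of p q] q2.proj_add[of "q1.\<pi> p" "q1.\<pi> q"]
  by (simp add: P_eq Y_eq q1_Q car_eq[symmetric] free_algebra_sel)

lemma P_mult: "p \<in> car \<Longrightarrow> q \<in> car \<Longrightarrow> P (p * q) = P p \<otimes>\<^bsub>Y\<^esub> P q"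
  using q1.proj_mult[of p q] q2.proj_mult[of "q1.\<pi> p" "q1.\<pi> q"]
  by (simp add: P_eq Y_eq q1_Q car_eq[symmetric] free_algebra_sel)

lemma P_smult: "p \<in> car \<Longrightarrow> P (const c * p) = c \<odot>\<^bsub>Y\<^esub> P p"
  using q1.proj_smult[of p c] q2.proj_smult[of "q1.\<pi> p" c]
  by (simp add: P_eq Y_eq q1_Q car_eq[symmetric] free_algebra_sel)

lemma P_zero: "P 0 = \<zero>\<^bsub>Y\<^esub>"
  using q1.proj_zero q2.proj_zero by (simp add: P_eq Y_eq q1_Q free_algebra_sel)

lemma assoc_algebra_Y: "assoc_algebra Y"
  using q2.assoc_algebra_Q by (simp add: Y_eq)

lemma ring_Y: "ring Y"
  using assoc_algebra_Y by (simp add: assoc_algebra_def)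

lemma P_minus_zero:
  assumes "p \<in> car" and "q \<in> car"
  shows "P (p - q) = \<zero>\<^bsub>Y\<^esub> \<longleftrightarrow> P p = P q"
proof -
  interpret Y: ring Y by (rule ring_Y)
  note d = car_closed(6)[OF assms]
  have "P p = P (p - q) \<oplus>\<^bsub>Y\<^esub> P q"
    using P_add[OF d assms(2)] by simp
  then show ?thesis
    using Y.add.r_cancel_one'[OF P_closed[OF assms(2)] P_closed[OF d]] by auto
qed

definition J0 :: "'k yh_free set" where
  "J0 = {p \<in> car. P p = \<zero>\<^bsub>Y\<^esub>}"

lemma relations_J0: "yh_relations r n \<subseteq> J0"
proof
  fix p :: "'k yh_free" assume p: "p \<in> yh_relations r n"
  then have car: "p \<in> car" using relations_closed car_eq by auto
  have "p \<in> Idl\<^bsub>A0\<^esub> (yh_relations r n)"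
    using q1.genideal_self[OF relations_closed] p by auto
  then have "q1.\<pi> p = \<zero>\<^bsub>affine_yh r n\<^esub>"
    using q1.proj_eq_zero[of p] car by (simp add: car_eq q1_Q)
  then show "p \<in> J0" using car q2.proj_zero by (simp add: J0_def P_eq Y_eq)
qed

lemma cyc_J0: "cyc \<in> J0"
proof -
  have "q1.\<pi> cyc \<in> Idl\<^bsub>affine_yh r n\<^esub> {cyc_rel r n d v}"
    using q2.genideal_self' cyc_car by (simp add: cyc_rel_eq q1_pi[symmetric])
  then show ?thesis
    using q2.proj_eq_zero[of "q1.\<pi> cyc"] cyc_car by (simp add: J0_def P_eq Y_eq)
qed

lemma ideal_Phi: "ideal {p \<in> car. eqV (Phi p) 0} A0"
proof (rule idealI)
  show "ring A0" by (rule q1.ring_axioms)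
  show "subgroup {p \<in> car. eqV (Phi p) 0} (add_monoid A0)"
  proof (rule group.subgroupI[OF q1.a_group])
    show "{p \<in> car. eqV (Phi p) 0} \<noteq> {}" using car_closed(1) by (auto intro!: exI[of _ 0])
    fix p assume p: "p \<in> {p \<in> car. eqV (Phi p) 0}"
    have "\<ominus>\<^bsub>A0\<^esub> p = 0 - p"
      using p car_closed(6)[OF car_closed(1)]
      by (intro q1.minus_equality) (simp_all add: free_algebra_sel car_eq)
    moreover have "eqV (Phi (0 - p)) 0"
      unfolding Phi_simps(1,4) using p by (simp add: eqV_def app_minus_left del: diff_0)
    moreover have "0 - p \<in> car"
      using p car_closed(6)[OF car_closed(1)] by blast
    ultimately show "inv\<^bsub>add_monoid A0\<^esub> p \<in> {p \<in> car. eqV (Phi p) 0}"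
      by (simp only: a_inv_def[symmetric] mem_Collect_eq simp_thms)
  qed (auto simp: car_eq[symmetric] free_algebra_sel eqV_def app_add_left intro: car_closed)
  show "a \<otimes>\<^bsub>A0\<^esub> p \<in> {p \<in> car. eqV (Phi p) 0}" "p \<otimes>\<^bsub>A0\<^esub> a \<in> {p \<in> car. eqV (Phi p) 0}"
    if "p \<in> {p \<in> car. eqV (Phi p) 0}" "a \<in> carrier A0" for a p
    using that presD[OF pres_Phi[of a]]
    by (auto simp: car_eq[symmetric] free_algebra_sel eqV_def app_mult intro: car_closed)
qed

text \<open>The polynomials that act as zero on the truncated module form an ideal containing both
  sets of relations, hence the kernel of \<open>P\<close>: the action descends to the cyclotomic
  algebra.\<close>

lemma Phi_kernel:
  assumes "p \<in> J0"
  shows "eqV (Phi p) 0"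
proof -
  have "p \<in> {p \<in> car. eqV (Phi p) 0}"
  proof (rule iterated_quotient_kernel[OF q1.algebra_quotient_axioms _ ideal_Phi, of cyc p])
    show "yh_relations r n \<subseteq> {p \<in> car. eqV (Phi p) 0}"
      using Phi_relations relations_J0 by (auto simp: J0_def)
    show "quot_proj q1.Q {q1.\<pi> cyc} (q1.\<pi> p) = \<zero>\<^bsub>quot_algebra q1.Q {q1.\<pi> cyc}\<^esub>"
      using assms by (simp add: J0_def cyclotomic_proj_def cyclotomic_yh_def cyc_rel_eq q1_Q q1_pi)
  qed (use assms cyc_car Phi_cyc in \<open>simp_all add: J0_def car_eq\<close>)
  then show ?thesis by simp
qed

lemma P_eq_Phi:
  assumes "p \<in> car" and "q \<in> car" and "P p = P q"
  shows "eqV (Phi p) (Phi q)"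
proof -
  have "p - q \<in> J0" using assms P_minus_zero by (simp add: J0_def car_closed)
  from Phi_kernel[OF this] show ?thesis by (simp add: eqV_def app_minus_left)
qed

lemma mon_car: "u \<in> spn Trn \<Longrightarrow> mon u \<in> car"
  unfolding mon_def lext_def
proof (intro car_closed_sum car_closed(7) car_closed(3))
  fix i assume "u \<in> spn Trn" and "i \<in> keys u"
  then obtain m s w where i: "i = (m, s, w)" "w permutes {1..n}"
    by (auto simp: spn_def Trn_def Aff_def)
  then show "(case i of (m, s, w) \<Rightarrow> yh_monomial n s m (canon_word n w)) \<in> car"
    using canon_word_correct[OF i(2)] by (auto intro: monomial_car)
qed

definition e0 :: "idx \<Rightarrow>\<^sub>0 'k" where
  "e0 = bw id"

lemma e0_Trn: "e0 \<in> spn Trn"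
  unfolding e0_def by (rule bw_Trn) (rule permutes_id)

lemma R_e0: "app (opR (adj k)) e0 = app (F k) e0"
  by (simp add: e0_def)

lemma F_word_e0: "app (prod_list (map F ks)) e0 = bw (perm ks)"
  by (simp only: e0_def F_word_bw comp_id)

lemma P_mon_Phi:
  assumes "p \<in> car"
  shows "P p = P (mon (app (Phi p) e0))"
proof -
  let ?J = "{p. restrict_gens (yh_gens n) p \<in> J0}"
  have e: "restrict_gens (yh_gens n) q \<in> car" for q by (simp only: car_eq restrict_gens_closed)
  have id: "restrict_gens (yh_gens n) q = q" if "q \<in> car" for q using that by (simp only: car_eq restrict_gens_id)
  interpret Y: ring Y by (rule ring_Y)
  have "p - mon (app (Phi p) e0) \<in> ?J"
    unfolding e0_def
  proof (rule cong_mon_Phi)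
    show "0 \<in> ?J" by (simp add: restrict_gens_def J0_def P_zero car_closed)
    show "x + y \<in> ?J" if "x \<in> ?J" "y \<in> ?J" for x y
      using that e by (auto simp: restrict_gens_def free.fhom_add J0_def P_add car_closed)
    show "a * x \<in> ?J" "x * a \<in> ?J" if "x \<in> ?J" for a x
      using that e[of a] e[of x] by (auto simp: restrict_gens_def free.fhom_mult J0_def P_mult car_closed)
    show "yh_relations r n \<subseteq> ?J"
      using relations_J0 id by (auto simp: J0_def)
    show "cyc \<in> ?J" using cyc_J0 id by (simp add: J0_def)
  qed fact
  then have "restrict_gens (yh_gens n) (p - mon (app (Phi p) e0)) \<in> J0" by simp
  moreover have M: "mon (app (Phi p) e0) \<in> car"
    by (intro mon_car presD[OF pres_Phi[OF assms]] e0_Trn)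
  ultimately show ?thesis
    using assms id[OF car_closed(6)[OF assms M]] P_minus_zero[OF assms M] by (simp add: J0_def)
qed

text \<open>With \<open>P_mon_Phi\<close>, this makes evaluation at \<open>e0\<close> and
  \<open>mon\<close> inverse to each other between the cyclotomic algebra and the truncated
  module.\<close>

lemma Phi_mon: "u \<in> spn Trn \<Longrightarrow> app (Phi (mon u)) e0 = u"
proof (induction rule: spn_induct)
  case (basis i c)
  obtain m s w where i: "i = (m, s, w)" by (cases i)
  have "w permutes {1..n}" using basis by (simp add: i Trn_def Aff_def)
  then have w: "perm (canon_word n w) = w" using canon_word_correct by blast
  have "app (Phi (mon (bv i))) e0 = app (mop m s) (bw w)"
    by (simp only: i mon_bv Phi_monomial app_mult F_word_e0 w)
  then have "app (Phi (mon (bv i))) e0 = bv i"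
    using mop_bw_Trn basis by (simp only: i)
  moreover have "mon (vscale c (bv i)) = const c * mon (bv i)"
    unfolding mon_def by (rule free.lext_vscale)
  ultimately show ?case by (simp add: app_mult app_sc)
next
  case zero
  then show ?case by (simp add: mon_def)
next
  case (add u w)
  then show ?case by (simp add: mon_def free.lext_add app_add_left)
qed

section \<open>The trace property\<close>

text \<open>Stated for operators, so that the recursion for \<open>opX\<close> carries the property
  from x_1 to all x_k.\<close>

definition tracial :: "(idx, 'k) endo \<Rightarrow> bool" where
  "tracial A \<longleftrightarrow> (\<exists>p\<in>car. A = Phi p) \<and>
     (\<forall>q\<in>car. rho (app (Phi q) (app A e0)) = rho (app A (app (Phi q) e0)))"

lemma tracialI:
  assumes "p \<in> car" and "A = Phi p"
    and "\<And>q. q \<in> car \<Longrightarrow> rho (app (Phi q) (app A e0)) = rho (app A (app (Phi q) e0))"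
  shows "tracial A"
  using assms by (auto simp: tracial_def)

text \<open>rho (q a b) = rho (b q a) = rho (a b q): B is moved past q a, then A past b q.\<close>

lemma tracial_mult:
  assumes "tracial A" and "tracial B"
  shows "tracial (A * B)"
proof -
  obtain a b where a: "a \<in> car" "A = Phi a" and b: "b \<in> car" "B = Phi b"
    using assms by (auto simp: tracial_def)
  show ?thesis
  proof (rule tracialI[of "a * b"])
    fix q assume q: "q \<in> car"
    have "rho (app (Phi q) (app (A * B) e0)) = rho (app (Phi (q * a)) (app B e0))"
      by (simp add: app_mult a)
    also have "\<dots> = rho (app B (app (Phi (q * a)) e0))"
      using assms(2) car_closed(7)[OF q a(1)] unfolding tracial_def by blast
    also have "\<dots> = rho (app (Phi (b * q)) (app A e0))"
      by (simp add: app_mult a b)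
    also have "\<dots> = rho (app A (app (Phi (b * q)) e0))"
      using assms(1) car_closed(7)[OF b(1) q] unfolding tracial_def by blast
    finally show "rho (app (Phi q) (app (A * B) e0)) = rho (app (A * B) (app (Phi q) e0))"
      by (simp add: app_mult b)
  qed (use a b car_closed(7) in auto)
qed

lemma tracial_add: "tracial A \<Longrightarrow> tracial B \<Longrightarrow> tracial (A + B)"
  unfolding tracial_def
  by (auto simp: app_add_left app_add_right intro!: bexI[of _ "_ + _"] car_closed(5) Phi_simps(3)[symmetric])

lemma tracial_sc: "tracial (sc c)"
  by (rule tracialI[of "const c"]) (simp_all add: car_closed(3) app_sc app_vscale_right)

lemma tracial_zero: "tracial 0"
  by (rule tracialI[of 0]) (simp_all add: car_closed(1))

lemma tracial_one: "tracial 1"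
  by (rule tracialI[of 1]) (simp_all add: car_closed(2))

lemma tracial_power: "tracial A \<Longrightarrow> tracial (A ^ k)"
  by (induction k) (simp_all add: tracial_one tracial_mult)

lemma tracial_sum: "(\<And>x. x \<in> I \<Longrightarrow> tracial (A x)) \<Longrightarrow> tracial (\<Sum>x\<in>I. A x)"
  by (induction I rule: infinite_finite_induct) (simp_all add: tracial_zero tracial_add)

lemma tracial_prod_list: "(\<And>A. A \<in> set As \<Longrightarrow> tracial A) \<Longrightarrow> tracial (prod_list As)"
  by (induction As) (simp_all add: tracial_one tracial_mult)

lemma tracial_T: "j \<in> {1..n} \<Longrightarrow> tracial (T j)"
  by (rule tracialI[of "yt j"]) (simp_all add: gen_car e0_def rho_right_T[OF Phi_RT] del: opT_bv)

lemma tracial_F: "i \<in> {1..<n} \<Longrightarrow> tracial (F i)"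
  by (rule tracialI[of "yf i"]) (simp_all add: gen_car e0_def rho_right_F Phi_R pres_Phi del: opF_bw)

lemma tracial_E: "j \<in> {1..n} \<Longrightarrow> k \<in> {1..n} \<Longrightarrow> tracial (E j k)"
  unfolding opE_def by (intro tracial_mult tracial_sum tracial_sc tracial_power tracial_T)

lemma tracial_X_1: "tracial (opX 1)"
proof (rule tracialI[of "yx 1"])
  have 1: "1 \<in> {1..n}" using n_pos by simp
  show "yx 1 \<in> car" by (rule gen_car(2)[OF 1])
  fix q assume q: "q \<in> car"
  let ?u = "app (Phi q) e0"
  have b: "e0 \<in> spn Trn" by (rule e0_Trn)
  have u: "?u \<in> spn Trn" by (rule presD[OF pres_Phi[OF q] b])
  have X: "app (opX 1) e0 \<in> spn Trn" by (rule presD[OF pres_X_Trn[OF 1] b])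
  have *: "rho (app (Phi (mon u)) (app (opX 1) e0)) = rho (app (opX 1) u)" if "u \<in> spn Trn" for u
    using that
  proof (induction rule: spn_induct)
    case (basis i c)
    obtain m s w where i: "i = (m, s, w)" by (cases i)
    have "w permutes {1..n}" using basis by (simp add: i Trn_def Aff_def)
    then have w: "perm (canon_word n w) = w" "set (canon_word n w) \<subseteq> {1..<n}" using canon_word_correct by blast+
    have "Phi (mon (bv i)) = mop m s * prod_list (map F (canon_word n w))"
      by (simp only: i mon_bv Phi_monomial)
    then have "rho (app (Phi (mon (bv i))) (app (opX 1) e0)) =
        rho (app (opX 1) (app (Phi (mon (bv i))) e0))"
      using rho_monomial_X_1[OF _ w(2), of m s] basis w(1) i by (simp only: e0_def)
    then have "rho (app (Phi (mon (bv i))) (app (opX 1) e0)) = rho (app (opX 1) (bv i))"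
      using Phi_mon[of "bv i"] basis by simp
    moreover have "mon (vscale c (bv i)) = const c * mon (bv i)"
      unfolding mon_def by (rule free.lext_vscale)
    ultimately show ?case by (simp add: app_mult app_sc app_vscale_right)
  next
    case zero
    then show ?case by (simp add: mon_def)
  next
    case (add u w)
    then show ?case by (simp add: mon_def free.lext_add app_add_left app_add_right)
  qed
  \<comment> \<open>q and the combination \<open>mon ?u\<close> of monomials agree in the cyclotomic
    algebra, hence act alike, so the case of monomials is enough.\<close>
  have "eqV (Phi q) (Phi (mon ?u))"
    using P_eq_Phi[OF q mon_car[OF u] P_mon_Phi[OF q]] .
  then show "rho (app (Phi q) (app (opX 1) e0)) = rho (app (opX 1) ?u)"
    using *[OF u] eqVD[OF _ X] by simp
qed simp

lemma tracial_X: "k \<in> {1..n} \<Longrightarrow> tracial (opX k)"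
proof (induction k rule: opX_induct)
  case (Suc k)
  then have "tracial (opX k)" "tracial (F k)" "tracial (E k (Suc k))"
    by (simp_all add: tracial_F tracial_E)
  then show ?case using Suc.hyps by (simp add: opX_Suc tracial_add tracial_mult)
qed (simp_all add: tracial_X_1)

lemma tracial_Phi:
  assumes "p \<in> car"
  shows "tracial (Phi p)"
proof -
  have "tracial (phi g)" if "g \<in> yh_gens n" for g
    using that by (auto simp: yh_gens_def intro!: tracial_T tracial_F tracial_X)
  then show ?thesis
    unfolding Phi_def opr.fhom_def lext_def
    using assms by (intro tracial_sum tracial_mult tracial_sc tracial_prod_list) (auto simp: car_def)
qed

lemma rho_Phi_comm:
  "p \<in> car \<Longrightarrow> q \<in> car \<Longrightarrow> rho (app (Phi (p * q)) e0) = rho (app (Phi (q * p)) e0)"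
  using tracial_Phi[of q] by (simp add: tracial_def app_mult)

lemma rho_nondegenerate:
  assumes a: "a \<in> car" and z: "\<And>b. b \<in> car \<Longrightarrow> rho (app (Phi (b * a)) e0) = 0"
  shows "app (Phi a) e0 = 0"
proof -
  \<comment> \<open>The radical of the form, seen in the truncated module; it is a left ideal by
    construction.\<close>
  define U where "U = {app (Phi a) e0 | a. a \<in> car \<and> (\<forall>b\<in>car. rho (app (Phi (b * a)) e0) = 0)}"
  have UI: "app (Phi a) e0 \<in> U" if "a \<in> car" "\<And>b. b \<in> car \<Longrightarrow> rho (app (Phi (b * a)) e0) = 0" for a
    using that by (auto simp: U_def)
  have left: "app (Phi g) u \<in> U" if "u \<in> U" "g \<in> car" for g u
  proof -
    obtain a where a: "a \<in> car" "u = app (Phi a) e0"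
      "\<forall>b\<in>car. rho (app (Phi (b * a)) e0) = 0"
      using \<open>u \<in> U\<close> unfolding U_def by blast
    have "app (Phi (g * a)) e0 \<in> U"
    proof (rule UI)
      show "rho (app (Phi (b * (g * a))) e0) = 0" if "b \<in> car" for b
        using bspec[OF a(3) car_closed(7)[OF that \<open>g \<in> car\<close>]] by (simp only: mult.assoc)
    qed (rule car_closed(7)[OF that(2) a(1)])
    then show ?thesis by (simp add: a(2) app_mult)
  qed
  show ?thesis
  proof (rule U_zero[of U])
    show "app (Phi a) e0 \<in> U" by (rule UI) fact+
    show "U \<subseteq> spn Trn"
      unfolding U_def by (auto intro!: presD[OF pres_Phi] e0_Trn)
    show "app (opX k) u \<in> U" if "u \<in> U" "k \<in> {1..n}" for u k
      using left[OF that(1) gen_car(2)[OF that(2)]] by simp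
    show "app (T k) u \<in> U" if "u \<in> U" "k \<in> {1..n}" for u k
      using left[OF that(1) gen_car(1)[OF that(2)]] by simp
    show "rho u = 0" if "u \<in> U" for u
      using that car_closed(2) by (force simp: U_def)
    show "app (opR (adj k)) u \<in> U" if "u \<in> U" "k \<in> {1..<n}" for u k
    proof -
      obtain a where a: "a \<in> car" "u = app (Phi a) e0"
        "\<forall>b\<in>car. rho (app (Phi (b * a)) e0) = 0"
        using \<open>u \<in> U\<close> unfolding U_def by blast
      note f = gen_car(3)[OF that(2)]
      have "app (opR (adj k)) u = app (Phi a) (app (opR (adj k)) e0)"
        unfolding a(2) by (rule app_app_eq) (rule Phi_R)
      also have "\<dots> = app (Phi (a * yf k)) e0"
        by (simp add: app_mult R_e0)
      also have "\<dots> \<in> U"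
      proof (rule UI)
        fix b assume b: "b \<in> car"
        \<comment> \<open>The trace identity moves f_k to the far left, where it is absorbed into
          the arbitrary left factor; this gives stability on the right.\<close>
        have "rho (app (Phi ((b * a) * yf k)) e0) = rho (app (Phi (yf k * (b * a))) e0)"
          by (rule rho_Phi_comm) (use a b f car_closed(7) in auto)
        also have "\<dots> = 0"
          using bspec[OF a(3) car_closed(7)[OF f b]] by (simp only: mult.assoc)
        finally show "rho (app (Phi (b * (a * yf k))) e0) = 0" by (simp only: mult.assoc)
      qed (use a f car_closed(7) in auto)
      finally show ?thesis .
    qed
  qed
qed

section \<open>The symmetrizing form\<close>

definition rho_hat :: "'k yh_free set set \<Rightarrow> 'k" where
  "rho_hat = (\<lambda>y\<in>carrier Y. rho (app (Phi (SOME p. p \<in> car \<and> P p = y)) e0))"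

lemma rho_hat_P:
  assumes p: "p \<in> car"
  shows "rho_hat (P p) = rho (app (Phi p) e0)"
proof -
  let ?q = "SOME q. q \<in> car \<and> P q = P p"
  have q: "?q \<in> car \<and> P ?q = P p" by (rule someI[of _ p]) (simp add: p)
  then have "eqV (Phi ?q) (Phi p)" using p by (intro P_eq_Phi) auto
  from eqVD[OF this e0_Trn] show ?thesis using p by (simp add: rho_hat_def)
qed

lemma linear_form_rho_hat: "linear_form Y rho_hat"
  unfolding linear_form_def
proof (intro conjI allI ballI)
  fix a b assume "a \<in> carrier Y" "b \<in> carrier Y"
  then obtain p q where "p \<in> car" "a = P p" "q \<in> car" "b = P q" using P_surj by blast
  then show "rho_hat (a \<oplus>\<^bsub>Y\<^esub> b) = rho_hat a + rho_hat b"
    by (simp add: P_add[symmetric] rho_hat_P car_closed app_add_left)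
next
  fix c a assume "a \<in> carrier Y"
  then obtain p where "p \<in> car" "a = P p" using P_surj by blast
  then show "rho_hat (c \<odot>\<^bsub>Y\<^esub> a) = c * rho_hat a"
    by (simp add: P_smult[symmetric] rho_hat_P car_closed app_mult app_sc)
qed

lemma is_rho_hat_rho_hat: "is_rho_hat r n d v rho_hat"
  unfolding is_rho_hat_def
proof (intro conjI allI impI)
  show "rho_hat \<in> extensional (carrier Y)" by (simp add: rho_hat_def)
  show "linear_form Y rho_hat" by (rule linear_form_rho_hat)
  fix s m w ks
  assume *: "(\<forall>i\<in>{1..n}. s i \<le> r - 1) \<and> (\<forall>i\<in>{1..n}. m i \<le> d - 1) \<and> w permutes {1..n} \<and> simple_expr n ks w"
  then have ks: "set ks \<subseteq> {1..<n}" "w = perm ks" by (simp_all only: simple_expr_iff)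
  have sr: "s i < r" "m i < d" if "i \<in> {1..n}" for i
  proof -
    have "s i \<le> r - 1" "m i \<le> d - 1" using * that by auto
    then show "s i < r" "m i < d" using r_pos d_pos by linarith+
  qed
  have "rho_hat (P (yh_monomial n s m ks)) = rho (app (mop m s) (bw w))"
    by (simp only: rho_hat_P[OF monomial_car[OF ks(1)]] Phi_monomial app_mult F_word_e0 ks(2))
  also have "app (mop m s) (bw w) = bv (rst m, rst s, w)"
    using * sr by (intro mop_bw) auto
  also have "rho \<dots> = (if rst m = top \<and> rst s = (\<lambda>_. 0) \<and> w = id then 1 else 0)"
    by (rule rho_bv)
  also have "rst m = top \<longleftrightarrow> (\<forall>i\<in>{1..n}. m i = d - 1)"
    by (auto simp: rst_def top_def fun_eq_iff)
  also have "rst s = (\<lambda>_. 0) \<longleftrightarrow> (\<forall>i\<in>{1..n}. s i mod r = 0)"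
    using sr by (auto simp: rst_def fun_eq_iff)
  finally show "rho_hat (P (yh_monomial n s m ks)) =
    (if (\<forall>i\<in>{1..n}. m i = d - 1) \<and> (\<forall>i\<in>{1..n}. s i mod r = 0) \<and> w = id then 1 else 0)" .
qed

text \<open>The prescribed values include those on the monomials with canonical words, and by
  \<open>P_mon_Phi\<close> these span.\<close>

lemma is_rho_hat_unique:
  assumes "is_rho_hat r n d v \<tau>" and "is_rho_hat r n d v \<tau>'"
  shows "\<tau> = \<tau>'"
proof (rule extensionalityI)
  show "\<tau> \<in> extensional (carrier Y)" "\<tau>' \<in> extensional (carrier Y)"
    using assms by (auto simp: is_rho_hat_def)
  have lin: "linear_form Y \<tau>" "linear_form Y \<tau>'"
    using assms by (auto simp: is_rho_hat_def)
  have mon: "\<tau> (P (yh_monomial n s m (canon_word n w))) = \<tau>' (P (yh_monomial n s m (canon_word n w)))"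
    if "(m, s, w) \<in> Trn" for m s w
  proof -
    have w: "w permutes {1..n}" using that by (simp add: Trn_def Aff_def)
    have "simple_expr n (canon_word n w) w"
      using canon_word_correct[OF w] by (auto simp: simple_expr_iff)
    moreover have "s i \<le> r - 1" "m i \<le> d - 1" if "i \<in> {1..n}" for i
    proof -
      have "s i < r" "m i < d" using \<open>(m, s, w) \<in> Trn\<close> that by (auto simp: Trn_def Aff_def)
      then show "s i \<le> r - 1" "m i \<le> d - 1" by linarith+
    qed
    ultimately show ?thesis using assms w unfolding is_rho_hat_def by simp
  qed
  fix y assume "y \<in> carrier Y"
  then obtain p where p: "p \<in> car" "y = P p" using P_surj by blast
  let ?u = "app (Phi p) e0"
  have "?u \<in> spn Trn" by (intro presD[OF pres_Phi[OF p(1)]] e0_Trn)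
  then have "mon ?u \<in> car \<and> \<tau> (P (mon ?u)) = \<tau>' (P (mon ?u))"
  proof (induction rule: spn_induct)
    case zero
    have "P (const 0 * 0) = 0 \<odot>\<^bsub>Y\<^esub> P 0" by (rule P_smult) (rule car_closed)
    then have "\<tau> (P 0) = 0 * \<tau> (P 0)" "\<tau>' (P 0) = 0 * \<tau>' (P 0)"
      using lin car_closed(1) unfolding linear_form_def by (metis P_closed mult_zero_right)+
    then show ?case by (simp add: mon_def car_closed)
  next
    case (basis i c)
    have M: "mon (bv i) \<in> car" by (rule mon_car) (use basis in simp)
    have "mon (vscale c (bv i)) = const c * mon (bv i)"
      unfolding mon_def by (rule free.lext_vscale)
    moreover have "\<tau> (P (mon (bv i))) = \<tau>' (P (mon (bv i)))"
      using mon basis by (cases i) (simp only: mon_bv)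
    ultimately show ?case
      using lin M car_closed(3,7) by (simp add: P_smult linear_form_def)
  next
    case (add u w)
    have "mon (u + w) = mon u + mon w" unfolding mon_def by (rule free.lext_add)
    then show ?case using add lin car_closed(5) by (simp add: P_add linear_form_def)
  qed
  then show "\<tau> y = \<tau>' y" using P_mon_Phi[OF p(1)] p(2) by simp
qed

lemma symmetrizing_rho_hat: "symmetrizing_form Y rho_hat"
  unfolding symmetrizing_form_def
proof (intro conjI allI ballI impI)
  show "linear_form Y rho_hat" by (rule linear_form_rho_hat)
  show comm: "rho_hat (a \<otimes>\<^bsub>Y\<^esub> b) = rho_hat (b \<otimes>\<^bsub>Y\<^esub> a)" if "a \<in> carrier Y" "b \<in> carrier Y" for a b
  proof -
    obtain p q where "p \<in> car" "a = P p" "q \<in> car" "b = P q" using P_surj \<open>a \<in> _\<close> \<open>b \<in> _\<close> by blast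
    then show ?thesis using rho_Phi_comm[of p q] by (simp add: P_mult[symmetric] rho_hat_P car_closed(7))
  qed
  fix J assume J: "(left_ideal J Y \<or> right_ideal J Y) \<and> (\<forall>x\<in>J. rho_hat x = 0)"
  then have add: "additive_subgroup J Y" by (auto simp: left_ideal_def right_ideal_def)
  have "x = \<zero>\<^bsub>Y\<^esub>" if x: "x \<in> J" for x
  proof -
    have xY: "x \<in> carrier Y" using additive_subgroup.a_subset[OF add] x by auto
    then obtain p where p: "p \<in> car" "x = P p" using P_surj by blast
    \<comment> \<open>For a right ideal the trace identity first moves y to the other side.\<close>
    have *: "rho_hat (y \<otimes>\<^bsub>Y\<^esub> x) = 0" if "y \<in> carrier Y" for y
      using J x that comm[OF that xY] by (auto simp: left_ideal_def right_ideal_def)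
    have "rho (app (Phi (b * p)) e0) = 0" if "b \<in> car" for b
    proof -
      have "rho_hat (P (b * p)) = 0"
        unfolding P_mult[OF that p(1)] p(2)[symmetric] by (rule *) (rule P_closed[OF that])
      then show ?thesis by (simp only: rho_hat_P[OF car_closed(7)[OF that p(1)]])
    qed
    then have "app (Phi p) e0 = 0" by (rule rho_nondegenerate[OF p(1)])
    then have "P p = P (mon 0)" using P_mon_Phi[OF p(1)] by simp
    then show ?thesis by (simp add: p(2) mon_def P_zero)
  qed
  then show "J = {\<zero>\<^bsub>Y\<^esub>}" using additive_subgroup.zero_closed[OF add] by blast
qed

lemma finite_Trn: "finite Trn"
proof -
  let ?f = "\<lambda>b. {f. \<forall>x. (x \<in> {1..n} \<longrightarrow> f x \<in> {..<b}) \<and> (x \<notin> {1..n} \<longrightarrow> f x = (0 :: nat))}"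
  have "finite (?f d \<times> ?f r \<times> {w. w permutes {1..n}})"
    by (intro finite_cartesian_product finite_set_of_finite_funs finite_permutations) auto
  moreover have "Trn \<subseteq> ?f d \<times> ?f r \<times> {w. w permutes {1..n}}"
    by (auto simp: Trn_def Aff_def)
  ultimately show ?thesis by (rule finite_subset[rotated])
qed

lemma finite_dimensional_Y: "finite_dimensional Y"
proof -
  interpret Y: assoc_algebra Y by (rule assoc_algebra_Y)
  let ?h = "\<lambda>i. P (mon (bv i))"
  have cl: "mon (bv i) \<in> car" if "i \<in> Trn" for i by (rule mon_car) (use that in simp)
  \<comment> \<open>The coefficients in \<open>finite_dimensional\<close> are indexed by elements of
    the algebra, so distinct monomials must have distinct images; their values at \<open>e0\<close>
    tell them apart.\<close>
  have inj: "inj_on ?h Trn"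
  proof (rule inj_onI)
    fix i j assume "i \<in> Trn" "j \<in> Trn" "?h i = ?h j"
    then have "eqV (Phi (mon (bv i))) (Phi (mon (bv j)))" by (intro P_eq_Phi cl)
    from eqVD[OF this e0_Trn] have "bv i = (bv j :: idx \<Rightarrow>\<^sub>0 'k)"
      using Phi_mon \<open>i \<in> Trn\<close> \<open>j \<in> Trn\<close> by simp
    then show "i = j" by (metis keys_bv singleton_inject)
  qed
  have sum: "P (\<Sum>i\<in>I. const (c i) * mon (bv i)) = (\<Oplus>\<^bsub>Y\<^esub>i\<in>I. c i \<odot>\<^bsub>Y\<^esub> ?h i)"
    if "finite I" "I \<subseteq> Trn" for I and c :: "idx \<Rightarrow> 'k"
    using that
  proof (induction I)
    case empty
    then show ?case by (simp add: P_zero)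
  next
    case (insert i I)
    have t: "const (c j) * mon (bv j) \<in> car" if "j \<in> insert i I" for j
      using that insert.prems by (intro car_closed(7) car_closed(3) cl) auto
    have ht: "c j \<odot>\<^bsub>Y\<^esub> ?h j \<in> carrier Y" if "j \<in> insert i I" for j
      using P_closed[OF t[OF that]] P_smult[OF cl, of j "c j"] that insert.prems by auto
    show ?case
      using insert t ht cl
      by (simp add: P_add P_smult car_closed_sum Y.finsum_insert[OF insert.hyps(1,2)] Pi_def)
  qed
  show ?thesis
    unfolding finite_dimensional_def
  proof (intro exI[of _ "?h ` Trn"] conjI ballI)
    show "finite (?h ` Trn)" using finite_Trn by simp
    show "?h ` Trn \<subseteq> carrier Y" using cl by auto
    fix a assume "a \<in> carrier Y"
    then obtain p where p: "p \<in> car" "a = P p" using P_surj by blast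
    let ?u = "app (Phi p) e0"
    have u: "?u \<in> spn Trn" by (intro presD[OF pres_Phi[OF p(1)]] e0_Trn)
    let ?c = "\<lambda>i. lookup ?u i"
    have clc: "c \<odot>\<^bsub>Y\<^esub> ?h i \<in> carrier Y" if "i \<in> Trn" for c i
      unfolding P_smult[OF cl[OF that], symmetric]
      by (intro P_closed car_closed(7) car_closed(3) cl that)
    have "mon ?u = (\<Sum>i\<in>Trn. const (?c i) * mon (bv i))"
      unfolding mon_def using u finite_Trn
      by (subst free.lext_superset[of Trn]) (simp_all only: spn_def mem_Collect_eq free.lext_bv)
    then have "a = (\<Oplus>\<^bsub>Y\<^esub>i\<in>Trn. ?c i \<odot>\<^bsub>Y\<^esub> ?h i)"
      using P_mon_Phi[OF p(1)] p(2) sum[OF finite_Trn order_refl, of ?c] by simp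
    also have "\<dots> = (\<Oplus>\<^bsub>Y\<^esub>i\<in>Trn. ?c (inv_into Trn ?h (?h i)) \<odot>\<^bsub>Y\<^esub> ?h i)"
    proof (rule Y.finsum_cong')
      show "?c i \<odot>\<^bsub>Y\<^esub> ?h i = ?c (inv_into Trn ?h (?h i)) \<odot>\<^bsub>Y\<^esub> ?h i" if "i \<in> Trn" for i
        by (simp only: inv_into_f_f[OF inj that])
    qed (use clc in auto)
    also have "\<dots> = (\<Oplus>\<^bsub>Y\<^esub>b\<in>?h ` Trn. ?c (inv_into Trn ?h b) \<odot>\<^bsub>Y\<^esub> b)"
      using clc inj by (intro Y.finsum_reindex[symmetric]) auto
    finally show "\<exists>c. a = (\<Oplus>\<^bsub>Y\<^esub>b\<in>?h ` Trn. c b \<odot>\<^bsub>Y\<^esub> b)"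
      by (rule exI[of _ "\<lambda>b. ?c (inv_into Trn ?h b)"])
  qed
qed

end

theorem theorem2p4:
  fixes n r d :: nat
    and v :: "nat \<Rightarrow> 'k :: alg_closed_field"
  assumes "n \<ge> 1" and "r \<ge> 1" and "d \<ge> 1"
    and "\<not> CHAR('k) dvd r"
  shows "(\<exists>!\<rho>. is_rho_hat r n d v \<rho>) \<and>
    (\<forall>\<rho>. is_rho_hat r n d v \<rho> \<longrightarrow> symmetrizing_form (cyclotomic_yh r n d v) \<rho>) \<and>
    symmetric_algebra (cyclotomic_yh r n d v)"
proof -
  interpret yokonuma n r d v
    using assms by unfold_locales
  have "\<rho> = rho_hat" if "is_rho_hat r n d v \<rho>" for \<rho>
    by (rule is_rho_hat_unique[OF that is_rho_hat_rho_hat])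
  then show ?thesis
    using is_rho_hat_rho_hat symmetrizing_rho_hat assoc_algebra_Y finite_dimensional_Y
    unfolding symmetric_algebra_def by blast
qed

end
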